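(* Let $H$ be an autostackable [respectively, algorithmically stackable] group over an inverse-closed generating set $Y$, with associated normal form set $\mathcal N_H\subseteq Y^*$. Let $A\le H$ be generated by a finite inverse-closed set $Z\subseteq Y$, with shortlex normal form set $SL_A\subseteq Z^*$ (with respect to some total ordering of $Z$), and let $\psi:A\to H$ be a monomorphism with $\psi(Z)\subseteq Y$. Suppose further that there are regular [respectively, decidable] subsets $\mathcal N_{H/A},\mathcal N_{H/\psi(A)}\subseteq\mathcal N_H$, each containing the empty word, representing transversals of these subgroups, and that for each $z\in Z$ and $\tilde z\in\psi(Z)$ the sets $$L_z:=\{w\in\mathcal N_H\mid w=_H \tau\sigma\text{ for some }\tau\in\mathcal N_{H/A}\text{ and }\sigma\in SL_A\cap Z^*z\}$$ and $$L'_{\tilde z}:=\{w\in\mathcal N_H\mid w=_H\tau\sigma\text{ for some }\tau\in\mathcal N_{H/\psi(A)}\text{ and }\sigma\in\psi(SL_A)\cap\psi(Z)^*\tilde z\}$$ are also regular [respectively, decidable]. Then the HNN extension $G=H\ast_\psi=\langle H,s\mid sas^{-1}=\psi(a)\ (a\in A)\rangle$ is autostackable [respectively, algorithmically stackable].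
   Context: Let $G$ be a group with a finite inverse-closed generating set $X$, no element of which represents the identity. Let $\Gamma=\Gamma(G,X)$ be the Cayley graph, $\vec E$ its set of directed edges and $\vec P$ its set of directed edge paths. For $g\in G$, $a\in X$, $e_{g,a}$ is the directed edge from $g$ to $ga$ labeled $a$; $e_{g,a}$ and $e_{ga,a^{-1}}$ have the same underlying undirected edge. A flow function associated to a maximal tree $\mathcal T$ in $\Gamma$ is a function $\Phi:\vec E\to\vec P$ such that: (F1) $\Phi(e)$ has the same initial and terminal vertices as $e$; (F2d) if the undirected edge underlying $e$ lies in $\mathcal T$, then $\Phi(e)=e$; (F2r) the transitive closure of the relation $<$ on $\vec E$, where $e'<e$ whenever $e'$ lies on $\Phi(e)$ and the undirected edges underlying both $e$ and $e'$ do not lie in $\mathcal T$, is a well-founded strict partial ordering. It is bounded if there is a constant $k$ such that every path $\Phi(e)$ has length at most $k$. For $g\in G$, $\mathsf{nf}(g)\in X^*$ is the label of the unique path without backtracking in $\mathcal T$ from the identity to $g$, and $\mathcal N_{\mathcal T}=\{\mathsf{nf}(g)\mid g\in G\}$ is the associated normal form set. The stacking map $\phi:\mathcal N_{\mathcal T}\times X\to X^*$ sends $(\mathsf{nf}(g),a)$ to the label of $\Phi(e_{g,a})$, and $\mathsf{graph}(\phi)=\{(\mathsf{nf}(g),a,\phi(\mathsf{nf}(g),a))\mid g\in G,a\in X\}\subseteq (X^* )^3$. A subset $L\subseteq (X^* )^n$ is synchronously regular if the set of padded words $\{\mathsf{pad}(w)\mid w\in L\}$ is a regular language over the alphabet $(X\cup\{\$\})^n$,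 where $\$\notin X$ and $\mathsf{pad}(w_1,\dots,w_n)$ is obtained by appending letters $\$$ to the ends of the shorter $w_i$ so that all have the same length $N=\max_i l(w_i)$, and reading the result as a word of length $N$ of $n$-tuples. $G$ is autostackable (respectively, algorithmically stackable) over $X$ if there is a bounded flow function on a maximal tree of $\Gamma(G,X)$ for which $\mathsf{graph}(\phi)$ is synchronously regular (respectively, decidable, i.e. recursive). $G$ is autostackable (respectively, algorithmically stackable) if this holds for some finite inverse-closed generating set. In the claim, $\mathcal N_H$ is the normal form set $\mathcal N_{\mathcal T}$ of a fixed such structure for $H$ over $Y$. $w=_H v$ means that the words $w,v$ represent the same element of $H$. A subset $\mathcal N_{H/A}\subseteq\mathcal N_H$ represents a transversal of $A$ if the composition $\mathcal N_{H/A}\to H\to H/A$ (left cosets $hA$) is a bijection. $SL_A$ is the set of words over $Z$ that are least in the shortlex ordering among all words over $Z$ representing the same element of $A$. $\psi(SL_A)$ is the set of words over $\psi(Z)$ obtained by applying $\psi$ letter by letter, and $Z^*z$ (respectively $\psi(Z)^*\tilde z$) is the set of words over $Z$ (respectively $\psi(Z)$) ending in the letter $z$ (respectively $\tilde z$). *)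

theory Defs
  imports
    "HOL-Algebra.Generated_Groups"
    "HOL-Algebra.Left_Coset"
    "HOL-Library.Nat_Bijection"
    "Graph_Theory.Arc_Walk"
begin

section \<open>Formal languages\<close>

text \<open>Acceptance by a complete deterministic finite automaton whose states are
  (without loss of generality) natural numbers below \<open>m\<close>.\<close>

definition regular_lang :: "'l set \<Rightarrow> 'l list set \<Rightarrow> bool" where
  "regular_lang \<Sigma> L \<longleftrightarrow>
     finite \<Sigma> \<and>
     (\<exists>(m::nat) (\<delta> :: nat \<Rightarrow> 'l \<Rightarrow> nat) q0 F.
        q0 < m \<and> F \<subseteq> {..<m} \<and> (\<forall>q<m. \<forall>a\<in>\<Sigma>. \<delta> q a < m) \<and>
        L = {w \<in> lists \<Sigma>. foldl \<delta> q0 w \<in> F})"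

text \<open>An element of \<open>(X\<^sup>*)\<^sup>n\<close> is a list of \<open>n\<close> words over \<open>X\<close>.  The padding letter is
  \<^const>\<open>None\<close>, so a letter of the padded alphabet is a list of length \<open>n\<close> over
  \<open>insert None (Some ` X)\<close>.\<close>

definition word_tuples :: "'l set \<Rightarrow> nat \<Rightarrow> 'l list list set" where
  "word_tuples X n = {ws. length ws = n \<and> set ws \<subseteq> lists X}"

definition pad :: "'l list list \<Rightarrow> 'l option list list" where
  "pad ws = map (\<lambda>i. map (\<lambda>w. if i < length w then Some (w ! i) else None) ws)
              [0..<foldr max (map length ws) 0]"

definition padded_alphabet :: "'l set \<Rightarrow> nat \<Rightarrow> 'l option list set" where
  "padded_alphabet X n = {c. length c = n \<and> set c \<subseteq> insert None (Some ` X)}"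

definition sync_regular :: "'l set \<Rightarrow> nat \<Rightarrow> 'l list list set \<Rightarrow> bool" where
  "sync_regular X n L \<longleftrightarrow>
     L \<subseteq> word_tuples X n \<and> regular_lang (padded_alphabet X n) (pad ` L)"

text \<open>The total recursive functions on the natural numbers (primitive recursion and
  minimisation of regular functions).  A function of arity \<open>n\<close> is applied to argument lists
  of length \<open>n\<close>; its values on other lists are irrelevant.\<close>

inductive total_recursive :: "nat \<Rightarrow> (nat list \<Rightarrow> nat) \<Rightarrow> bool" where
  zero: "total_recursive n (\<lambda>_. 0)"
| succ: "total_recursive 1 (\<lambda>xs. Suc (xs ! 0))"
| proj: "i < n \<Longrightarrow> total_recursive n (\<lambda>xs. xs ! i)"
| comp: "\<lbrakk>total_recursive (length gs) f; \<forall>g\<in>set gs. total_recursive n g\<rbrakk>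
          \<Longrightarrow> total_recursive n (\<lambda>xs. f (map (\<lambda>g. g xs) gs))"
| prim_rec: "\<lbrakk>total_recursive n f; total_recursive (Suc (Suc n)) g\<rbrakk>
          \<Longrightarrow> total_recursive (Suc n)
                (\<lambda>xs. rec_nat (f (tl xs)) (\<lambda>k r. g (k # r # tl xs)) (hd xs))"
| minim: "\<lbrakk>total_recursive (Suc n) f; \<forall>xs. length xs = n \<longrightarrow> (\<exists>y. f (y # xs) = 0)\<rbrakk>
          \<Longrightarrow> total_recursive n (\<lambda>xs. LEAST y. f (y # xs) = 0)"

text \<open>Words over the finite alphabet are coded by numbering its letters and applying the
  standard primitive recursive bijection \<^const>\<open>list_encode\<close>.  Whether a set is decidable does
  not depend on the numbering, since any two differ by a permutation of finitely many letters.\<close>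

definition decidable_tuples :: "'l set \<Rightarrow> nat \<Rightarrow> 'l list list set \<Rightarrow> bool" where
  "decidable_tuples X n L \<longleftrightarrow>
     finite X \<and> L \<subseteq> word_tuples X n \<and>
     (\<exists>(\<iota> :: 'l \<Rightarrow> nat) f. inj_on \<iota> X \<and> total_recursive n f \<and>
        (\<forall>ns. length ns = n \<longrightarrow>
           (f ns = 0 \<longleftrightarrow> ns \<in> map (\<lambda>w. list_encode (map \<iota> w)) ` L)))"

definition decidable_lang :: "'l set \<Rightarrow> 'l list set \<Rightarrow> bool" where
  "decidable_lang X L \<longleftrightarrow> decidable_tuples X 1 ((\<lambda>w. [w]) ` L)"


section \<open>Cayley graphs, flow functions and stackability\<close>

text \<open>The letters of \<open>X\<close> are elements of the group itself.\<close>

definition inv_closed_gens :: "('a, 'b) monoid_scheme \<Rightarrow> 'a set \<Rightarrow> bool" where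
  "inv_closed_gens G X \<longleftrightarrow>
     finite X \<and> X \<subseteq> carrier G \<and> (\<forall>x\<in>X. inv\<^bsub>G\<^esub> x \<in> X) \<and> \<one>\<^bsub>G\<^esub> \<notin> X \<and>
     generate G X = carrier G"

definition word_val :: "('a, 'b) monoid_scheme \<Rightarrow> 'a list \<Rightarrow> 'a" where
  "word_val G w = foldr (\<otimes>\<^bsub>G\<^esub>) w \<one>\<^bsub>G\<^esub>"

text \<open>The pair \<open>(g, a)\<close> is the directed edge from \<open>g\<close> to \<open>g \<otimes> a\<close> with label \<open>a\<close>.\<close>

definition cayley :: "('a, 'b) monoid_scheme \<Rightarrow> 'a set \<Rightarrow> ('a, 'a \<times> 'a) pre_digraph" where
  "cayley G X = \<lparr>verts = carrier G, arcs = carrier G \<times> X,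
                 tail = fst, head = (\<lambda>(g, a). g \<otimes>\<^bsub>G\<^esub> a)\<rparr>"

definition rev_edge :: "('a, 'b) monoid_scheme \<Rightarrow> 'a \<times> 'a \<Rightarrow> 'a \<times> 'a" where
  "rev_edge G = (\<lambda>(g, a). (g \<otimes>\<^bsub>G\<^esub> a, inv\<^bsub>G\<^esub> a))"

abbreviation label :: "('a \<times> 'a) list \<Rightarrow> 'a list" where
  "label p \<equiv> map snd p"

definition no_backtrack :: "('a, 'b) monoid_scheme \<Rightarrow> ('a \<times> 'a) list \<Rightarrow> bool" where
  "no_backtrack G p \<longleftrightarrow> successively (\<lambda>e e'. e' \<noteq> rev_edge G e) p"

text \<open>A set of undirected edges is represented by the set \<open>T\<close> of all directed edges over it, so
  \<open>T\<close> is closed under reversal and \<open>e \<in> T\<close> says that the undirected edge underlying \<open>e\<close> lies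
  in the tree.  The maximal trees of the connected graph \<open>cayley G X\<close> are its subtrees containing
  every vertex; a tree is a connected graph without nontrivial closed paths that do not
  backtrack.  (The notion \<open>spanning_tree\<close> of the digraph library is about directed cycles,
  and no graph with a pair of opposite arcs satisfies it.)\<close>

definition tree_path ::
    "('a, 'b) monoid_scheme \<Rightarrow> ('a \<times> 'a) set \<Rightarrow> 'a \<Rightarrow> ('a \<times> 'a) list \<Rightarrow> 'a \<Rightarrow> bool" where
  "tree_path G T = pre_digraph.awalk (cayley G UNIV\<lparr>arcs := T\<rparr>)"

definition maximal_tree ::
    "('a, 'b) monoid_scheme \<Rightarrow> 'a set \<Rightarrow> ('a \<times> 'a) set \<Rightarrow> bool" where
  "maximal_tree G X T \<longleftrightarrow>
     T \<subseteq> arcs (cayley G X) \<and> (\<forall>e\<in>T. rev_edge G e \<in> T) \<and>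
     (\<forall>u\<in>carrier G. \<forall>v\<in>carrier G. \<exists>p. tree_path G T u p v) \<and>
     (\<forall>u p. tree_path G T u p u \<and> no_backtrack G p \<longrightarrow> p = [])"

definition nf :: "('a, 'b) monoid_scheme \<Rightarrow> ('a \<times> 'a) set \<Rightarrow> 'a \<Rightarrow> 'a list" where
  "nf G T g = label (THE p. tree_path G T \<one>\<^bsub>G\<^esub> p g \<and> no_backtrack G p)"

definition normal_forms :: "('a, 'b) monoid_scheme \<Rightarrow> ('a \<times> 'a) set \<Rightarrow> 'a list set" where
  "normal_forms G T = nf G T ` carrier G"

definition flow_less ::
    "('a, 'b) monoid_scheme \<Rightarrow> 'a set \<Rightarrow> ('a \<times> 'a) set \<Rightarrow> ('a \<times> 'a \<Rightarrow> ('a \<times> 'a) list)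
      \<Rightarrow> (('a \<times> 'a) \<times> ('a \<times> 'a)) set" where
  "flow_less G X T \<Phi> =
     {(e', e). e \<in> arcs (cayley G X) \<and> e' \<in> set (\<Phi> e) \<and> e \<notin> T \<and> e' \<notin> T}"

definition flow_function ::
    "('a, 'b) monoid_scheme \<Rightarrow> 'a set \<Rightarrow> ('a \<times> 'a) set \<Rightarrow> ('a \<times> 'a \<Rightarrow> ('a \<times> 'a) list)
      \<Rightarrow> bool" where
  "flow_function G X T \<Phi> \<longleftrightarrow>
     (\<forall>e\<in>arcs (cayley G X).
        pre_digraph.awalk (cayley G X) (tail (cayley G X) e) (\<Phi> e) (head (cayley G X) e)) \<and>
     (\<forall>e\<in>arcs (cayley G X). e \<in> T \<longrightarrow> \<Phi> e = [e]) \<and>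
     (let R = (flow_less G X T \<Phi>)\<^sup>+ in irrefl R \<and> trans R \<and> wf R)"

definition bounded_flow_function ::
    "('a, 'b) monoid_scheme \<Rightarrow> 'a set \<Rightarrow> ('a \<times> 'a) set \<Rightarrow> ('a \<times> 'a \<Rightarrow> ('a \<times> 'a) list)
      \<Rightarrow> bool" where
  "bounded_flow_function G X T \<Phi> \<longleftrightarrow>
     flow_function G X T \<Phi> \<and> (\<exists>k. \<forall>e\<in>arcs (cayley G X). length (\<Phi> e) \<le> k)"

definition stacking_graph ::
    "('a, 'b) monoid_scheme \<Rightarrow> 'a set \<Rightarrow> ('a \<times> 'a) set \<Rightarrow> ('a \<times> 'a \<Rightarrow> ('a \<times> 'a) list)
      \<Rightarrow> 'a list list set" where
  "stacking_graph G X T \<Phi> =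
     {[nf G T g, [a], label (\<Phi> (g, a))] | g a. g \<in> carrier G \<and> a \<in> X}"

definition autostackable_structure ::
    "('a, 'b) monoid_scheme \<Rightarrow> 'a set \<Rightarrow> ('a \<times> 'a) set \<Rightarrow> ('a \<times> 'a \<Rightarrow> ('a \<times> 'a) list)
      \<Rightarrow> bool" where
  "autostackable_structure G X T \<Phi> \<longleftrightarrow>
     inv_closed_gens G X \<and> maximal_tree G X T \<and> bounded_flow_function G X T \<Phi> \<and>
     sync_regular X 3 (stacking_graph G X T \<Phi>)"

definition alg_stackable_structure ::
    "('a, 'b) monoid_scheme \<Rightarrow> 'a set \<Rightarrow> ('a \<times> 'a) set \<Rightarrow> ('a \<times> 'a \<Rightarrow> ('a \<times> 'a) list)
      \<Rightarrow> bool" where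
  "alg_stackable_structure G X T \<Phi> \<longleftrightarrow>
     inv_closed_gens G X \<and> maximal_tree G X T \<and> bounded_flow_function G X T \<Phi> \<and>
     decidable_tuples X 3 (stacking_graph G X T \<Phi>)"

definition autostackable :: "('a, 'b) monoid_scheme \<Rightarrow> bool" where
  "autostackable G \<longleftrightarrow> group G \<and> (\<exists>X T \<Phi>. autostackable_structure G X T \<Phi>)"

definition alg_stackable :: "('a, 'b) monoid_scheme \<Rightarrow> bool" where
  "alg_stackable G \<longleftrightarrow> group G \<and> (\<exists>X T \<Phi>. alg_stackable_structure G X T \<Phi>)"


section \<open>Shortlex normal forms and transversals\<close>

definition shortlex_nfs ::
    "('a, 'b) monoid_scheme \<Rightarrow> 'a set \<Rightarrow> ('a \<times> 'a) set \<Rightarrow> 'a list set" where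
  "shortlex_nfs G Z r =
     {w \<in> lists Z. \<forall>v\<in>lists Z. word_val G v = word_val G w \<longrightarrow> v = w \<or> (w, v) \<in> lenlex r}"

definition represents_transversal ::
    "('a, 'b) monoid_scheme \<Rightarrow> 'a set \<Rightarrow> 'a list set \<Rightarrow> bool" where
  "represents_transversal G A N \<longleftrightarrow>
     bij_betw (\<lambda>w. word_val G w <#\<^bsub>G\<^esub> A) N (lcosets\<^bsub>G\<^esub> A)"

text \<open>With \<open>N\<close> the normal form set, \<open>C\<close> a transversal and \<open>S\<close> the set \<open>SL\<^sub>A\<close> (or its image
  under \<open>\<psi>\<close>), this is \<open>L\<^sub>z\<close> (or \<open>L'\<^sub>z\<close>).\<close>

definition last_letter_lang ::
    "('a, 'b) monoid_scheme \<Rightarrow> 'a list set \<Rightarrow> 'a list set \<Rightarrow> 'a list set \<Rightarrow> 'a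
      \<Rightarrow> 'a list set" where
  "last_letter_lang G N C S z =
     {w \<in> N. \<exists>\<tau>\<in>C. \<exists>\<sigma>\<in>S. \<sigma> \<noteq> [] \<and> last \<sigma> = z \<and> word_val G w = word_val G (\<tau> @ \<sigma>)}"


section \<open>HNN extensions\<close>

text \<open>The group \<open>\<langle>H, s | s a s\<^sup>-\<^sup>1 = \<psi> a (a \<in> A)\<rangle>\<close>: words over the elements of \<open>H\<close> and the
  letters \<open>s\<close>, \<open>s\<^sup>-\<^sup>1\<close>, modulo the congruence generated by the multiplication table of \<open>H\<close>, the
  cancellation of \<open>s\<close> and \<open>s\<^sup>-\<^sup>1\<close>, and the defining relations.\<close>

datatype 'a hnn_letter = Base 'a | Stable | StableInv

definition hnn_words :: "('a, 'b) monoid_scheme \<Rightarrow> 'a hnn_letter list set" where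
  "hnn_words H = lists (Base ` carrier H \<union> {Stable, StableInv})"

inductive hnn_eq ::
    "('a, 'b) monoid_scheme \<Rightarrow> 'a set \<Rightarrow> ('a \<Rightarrow> 'a)
      \<Rightarrow> 'a hnn_letter list \<Rightarrow> 'a hnn_letter list \<Rightarrow> bool"
  for H A \<psi> where
  refl: "hnn_eq H A \<psi> u u"
| sym: "hnn_eq H A \<psi> u v \<Longrightarrow> hnn_eq H A \<psi> v u"
| trans: "\<lbrakk>hnn_eq H A \<psi> u v; hnn_eq H A \<psi> v w\<rbrakk> \<Longrightarrow> hnn_eq H A \<psi> u w"
| cong: "hnn_eq H A \<psi> u v \<Longrightarrow> hnn_eq H A \<psi> (p @ u @ q) (p @ v @ q)"
| base_one: "hnn_eq H A \<psi> [Base \<one>\<^bsub>H\<^esub>] []"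
| base_mult: "\<lbrakk>h \<in> carrier H; k \<in> carrier H\<rbrakk>
              \<Longrightarrow> hnn_eq H A \<psi> [Base h, Base k] [Base (h \<otimes>\<^bsub>H\<^esub> k)]"
| stable_inv: "hnn_eq H A \<psi> [Stable, StableInv] []"
| inv_stable: "hnn_eq H A \<psi> [StableInv, Stable] []"
| conj: "a \<in> A \<Longrightarrow> hnn_eq H A \<psi> [Stable, Base a, StableInv] [Base (\<psi> a)]"

definition hnn_class ::
    "('a, 'b) monoid_scheme \<Rightarrow> 'a set \<Rightarrow> ('a \<Rightarrow> 'a)
      \<Rightarrow> 'a hnn_letter list \<Rightarrow> 'a hnn_letter list set" where
  "hnn_class H A \<psi> w = {v. hnn_eq H A \<psi> w v}"

definition HNN ::
    "('a, 'b) monoid_scheme \<Rightarrow> 'a set \<Rightarrow> ('a \<Rightarrow> 'a) \<Rightarrow> 'a hnn_letter list set monoid" where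
  "HNN H A \<psi> =
     \<lparr>carrier = hnn_class H A \<psi> ` hnn_words H,
      mult = (\<lambda>U V. {w. \<exists>u\<in>U. \<exists>v\<in>V. hnn_eq H A \<psi> (u @ v) w}),
      one = hnn_class H A \<psi> []\<rparr>"

lemma hnn_eq_append:
  assumes "hnn_eq H A \<psi> u u'" "hnn_eq H A \<psi> v v'"
  shows "hnn_eq H A \<psi> (u @ v) (u' @ v')"
  using hnn_eq.cong[OF assms(1), of "[]" v] hnn_eq.cong[OF assms(2), of u' "[]"]
  by (auto intro: hnn_eq.trans)

lemma hnn_class_eq_iff: "hnn_class H A \<psi> u = hnn_class H A \<psi> v \<longleftrightarrow> hnn_eq H A \<psi> u v"
  unfolding hnn_class_def by (blast intro: hnn_eq.refl hnn_eq.sym hnn_eq.trans)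

lemma hnn_mult_class:
  "hnn_class H A \<psi> u \<otimes>\<^bsub>HNN H A \<psi>\<^esub> hnn_class H A \<psi> v = hnn_class H A \<psi> (u @ v)"
proof -
  have "hnn_eq H A \<psi> (u @ v) w"
    if "hnn_eq H A \<psi> u u'" "hnn_eq H A \<psi> v v'" "hnn_eq H A \<psi> (u' @ v') w" for u' v' w
    using hnn_eq_append[OF that(1,2)] that(3) by (rule hnn_eq.trans)
  then show ?thesis
    unfolding HNN_def hnn_class_def by (auto intro: hnn_eq.refl)
qed

lemma hnn_inverse_letter:
  assumes "group H" "x \<in> Base ` carrier H \<union> {Stable, StableInv}"
  shows "\<exists>y \<in> Base ` carrier H \<union> {Stable, StableInv}. hnn_eq H A \<psi> [y, x] []"
proof -
  interpret group H by fact
  consider h where "h \<in> carrier H" "x = Base h" | "x = Stable" | "x = StableInv"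
    using assms(2) by auto
  then show ?thesis
  proof cases
    case 1
    then have "hnn_eq H A \<psi> [Base (inv\<^bsub>H\<^esub> h), Base h] [Base (inv\<^bsub>H\<^esub> h \<otimes>\<^bsub>H\<^esub> h)]"
      by (intro hnn_eq.base_mult) auto
    with 1 show ?thesis
      by (intro bexI[of _ "Base (inv\<^bsub>H\<^esub> h)"]) (auto intro: hnn_eq.trans hnn_eq.base_one)
  qed (auto intro: hnn_eq.stable_inv hnn_eq.inv_stable)
qed

lemma hnn_inverse_word:
  assumes "group H" "w \<in> hnn_words H"
  shows "\<exists>v \<in> hnn_words H. hnn_eq H A \<psi> (v @ w) []"
  using assms(2)
proof (induction w)
  case Nil
  then show ?case by (auto intro!: bexI[of _ "[]"] hnn_eq.refl simp: hnn_words_def)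
next
  case (Cons x w)
  then have x: "x \<in> Base ` carrier H \<union> {Stable, StableInv}" and w: "w \<in> hnn_words H"
    by (auto simp: hnn_words_def)
  obtain y where y: "y \<in> Base ` carrier H \<union> {Stable, StableInv}" "hnn_eq H A \<psi> [y, x] []"
    using hnn_inverse_letter[OF assms(1) x] by blast
  obtain v where v: "v \<in> hnn_words H" "hnn_eq H A \<psi> (v @ w) []"
    using Cons.IH[OF w] by blast
  have "hnn_eq H A \<psi> (v @ [y, x] @ w) (v @ [] @ w)"
    by (rule hnn_eq.cong) (rule y)
  then have "hnn_eq H A \<psi> ((v @ [y]) @ x # w) []"
    using v(2) by (auto intro: hnn_eq.trans)
  moreover have "v @ [y] \<in> hnn_words H"
    using v(1) y(1) by (auto simp: hnn_words_def)
  ultimately show ?case by blast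
qed

lemma group_HNN:
  assumes "group H"
  shows "group (HNN H A \<psi>)"
proof (rule groupI)
  have app: "u @ v \<in> hnn_words H" if "u \<in> hnn_words H" "v \<in> hnn_words H" for u v
    using that by (auto simp: hnn_words_def)
  have car: "carrier (HNN H A \<psi>) = hnn_class H A \<psi> ` hnn_words H"
    and one: "\<one>\<^bsub>HNN H A \<psi>\<^esub> = hnn_class H A \<psi> []"
    by (auto simp: HNN_def)
  show "x \<otimes>\<^bsub>HNN H A \<psi>\<^esub> y \<in> carrier (HNN H A \<psi>)"
    if "x \<in> carrier (HNN H A \<psi>)" "y \<in> carrier (HNN H A \<psi>)" for x y
    using that app by (auto simp: car hnn_mult_class)
  show "\<one>\<^bsub>HNN H A \<psi>\<^esub> \<in> carrier (HNN H A \<psi>)"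
    by (auto simp: car one hnn_words_def)
  show "x \<otimes>\<^bsub>HNN H A \<psi>\<^esub> y \<otimes>\<^bsub>HNN H A \<psi>\<^esub> z = x \<otimes>\<^bsub>HNN H A \<psi>\<^esub> (y \<otimes>\<^bsub>HNN H A \<psi>\<^esub> z)"
    if "x \<in> carrier (HNN H A \<psi>)" "y \<in> carrier (HNN H A \<psi>)" "z \<in> carrier (HNN H A \<psi>)" for x y z
    using that by (auto simp: car hnn_mult_class)
  show "\<one>\<^bsub>HNN H A \<psi>\<^esub> \<otimes>\<^bsub>HNN H A \<psi>\<^esub> x = x" if "x \<in> carrier (HNN H A \<psi>)" for x
    using that by (auto simp: car one hnn_mult_class)
  show "\<exists>y\<in>carrier (HNN H A \<psi>). y \<otimes>\<^bsub>HNN H A \<psi>\<^esub> x = \<one>\<^bsub>HNN H A \<psi>\<^esub>"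
    if "x \<in> carrier (HNN H A \<psi>)" for x
    using that hnn_inverse_word[OF assms, of _ A \<psi>]
    by (fastforce simp: car one hnn_mult_class hnn_class_eq_iff)
qed

end

theory Submission
  imports Defs
begin

text \<open>Choose transversals of \<open>\<psi> A\<close> and \<open>A\<close> in \<open>H\<close>, to be used before \<open>s\<close> and before
  \<open>s\<inverse>\<close> respectively.  Every element of the extension is then uniquely
  \<open>\<tau>\<^sub>1 s\<^bsup>\<epsilon>\<^sub>1\<^esup> \<dots> \<tau>\<^sub>n s\<^bsup>\<epsilon>\<^sub>n\<^esup> h\<close> without a cancelling \<open>s\<^bsup>-\<epsilon>\<^esup> 1 s\<^bsup>\<epsilon>\<^esup>\<close>, and writing the factors
  \<open>\<tau>\<^sub>i\<close> and \<open>h\<close> in the normal forms of \<open>H\<close> gives the words read along a maximal tree.  The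
  flow function of \<open>H\<close> is translated to the cosets \<open>g H\<close>.  An edge from \<open>g h\<close> labelled \<open>s\<^bsup>\<epsilon>\<^esup>\<close>
  outside the tree has \<open>h = \<tau> \<sigma>\<close> with \<open>\<sigma> \<noteq> 1\<close> in shortlex form; if \<open>\<sigma>\<close> ends in \<open>z\<close>, the edge
  is sent to the path labelled \<open>z\<inverse> s\<^bsup>\<epsilon>\<^esup> z'\<close> with \<open>z s\<^bsup>\<epsilon>\<^esup> = s\<^bsup>\<epsilon>\<^esup> z'\<close>, on which the edge
  labelled \<open>s\<^bsup>\<epsilon>\<^esup>\<close> has a shorter \<open>\<sigma>\<close>.  The normal forms of the \<open>g h\<close> for which a letter has
  a given flow path are the words all of whose segments between stable letters lie in languages
  that are regular (decidable) by hypothesis, which a left-to-right scan recognises.\<close>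

section \<open>Recursive functions\<close>

text \<open>Flow labels have bounded length, so the graph of a stacking map amounts to finitely many
  languages, its slices by letter and label; the regular and the decidable claim then differ only in
  the class of languages to be preserved. The label chosen at \<open>g h\<close> depends on
  \<open>h\<close> alone, and for a stable letter outside the tree it reveals just the last letter
  of the geodesic \<open>\<sigma>\<close>. This is what the hypotheses on the languages of last
  letters are for: they describe the possible last segments, while earlier segments range over
  transversal words. Moving a single letter across, instead of all of \<open>\<sigma>\<close>, is
  forced by boundedness; iterating the flow completes the move. Well-foundedness has to combine this
  with the flow order of \<open>H\<close>: edges with base letters are placed below all edges with
  stable letters, and among the latter the length of \<open>\<sigma>\<close> drops. Paths in the
  extension are awkward to handle directly, so \<open>nf_system\<close> replaces the tree condition
  by one on single edges. Uniqueness of reduced expressions enters twice, to index the vertices and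
  to keep the generators distinct.\<close>

text \<open>\<^const>\<open>total_recursive\<close> also determines the values on lists of the wrong length, so it is
  not closed under extensional equality on the intended arguments; \<open>recf\<close> is.\<close>

definition recf :: "nat \<Rightarrow> (nat list \<Rightarrow> nat) \<Rightarrow> bool" where
  "recf n f \<longleftrightarrow> (\<exists>f'. total_recursive n f' \<and> (\<forall>xs. length xs = n \<longrightarrow> f' xs = f xs))"

definition recf1 :: "(nat \<Rightarrow> nat) \<Rightarrow> bool" where
  "recf1 g \<longleftrightarrow> recf 1 (\<lambda>xs. g (xs ! 0))"

definition recf2 :: "(nat \<Rightarrow> nat \<Rightarrow> nat) \<Rightarrow> bool" where
  "recf2 g \<longleftrightarrow> recf 2 (\<lambda>xs. g (xs ! 0) (xs ! 1))"

lemma recf1I: "recf 1 (\<lambda>xs. g (xs ! 0)) \<Longrightarrow> recf1 g"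
  by (simp add: recf1_def)

lemma recf2I: "recf 2 (\<lambda>xs. g (xs ! 0) (xs ! 1)) \<Longrightarrow> recf2 g"
  by (simp add: recf2_def)

lemma recf_cong: "recf n f \<Longrightarrow> (\<And>xs. length xs = n \<Longrightarrow> f xs = g xs) \<Longrightarrow> recf n g"
  unfolding recf_def by fastforce

lemma recf_total: "total_recursive n f \<Longrightarrow> recf n f"
  unfolding recf_def by blast

lemma recf_proj: "i < n \<Longrightarrow> recf n (\<lambda>xs. xs ! i)"
  by (intro recf_total total_recursive.proj)

lemma recf_comp:
  assumes f: "recf (length gs) f" and gs: "\<forall>g\<in>set gs. recf n g"
  shows "recf n (\<lambda>xs. f (map (\<lambda>g. g xs) gs))"
proof -
  obtain f' where f': "total_recursive (length gs) f'"
      "\<forall>xs. length xs = length gs \<longrightarrow> f' xs = f xs"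
    using f unfolding recf_def by blast
  obtain c where c: "\<forall>g\<in>set gs. total_recursive n (c g) \<and> (\<forall>xs. length xs = n \<longrightarrow> c g xs = g xs)"
    using gs unfolding recf_def by metis
  have "total_recursive n (\<lambda>xs. f' (map (\<lambda>g. g xs) (map c gs)))"
    using f' c by (intro total_recursive.comp) auto
  moreover have "f' (map (\<lambda>g. g xs) (map c gs)) = f (map (\<lambda>g. g xs) gs)" if "length xs = n" for xs
    using that c f'(2) by (auto simp: comp_def cong: map_cong)
  ultimately show ?thesis unfolding recf_def by blast
qed

lemma recf_comp1: "recf1 g \<Longrightarrow> recf n f \<Longrightarrow> recf n (\<lambda>xs. g (f xs))"
  using recf_comp[of "[f]" "\<lambda>xs. g (xs ! 0)" n] by (simp add: recf1_def)

lemma recf_comp2: "recf2 g \<Longrightarrow> recf n f \<Longrightarrow> recf n f' \<Longrightarrow> recf n (\<lambda>xs. g (f xs) (f' xs))"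
  using recf_comp[of "[f, f']" "\<lambda>xs. g (xs ! 0) (xs ! 1)" n]
  by (simp add: recf2_def numeral_2_eq_2)

lemma recf_Suc: "recf n f \<Longrightarrow> recf n (\<lambda>xs. Suc (f xs))"
  by (rule recf_comp1[of Suc, OF recf1I[OF recf_total[OF total_recursive.succ]]])

lemma recf_const: "recf n (\<lambda>_. c)"
  by (induction c) (auto intro: recf_Suc recf_total total_recursive.zero)

text \<open>The scheme \<open>prim_rec\<close> recurses on the head of the argument list. Feeding it
  the list with \<open>m xs\<close> put in front of all projections lets the number of steps depend
  on the parameters.\<close>

lemma recf_rec_nat:
  assumes m: "recf n m" and a: "recf n a" and g: "recf (Suc (Suc n)) g"
  shows "recf n (\<lambda>xs. rec_nat (a xs) (\<lambda>k r. g (k # r # xs)) (m xs))"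
proof -
  obtain a' where a': "total_recursive n a'" "\<forall>xs. length xs = n \<longrightarrow> a' xs = a xs"
    using a unfolding recf_def by blast
  obtain g' where g': "total_recursive (Suc (Suc n)) g'"
      "\<forall>xs. length xs = Suc (Suc n) \<longrightarrow> g' xs = g xs"
    using g unfolding recf_def by blast
  define F where "F = (\<lambda>xs. rec_nat (a' (tl xs)) (\<lambda>k r. g' (k # r # tl xs)) (hd xs))"
  have "recf (Suc n) F"
    unfolding F_def by (intro recf_total total_recursive.prim_rec a' g')
  then have "recf n (\<lambda>xs. F (map (\<lambda>g. g xs) (m # map (\<lambda>i xs. xs ! i) [0..<n])))"
    using m by (intro recf_comp) (auto intro: recf_proj)
  then show ?thesis
  proof (rule recf_cong)
    fix xs :: "nat list" assume len: "length xs = n"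
    have "map (\<lambda>g. g xs) (m # map (\<lambda>i xs. xs ! i) [0..<n]) = m xs # xs"
      using len by (auto simp: comp_def intro: nth_equalityI)
    moreover have "(\<lambda>k r. g' (k # r # xs)) = (\<lambda>k r. g (k # r # xs))"
      using g'(2) len by auto
    ultimately show "F (map (\<lambda>g. g xs) (m # map (\<lambda>i xs. xs ! i) [0..<n])) =
        rec_nat (a xs) (\<lambda>k r. g (k # r # xs)) (m xs)"
      using a'(2) len by (simp add: F_def)
  qed
qed

lemma recf_minim:
  assumes f: "recf (Suc n) f" and ex: "\<And>xs. length xs = n \<Longrightarrow> \<exists>y. f (y # xs) = 0"
  shows "recf n (\<lambda>xs. LEAST y. f (y # xs) = 0)"
proof -
  obtain f' where f': "total_recursive (Suc n) f'"
      "\<forall>xs. length xs = Suc n \<longrightarrow> f' xs = f xs"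
    using f unfolding recf_def by blast
  have "total_recursive n (\<lambda>xs. LEAST y. f' (y # xs) = 0)"
    using f' ex by (intro total_recursive.minim) auto
  then show ?thesis
    by (rule recf_cong[OF recf_total]) (use f'(2) in simp)
qed

lemma recf2_add: "recf2 (+)"
proof (rule recf2I)
  have "recf 2 (\<lambda>xs. rec_nat (xs ! 0) (\<lambda>k r. Suc ((k # r # xs) ! 1)) (xs ! 1))"
    by (intro recf_rec_nat recf_Suc recf_proj) auto
  moreover have "rec_nat a (\<lambda>k. Suc) b = a + b" for a b by (induction b) auto
  ultimately show "recf 2 (\<lambda>xs. xs ! 0 + xs ! 1)" by simp
qed

lemma recf1_pred: "recf1 (\<lambda>x. x - 1)"
proof (rule recf1I)
  have "recf 1 (\<lambda>xs. rec_nat 0 (\<lambda>k r. (k # r # xs) ! 0) (xs ! 0))"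
    by (intro recf_rec_nat recf_const recf_proj) auto
  moreover have "rec_nat 0 (\<lambda>k r. k) b = b - 1" for b by (cases b) auto
  ultimately show "recf 1 (\<lambda>xs. xs ! 0 - 1)" by simp
qed

lemma recf2_diff: "recf2 (-)"
proof (rule recf2I)
  have "recf 2 (\<lambda>xs. rec_nat (xs ! 0) (\<lambda>k r. (k # r # xs) ! 1 - 1) (xs ! 1))"
    by (intro recf_rec_nat recf_comp1[OF recf1_pred] recf_proj) auto
  moreover have "rec_nat a (\<lambda>k r. r - Suc 0) b = a - b" for a b by (induction b) auto
  ultimately show "recf 2 (\<lambda>xs. xs ! 0 - xs ! 1)" by simp
qed

lemma recf_add: "recf n f \<Longrightarrow> recf n g \<Longrightarrow> recf n (\<lambda>xs. f xs + g xs)"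
  by (rule recf_comp2[OF recf2_add])

lemma recf_diff: "recf n f \<Longrightarrow> recf n g \<Longrightarrow> recf n (\<lambda>xs. f xs - g xs)"
  by (rule recf_comp2[OF recf2_diff])

text \<open>A case distinction is a primitive recursion over \<open>c xs\<close> steps: no step
  leaves \<open>f\<close>, and any step forgets the counter and the previous value and returns
  \<open>g\<close>. Hence \<open>g\<close> has to be read from a list with two extra entries in
  front.\<close>

lemma recf_if_zero:
  assumes "recf n c" "recf n f" "recf n g"
  shows "recf n (\<lambda>xs. if c xs = 0 then f xs else g xs)"
proof -
  have g: "recf (Suc (Suc n)) (\<lambda>xs. g (tl (tl xs)))"
  proof (rule recf_cong)
    show "recf (Suc (Suc n)) (\<lambda>xs. g (map (\<lambda>g. g xs) (map (\<lambda>i xs. xs ! Suc (Suc i)) [0..<n])))"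
      using assms(3) by (intro recf_comp) (auto intro: recf_proj)
    fix xs :: "nat list" assume "length xs = Suc (Suc n)"
    then have "map (\<lambda>g. g xs) (map (\<lambda>i xs. xs ! Suc (Suc i)) [0..<n]) = tl (tl xs)"
      by (auto simp: comp_def nth_tl intro!: nth_equalityI)
    then show "g (map (\<lambda>g. g xs) (map (\<lambda>i xs. xs ! Suc (Suc i)) [0..<n])) = g (tl (tl xs))"
      by simp
  qed
  have "rec_nat a (\<lambda>k r. b) m = (if m = 0 then a else b)" for a b m :: nat
    by (cases m) auto
  then show ?thesis
    using recf_rec_nat[OF assms(1,2) g] by simp
qed

text \<open>Truth is the value zero, in line with \<open>decidable_tuples\<close>; a conjunction
  then becomes a sum of indicators.\<close>

definition recp :: "nat \<Rightarrow> (nat list \<Rightarrow> bool) \<Rightarrow> bool" where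
  "recp n P \<longleftrightarrow> (\<exists>f. recf n f \<and> (\<forall>xs. length xs = n \<longrightarrow> (P xs \<longleftrightarrow> f xs = 0)))"

lemma recp_if: "recp n P \<Longrightarrow> recf n f \<Longrightarrow> recf n g \<Longrightarrow> recf n (\<lambda>xs. if P xs then f xs else g xs)"
  unfolding recp_def using recf_if_zero by (auto intro: recf_cong[OF recf_if_zero])

lemma recp_zero: "recf n f \<Longrightarrow> recp n (\<lambda>xs. f xs = 0)"
  unfolding recp_def by blast

lemma recp_indicator: "recp n P \<Longrightarrow> recf n (\<lambda>xs. if P xs then 0 else 1)"
  by (intro recp_if recf_const)

lemma recp_cong: "recp n P \<Longrightarrow> (\<And>xs. length xs = n \<Longrightarrow> P xs = Q xs) \<Longrightarrow> recp n Q"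
  unfolding recp_def by metis

lemma recp_and: "recp n P \<Longrightarrow> recp n Q \<Longrightarrow> recp n (\<lambda>xs. P xs \<and> Q xs)"
  by (rule recp_cong[OF recp_zero[OF recf_add[OF recp_indicator recp_indicator]], of _ P Q]) auto

lemma recp_not: "recp n P \<Longrightarrow> recp n (\<lambda>xs. \<not> P xs)"
  by (rule recp_cong[OF recp_zero[OF recp_if[OF _ recf_const[of _ 1] recf_const[of _ 0]]], of _ P]) auto

lemma recp_or: "recp n P \<Longrightarrow> recp n Q \<Longrightarrow> recp n (\<lambda>xs. P xs \<or> Q xs)"
  using recp_not[OF recp_and[OF recp_not recp_not, of n P Q]] by simp

lemma recp_less: "recf n f \<Longrightarrow> recf n g \<Longrightarrow> recp n (\<lambda>xs. f xs < g xs)"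
  by (rule recp_cong[OF recp_zero[of n "\<lambda>xs. Suc (f xs) - g xs"]])
    (auto intro: recf_diff recf_Suc)

lemma recp_eq: "recf n f \<Longrightarrow> recf n g \<Longrightarrow> recp n (\<lambda>xs. f xs = g xs)"
  by (rule recp_cong[OF recp_and[OF recp_not recp_not, OF recp_less recp_less, of n f g g f]]) auto

lemma recp_False: "recp n (\<lambda>_. False)"
  using recp_zero[OF recf_const[of n 1]] by simp

lemma recp_Bex: "finite S \<Longrightarrow> (\<And>s. s \<in> S \<Longrightarrow> recp n (P s)) \<Longrightarrow> recp n (\<lambda>xs. \<exists>s\<in>S. P s xs)"
  by (induction S rule: finite_induct) (auto intro: recp_False recp_or)

lemma recp_comp1: "recp 1 (\<lambda>xs. P (xs ! 0)) \<Longrightarrow> recf n f \<Longrightarrow> recp n (\<lambda>xs. P (f xs))"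
proof -
  assume "recp 1 (\<lambda>xs. P (xs ! 0))" and f: "recf n f"
  then have "recf1 (\<lambda>x. if P x then 0 else 1)"
    by (intro recf1I recp_indicator)
  from recp_zero[OF recf_comp1[OF this f]] show ?thesis
    by (rule recp_cong) auto
qed

section \<open>Pairs and lists\<close>

lemma recf1_triangle: "recf1 triangle"
proof (rule recf1I)
  have "recf 1 (\<lambda>xs. rec_nat 0 (\<lambda>k r. (k # r # xs) ! 1 + Suc ((k # r # xs) ! 0)) (xs ! 0))"
    by (intro recf_rec_nat recf_add recf_Suc recf_const recf_proj) auto
  moreover have "rec_nat 0 (\<lambda>k r. r + Suc k) b = triangle b" for b by (induction b) auto
  ultimately show "recf 1 (\<lambda>xs. triangle (xs ! 0))" by simp
qed

lemma recf_pair: "recf n f \<Longrightarrow> recf n g \<Longrightarrow> recf n (\<lambda>xs. prod_encode (f xs, g xs))"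
  unfolding prod_encode_def prod.case by (intro recf_add recf_comp1[OF recf1_triangle])

lemma triangle_mono: "m \<le> n \<Longrightarrow> triangle m \<le> triangle n"
  by (induction n) (auto simp: le_Suc_eq)

text \<open>A pair has the code \<open>triangle (a + b) + a\<close>, which lies between
  \<open>triangle (a + b)\<close> and the next triangular number. Minimisation therefore finds
  \<open>a + b\<close>, and with it both components.\<close>

lemma triangle_root: "(LEAST k. n < triangle (Suc k)) = (case prod_decode n of (a, b) \<Rightarrow> a + b)"
proof -
  obtain a b where ab: "prod_decode n = (a, b)" by force
  then have n: "n = triangle (a + b) + a"
    using prod_decode_inverse[of n] by (simp add: prod_encode_def)
  have "(LEAST k. n < triangle (Suc k)) = a + b"
  proof (rule Least_equality)
    show "n < triangle (Suc (a + b))" by (simp add: n)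
    show "a + b \<le> k" if "n < triangle (Suc k)" for k
    proof (rule ccontr)
      assume "\<not> a + b \<le> k"
      then have "triangle (Suc k) \<le> triangle (a + b)" by (intro triangle_mono) auto
      with that n show False by simp
    qed
  qed
  then show ?thesis by (simp add: ab)
qed

lemma recf1_prod_decode:
  shows recf1_fst: "recf1 (\<lambda>n. fst (prod_decode n))"
    and recf1_snd: "recf1 (\<lambda>n. snd (prod_decode n))"
proof -
  define s where "s = (\<lambda>n. case prod_decode n of (a, b) \<Rightarrow> a + b)"
  have n: "n = triangle (s n) + fst (prod_decode n)" for n
    using prod_decode_inverse[of n] by (simp add: s_def prod_encode_def split: prod.splits)
  \<comment> \<open>Truncated subtraction from the successor vanishes exactly when the argument is
    below \<open>triangle (Suc y)\<close>.\<close>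
  have "recf 1 (\<lambda>xs. LEAST y. Suc ((y # xs) ! 1) - triangle (Suc ((y # xs) ! 0)) = 0)"
  proof (rule recf_minim)
    show "recf (Suc 1) (\<lambda>xs. Suc (xs ! 1) - triangle (Suc (xs ! 0)))"
      by (intro recf_diff recf_Suc recf_comp1[OF recf1_triangle] recf_proj) auto
    fix xs :: "nat list" assume "length xs = 1"
    show "\<exists>y. Suc ((y # xs) ! 1) - triangle (Suc ((y # xs) ! 0)) = 0"
      by (rule exI[of _ "xs ! 0"]) simp
  qed
  then have s: "recf1 s"
    unfolding recf1_def s_def triangle_root[symmetric] by (simp add: less_Suc_eq_le)
  have "fst (prod_decode n) = n - triangle (s n)" for n
    using n[of n] by simp
  moreover have "recf1 (\<lambda>n. n - triangle (s n))"
    by (intro recf1I recf_diff recf_comp1[OF recf1_triangle] recf_comp1[OF s] recf_proj) auto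
  ultimately show 1: "recf1 (\<lambda>n. fst (prod_decode n))" by simp
  have "snd (prod_decode n) = s n - fst (prod_decode n)" for n
    by (simp add: s_def split: prod.splits)
  moreover have "recf1 (\<lambda>n. s n - fst (prod_decode n))"
    by (intro recf1I recf_diff recf_comp1[OF s] recf_comp1[OF 1] recf_proj) auto
  ultimately show "recf1 (\<lambda>n. snd (prod_decode n))" by simp
qed

lemmas recf_fst = recf_comp1[OF recf1_fst]
lemmas recf_snd = recf_comp1[OF recf1_snd]

text \<open>Makes the code of a list a sufficient number of iterations for reading it to the
  end.\<close>

lemma length_le_list_encode: "length xs \<le> list_encode xs"
  by (induction xs) (auto intro: le_trans[OF _ le_prod_encode_2])

text \<open>Folds are computed by iterating a step on codes of pairs (unread list, accumulator).\<close>

lemma recf1_foldl: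
  assumes g: "recf2 g"
  shows "recf1 (\<lambda>n. foldl g a (list_decode n))"
proof -
  \<comment> \<open>Code 0 is the empty list; otherwise subtracting one exposes the pair of head and
    tail. On an exhausted list the step is the identity, so surplus iterations do no harm.\<close>
  define step where "step = (\<lambda>st. if fst (prod_decode st) = 0 then st
    else prod_encode (snd (prod_decode (fst (prod_decode st) - 1)),
           g (snd (prod_decode st)) (fst (prod_decode (fst (prod_decode st) - 1)))))"
  have "recf1 step"
    unfolding step_def
    by (intro recf1I recf_if_zero recf_pair recf_comp2[OF g] recf_fst recf_snd recf_proj
        recf_comp1[OF recf1_pred]) auto
  then have "recf 1 (\<lambda>xs. rec_nat (prod_encode (xs ! 0, a)) (\<lambda>k r. step ((k # r # xs) ! 1)) (xs ! 0))"
    by (intro recf_rec_nat recf_comp1[of step] recf_pair recf_const recf_proj) auto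
  then have "recf1 (\<lambda>n. snd (prod_decode (rec_nat (prod_encode (n, a)) (\<lambda>k. step) n)))"
    by (intro recf1I recf_snd) simp
  moreover have "snd (prod_decode (rec_nat (prod_encode (n, a)) (\<lambda>k. step) n)) =
      foldl g a (list_decode n)" for n
  proof -
    have "rec_nat (prod_encode (list_encode ys, a)) (\<lambda>k. step) k =
        prod_encode (list_encode (drop k ys), foldl g a (take k ys))" for k ys
    proof (induction k)
      case (Suc k)
      show ?case
      proof (cases "k < length ys")
        case True
        then have "drop k ys = ys ! k # drop (Suc k) ys" by (rule Cons_nth_drop_Suc[symmetric])
        then show ?thesis using Suc True by (simp add: step_def take_Suc_conv_app_nth)
      next
        case False
        then show ?thesis using Suc by (simp add: step_def)
      qed
    qed simp
    from this[of "list_decode n" n] show ?thesis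
      using length_le_list_encode[of "list_decode n"] by simp
  qed
  ultimately show ?thesis by simp
qed

lemma recf_Cons: "recf n f \<Longrightarrow> recf n g \<Longrightarrow> recf n (\<lambda>xs. Suc (prod_encode (f xs, g xs)))"
  by (intro recf_Suc recf_pair)

lemma recf1_rev: "recf1 (\<lambda>n. list_encode (rev (list_decode n)))"
proof -
  have "recf1 (\<lambda>n. foldl (\<lambda>acc x. Suc (prod_encode (x, acc))) 0 (list_decode n))"
    by (intro recf1_foldl recf2I recf_Cons recf_proj) auto
  moreover have "foldl (\<lambda>acc x. Suc (prod_encode (x, acc))) (list_encode ys) xs =
      list_encode (rev xs @ ys)" for xs ys
    by (induction xs arbitrary: ys) (simp_all flip: list_encode.simps(2))
  from this[of "[]"] have "foldl (\<lambda>acc x. Suc (prod_encode (x, acc))) 0 xs =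
      list_encode (rev xs)" for xs by simp
  ultimately show ?thesis by simp
qed

lemma recf1_map:
  assumes "recf1 g"
  shows "recf1 (\<lambda>n. list_encode (map g (list_decode n)))"
proof -
  have "recf1 (\<lambda>n. foldl (\<lambda>acc x. Suc (prod_encode (g x, acc))) 0 (list_decode n))"
    by (intro recf1_foldl recf2I recf_Cons recf_comp1[OF assms] recf_proj) auto
  moreover have "foldl (\<lambda>acc x. Suc (prod_encode (g x, acc))) (list_encode ys) xs =
      list_encode (rev (map g xs) @ ys)" for xs ys
    by (induction xs arbitrary: ys) (simp_all flip: list_encode.simps(2))
  from this[of "[]"] have "foldl (\<lambda>acc x. Suc (prod_encode (g x, acc))) 0 xs =
      list_encode (rev (map g xs))" for xs by simp
  ultimately have "recf1 (\<lambda>n. list_encode (rev (map g (list_decode n))))" by simp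
  from recf_comp1[OF recf1_rev this[unfolded recf1_def]] show ?thesis
    by (simp add: recf1_def)
qed

lemma recp_list_all:
  assumes "recp 1 (\<lambda>xs. P (xs ! 0))"
  shows "recp 1 (\<lambda>xs. list_all P (list_decode (xs ! 0)))"
proof -
  have "recf1 (\<lambda>n. foldl (\<lambda>acc x. if P x then acc else 1) 0 (list_decode n))"
    by (intro recf1_foldl recf2I recp_if recp_comp1[OF assms] recf_const recf_proj) auto
  moreover have "foldl (\<lambda>acc x. if P x then acc else 1) a ys = (if list_all P ys then a else (1::nat))"
    for ys a by (induction ys arbitrary: a) auto
  ultimately show ?thesis
    unfolding recf1_def by (intro recp_cong[OF recp_zero]) (auto split: if_splits)
qed

lemma recf1_finite_support:
  assumes "finite S"
  shows "recf1 (\<lambda>x. if x \<in> S then f x else 0)"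
  using assms
proof (induction S rule: finite_induct)
  case empty
  show ?case using recf_const[of 1 0] by (simp add: recf1_def)
next
  case (insert s S)
  have "recf 1 (\<lambda>xs. if xs ! 0 = s then f s else if xs ! 0 \<in> S then f (xs ! 0) else 0)"
    by (intro recp_if recp_eq recf_const recf_proj insert.IH[unfolded recf1_def]) auto
  then show ?case unfolding recf1_def
    by (rule recf_cong) auto
qed

section \<open>Decidable languages\<close>

definition code_set :: "('l \<Rightarrow> nat) \<Rightarrow> 'l list set \<Rightarrow> nat set" where
  "code_set \<iota> L = (\<lambda>w. list_encode (map \<iota> w)) ` L"

lemma singleton_codes_eq:
  "map (\<lambda>w. list_encode (map \<iota> w)) ` (\<lambda>w. [w]) ` L = (\<lambda>n. [n]) ` code_set \<iota> L"
  by (auto simp: code_set_def image_image)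

text \<open>Decidability is given for some numbering \<open>\<kappa>\<close> of the letters; for any
  other numbering \<open>\<iota>\<close> the translation between them is a finite table and hence
  recursive.\<close>

lemma decidable_langD:
  assumes "decidable_lang X L" "inj_on \<iota> X"
  shows "recp 1 (\<lambda>xs. xs ! 0 \<in> code_set \<iota> L)"
proof -
  from assms(1) obtain \<kappa> f where fin: "finite X" and L: "L \<subseteq> lists X" and \<kappa>: "inj_on \<kappa> X"
    and f: "total_recursive 1 f"
      "\<forall>ns. length ns = 1 \<longrightarrow> (f ns = 0) = (ns \<in> map (\<lambda>w. list_encode (map \<kappa> w)) ` (\<lambda>w. [w]) ` L)"
    unfolding decidable_lang_def decidable_tuples_def word_tuples_def by fastforce
  have rk: "recp 1 (\<lambda>xs. xs ! 0 \<in> code_set \<kappa> L)"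
  proof (rule recp_cong)
    show "recp 1 (\<lambda>xs. f xs = 0)" using f(1) by (intro recp_zero recf_total)
    fix xs :: "nat list" assume len: "length xs = 1"
    then obtain n where "xs = [n]" by (cases xs) auto
    then show "(f xs = 0) = (xs ! 0 \<in> code_set \<kappa> L)"
      using f(2)[rule_format, OF len] by (auto simp: singleton_codes_eq)
  qed
  \<comment> \<open>The default 0 may itself be the \<open>\<kappa>\<close>-number of a letter.
    Therefore the decision procedure also tests that every entry of the list is an
    \<open>\<iota>\<close>-number.\<close>
  define \<pi> where "\<pi> = (\<lambda>n. if n \<in> \<iota> ` X then \<kappa> (inv_into X \<iota> n) else 0)"
  have \<pi>: "\<pi> (\<iota> x) = \<kappa> x" if "x \<in> X" for x
    using that assms(2) by (simp add: \<pi>_def)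
  have "recf1 \<pi>"
    unfolding \<pi>_def using fin recf1_finite_support[of "\<iota> ` X" "\<lambda>n. \<kappa> (inv_into X \<iota> n)"] by simp
  have rX: "recp 1 (\<lambda>xs. xs ! 0 \<in> \<iota> ` X)"
    by (rule recp_cong[OF recp_Bex[of "\<iota> ` X" 1 "\<lambda>s xs. xs ! 0 = s"]])
      (auto intro: recp_eq recf_proj recf_const simp: fin)
  have "recp 1 (\<lambda>xs. list_all (\<lambda>n. n \<in> \<iota> ` X) (list_decode (xs ! 0)) \<and>
      list_encode (map \<pi> (list_decode (xs ! 0))) \<in> code_set \<kappa> L)"
    using recf_comp1[OF recf1_map[OF \<open>recf1 \<pi>\<close>], of 1 "\<lambda>xs. xs ! 0"]
    by (intro recp_and recp_list_all rX recp_comp1[OF rk]) (auto intro: recf_proj)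
  then show ?thesis
  proof (rule recp_cong)
    fix xs :: "nat list"
    define ns where "ns = list_decode (xs ! 0)"
    then have ns: "xs ! 0 = list_encode ns" by simp
    have "(list_all (\<lambda>n. n \<in> \<iota> ` X) ns \<and> list_encode (map \<pi> ns) \<in> code_set \<kappa> L) \<longleftrightarrow>
        list_encode ns \<in> code_set \<iota> L"
    proof (intro iffI conjI)
      assume *: "list_all (\<lambda>n. n \<in> \<iota> ` X) ns \<and> list_encode (map \<pi> ns) \<in> code_set \<kappa> L"
      then have "ns \<in> lists (\<iota> ` X)" by (auto simp: list_all_iff)
      then obtain w where w: "w \<in> lists X" "ns = map \<iota> w" by (auto simp: lists_image)
      moreover from w(1) have "map \<pi> (map \<iota> w) = map \<kappa> w" by (auto simp: \<pi>)
      ultimately have "list_encode (map \<kappa> w) \<in> code_set \<kappa> L"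
        using * by metis
      then obtain v where v: "v \<in> L" "map \<kappa> v = map \<kappa> w"
        by (auto simp: code_set_def list_encode_eq)
      then have "v = w"
        using w(1) L by (intro map_inj_on[OF v(2) inj_on_subset[OF \<kappa>]]) auto
      then show "list_encode ns \<in> code_set \<iota> L"
        using v(1) w(2) by (auto simp: code_set_def)
    next
      assume "list_encode ns \<in> code_set \<iota> L"
      then obtain w where w: "w \<in> L" "ns = map \<iota> w" by (auto simp: code_set_def list_encode_eq)
      then have "w \<in> lists X" using L by auto
      then show "list_all (\<lambda>n. n \<in> \<iota> ` X) ns" using w by (auto simp: list_all_iff)
      from \<open>w \<in> lists X\<close> have "map \<pi> (map \<iota> w) = map \<kappa> w" by (auto simp: \<pi>)
      then have "list_encode (map \<pi> ns) = list_encode (map \<kappa> w)"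
        using w(2) by metis
      then show "list_encode (map \<pi> ns) \<in> code_set \<kappa> L"
        using w(1) unfolding code_set_def by (metis image_eqI)
    qed
    then show "(list_all (\<lambda>n. n \<in> \<iota> ` X) (list_decode (xs ! 0)) \<and>
      list_encode (map \<pi> (list_decode (xs ! 0))) \<in> code_set \<kappa> L) = (xs ! 0 \<in> code_set \<iota> L)"
      using ns by simp
  qed
qed

lemma decidable_tuplesI:
  assumes "finite X" "L \<subseteq> word_tuples X n" "inj_on \<iota> X"
    and "recp n (\<lambda>ns. ns \<in> map (\<lambda>w. list_encode (map \<iota> w)) ` L)"
  shows "decidable_tuples X n L"
proof -
  from assms(4) obtain f where "recf n f" "\<forall>ns. length ns = n \<longrightarrow>
      (ns \<in> map (\<lambda>w. list_encode (map \<iota> w)) ` L \<longleftrightarrow> f ns = 0)"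
    unfolding recp_def by blast
  then show ?thesis
    using assms(1-3) unfolding decidable_tuples_def recf_def by (metis (no_types, lifting))
qed

lemma decidable_langI:
  assumes "finite X" "L \<subseteq> lists X" "inj_on \<iota> X" "recp 1 (\<lambda>xs. xs ! 0 \<in> code_set \<iota> L)"
  shows "decidable_lang X L"
  unfolding decidable_lang_def
proof (rule decidable_tuplesI[OF assms(1) _ assms(3)])
  show "(\<lambda>w. [w]) ` L \<subseteq> word_tuples X 1" using assms(2) by (auto simp: word_tuples_def)
  show "recp 1 (\<lambda>ns. ns \<in> map (\<lambda>w. list_encode (map \<iota> w)) ` (\<lambda>w. [w]) ` L)"
  proof (rule recp_cong[OF assms(4)])
    fix xs :: "nat list" assume "length xs = 1"
    then obtain n where "xs = [n]" by (cases xs) auto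
    then show "(xs ! 0 \<in> code_set \<iota> L) = (xs \<in> map (\<lambda>w. list_encode (map \<iota> w)) ` (\<lambda>w. [w]) ` L)"
      by (auto simp: singleton_codes_eq)
  qed
qed

lemma decidable_lang_subset: "decidable_lang X L \<Longrightarrow> L \<subseteq> lists X"
  and decidable_lang_finite: "decidable_lang X L \<Longrightarrow> finite X"
  unfolding decidable_lang_def decidable_tuples_def word_tuples_def by fastforce+

section \<open>Regular languages\<close>

text \<open>The left quotient of \<open>L\<close> by \<open>w\<close>; the residuals are the states
  of the minimal automaton.\<close>

definition residual :: "'l list set \<Rightarrow> 'l list \<Rightarrow> 'l list set" where
  "residual L w = {t. w @ t \<in> L}"

lemma residual_append1: "residual L w = residual L w' \<Longrightarrow> residual L (w @ t) = residual L (w' @ t)"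
  unfolding residual_def by (auto simp: set_eq_iff)

lemma residual_eq_memD: "residual L w = residual L w' \<Longrightarrow> w \<in> L \<longleftrightarrow> w' \<in> L"
  unfolding residual_def by (drule eqset_imp_iff[of _ _ "[]"]) simp

text \<open>The Myhill-Nerode criterion for an arbitrary right-invariant \<open>f\<close> with
  finitely many values that decides membership. The values of \<open>f\<close>, numbered by
  \<open>c\<close>, serve as states, and a transition appends the letter to a chosen representative
  word of the state.\<close>

lemma regular_langI:
  assumes fin: "finite \<Sigma>" and L: "L \<subseteq> lists \<Sigma>" and finf: "finite (f ` lists \<Sigma>)"
    and step: "\<And>w w' a. \<lbrakk>w \<in> lists \<Sigma>; w' \<in> lists \<Sigma>; a \<in> \<Sigma>; f w = f w'\<rbrakk> \<Longrightarrow> f (w @ [a]) = f (w' @ [a])"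
    and acc: "\<And>w w'. \<lbrakk>w \<in> lists \<Sigma>; w' \<in> lists \<Sigma>; f w = f w'; w \<in> L\<rbrakk> \<Longrightarrow> w' \<in> L"
  shows "regular_lang \<Sigma> L"
proof -
  define m where "m = card (f ` lists \<Sigma>)"
  obtain c where c: "bij_betw c (f ` lists \<Sigma>) {0..<m}"
    using ex_bij_betw_finite_nat[OF finf] unfolding m_def by blast
  then have inj: "inj_on c (f ` lists \<Sigma>)" and im: "c ` f ` lists \<Sigma> = {0..<m}"
    by (auto simp: bij_betw_def)
  define rep where "rep q = (SOME w. w \<in> lists \<Sigma> \<and> c (f w) = q)" for q
  have rep: "rep q \<in> lists \<Sigma> \<and> c (f (rep q)) = q" if "q < m" for q
  proof -
    have "\<exists>w. w \<in> lists \<Sigma> \<and> c (f w) = q"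
    proof -
      have "q \<in> c ` f ` lists \<Sigma>" using im that by simp
      then show ?thesis by blast
    qed
    then show ?thesis unfolding rep_def by (rule someI_ex)
  qed
  define \<delta> where "\<delta> q a = c (f (rep q @ [a]))" for q a
  have lt: "c (f w) < m" if "w \<in> lists \<Sigma>" for w
  proof -
    have "c (f w) \<in> {0..<m}" using that unfolding im[symmetric] by (intro imageI)
    then show ?thesis by simp
  qed
  have run: "foldl \<delta> (c (f [])) w = c (f w)" if "w \<in> lists \<Sigma>" for w
    using that
  proof (induction w rule: rev_induct)
    case (snoc a w)
    then have w: "w \<in> lists \<Sigma>" and a: "a \<in> \<Sigma>" by auto
    have "f (rep (c (f w))) = f w"
      using rep[OF lt[OF w]] w by (intro inj_onD[OF inj]) blast+
    then have "f (rep (c (f w)) @ [a]) = f (w @ [a])"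
      using w a rep[OF lt[OF w]] by (intro step) auto
    then show ?case using snoc w by (simp add: \<delta>_def)
  qed simp
  have "L = {w \<in> lists \<Sigma>. foldl \<delta> (c (f [])) w \<in> c ` f ` L}"
  proof (intro equalityI subsetI)
    fix w assume "w \<in> L"
    then show "w \<in> {w \<in> lists \<Sigma>. foldl \<delta> (c (f [])) w \<in> c ` f ` L}"
      using L run[of w] by auto
  next
    fix w assume "w \<in> {w \<in> lists \<Sigma>. foldl \<delta> (c (f [])) w \<in> c ` f ` L}"
    then have w: "w \<in> lists \<Sigma>" and "c (f w) \<in> c ` f ` L" using run[of w] by auto
    then obtain v where "v \<in> L" "c (f w) = c (f v)" by auto
    moreover have "f v \<in> f ` lists \<Sigma>" "f w \<in> f ` lists \<Sigma>" using \<open>v \<in> L\<close> L w by blast+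
    ultimately have "f v = f w" using inj by (metis inj_onD)
    with \<open>v \<in> L\<close> L w show "w \<in> L" using acc by blast
  qed
  moreover have "\<forall>q<m. \<forall>a\<in>\<Sigma>. \<delta> q a < m"
    unfolding \<delta>_def using rep by (intro allI impI ballI lt) simp
  moreover have "c (f []) < m" by (rule lt) simp
  moreover have "c ` f ` L \<subseteq> {..<m}" using L lt by blast
  ultimately show ?thesis
    unfolding regular_lang_def using fin
    by (intro conjI exI[of _ m] exI[of _ \<delta>] exI[of _ "c (f [])"] exI[of _ "c ` f ` L"])
qed

lemma regular_lang_subset: "regular_lang \<Sigma> L \<Longrightarrow> L \<subseteq> lists \<Sigma>"
  and regular_lang_finite: "regular_lang \<Sigma> L \<Longrightarrow> finite \<Sigma>"
  unfolding regular_lang_def by fastforce+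

text \<open>A residual depends only on the state reached. Words with letters outside the alphabet
  contribute the empty residual, which is why it is inserted separately.\<close>

lemma regular_lang_finite_residuals:
  assumes "regular_lang \<Sigma> L"
  shows "finite (range (residual L))"
proof -
  from assms obtain m \<delta> q0 F where d: "q0 < (m::nat)" "\<forall>q<m. \<forall>a\<in>\<Sigma>. \<delta> q a < m"
      "L = {w \<in> lists \<Sigma>. foldl \<delta> q0 w \<in> F}"
    unfolding regular_lang_def by (elim conjE exE) (rule that)
  have run: "foldl \<delta> q0 w < m" if "w \<in> lists \<Sigma>" for w
    using that by (induction w rule: rev_induct) (use d(1,2) in auto)
  have "residual L w \<in> insert {} ((\<lambda>q. {t \<in> lists \<Sigma>. foldl \<delta> q t \<in> F}) ` {..<m})" for w
  proof (cases "w \<in> lists \<Sigma>")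
    case True
    then have "residual L w = {t \<in> lists \<Sigma>. foldl \<delta> (foldl \<delta> q0 w) t \<in> F}"
      by (auto simp: residual_def d(3))
    then show ?thesis using run[OF True] by blast
  next
    case False
    then have "residual L w = {}" by (auto simp: residual_def d(3))
    then show ?thesis by simp
  qed
  then have "range (residual L) \<subseteq> insert {} ((\<lambda>q. {t \<in> lists \<Sigma>. foldl \<delta> q t \<in> F}) ` {..<m})"
    by blast
  then show ?thesis by (rule finite_subset) simp
qed

text \<open>The product automaton: the family of all residuals is tracked at once.\<close>

lemma regular_lang_UN:
  assumes "finite \<Sigma>" "finite I" "\<And>i. i \<in> I \<Longrightarrow> regular_lang \<Sigma> (L i)"
  shows "regular_lang \<Sigma> (\<Union>i\<in>I. L i)"
proof (rule regular_langI[where f = "\<lambda>w. \<lambda>i\<in>I. residual (L i) w"])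
  show "finite ((\<lambda>w. \<lambda>i\<in>I. residual (L i) w) ` lists \<Sigma>)"
  proof (rule finite_subset)
    show "(\<lambda>w. \<lambda>i\<in>I. residual (L i) w) ` lists \<Sigma> \<subseteq> (\<Pi>\<^sub>E i\<in>I. range (residual (L i)))"
      by auto
    show "finite (\<Pi>\<^sub>E i\<in>I. range (residual (L i)))"
      using assms by (intro finite_PiE regular_lang_finite_residuals) auto
  qed
  show "(\<Union>i\<in>I. L i) \<subseteq> lists \<Sigma>"
    using regular_lang_subset[OF assms(3)] by auto
next
  fix w w' a
  assume *: "(\<lambda>i\<in>I. residual (L i) w) = (\<lambda>i\<in>I. residual (L i) w')"
  then have eq: "residual (L i) w = residual (L i) w'" if "i \<in> I" for i
    using that by (auto dest: fun_cong[where x = i])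
  show "(\<lambda>i\<in>I. residual (L i) (w @ [a])) = (\<lambda>i\<in>I. residual (L i) (w' @ [a]))"
    using eq by (intro restrict_ext residual_append1)
  show "w' \<in> (\<Union>i\<in>I. L i)" if "w \<in> (\<Union>i\<in>I. L i)"
    using that residual_eq_memD[OF eq] by auto
qed fact+

lemma regular_lang_map:
  assumes L: "regular_lang \<Sigma> L" and inj: "inj_on f \<Sigma>"
  shows "regular_lang (f ` \<Sigma>) (map f ` L)"
proof (rule regular_langI[where f = "\<lambda>w. residual L (map (inv_into \<Sigma> f) w)"])
  have im: "map (inv_into \<Sigma> f) (map f w) = w" if "w \<in> lists \<Sigma>" for w
    using that inj by (induction w) auto
  have mi: "map f (map (inv_into \<Sigma> f) w) = w" if "w \<in> lists (f ` \<Sigma>)" for w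
    using that by (induction w) (auto simp: f_inv_into_f)
  show "finite (f ` \<Sigma>)" using regular_lang_finite[OF L] by simp
  show "map f ` L \<subseteq> lists (f ` \<Sigma>)"
    using regular_lang_subset[OF L] by (simp add: lists_image image_mono)
  show "finite ((\<lambda>w. residual L (map (inv_into \<Sigma> f) w)) ` lists (f ` \<Sigma>))"
    by (rule finite_subset[OF _ regular_lang_finite_residuals[OF L]]) auto
  fix w w'
  assume w: "w \<in> lists (f ` \<Sigma>)" "w' \<in> lists (f ` \<Sigma>)"
    and eq: "residual L (map (inv_into \<Sigma> f) w) = residual L (map (inv_into \<Sigma> f) w')"
  show "residual L (map (inv_into \<Sigma> f) (w @ [a])) = residual L (map (inv_into \<Sigma> f) (w' @ [a]))" for a
    using residual_append1[OF eq] by simp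
  assume "w \<in> map f ` L"
  then obtain v where v: "v \<in> L" "w = map f v" by blast
  then have "map (inv_into \<Sigma> f) w \<in> L" using im regular_lang_subset[OF L] by (metis subsetD)
  then have "map (inv_into \<Sigma> f) w' \<in> L" using residual_eq_memD[OF eq] by simp
  then show "w' \<in> map f ` L" using mi[OF w(2)] by (metis image_eqI)
qed

lemma regular_lang_empty: "finite \<Sigma> \<Longrightarrow> regular_lang \<Sigma> {}"
  using regular_lang_UN[of \<Sigma> "{}"] by simp

section \<open>Slices of a stacking relation\<close>

definition slice :: "'l list list set \<Rightarrow> 'l \<Rightarrow> 'l list \<Rightarrow> 'l list set" where
  "slice M a u = {w. [w, [a], u] \<in> M}"

text \<open>\<open>U\<close> holds the possible flow labels. Its finiteness, which comes from the
  bound on the flow, turns a ternary relation into finitely many languages.\<close>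

definition stacking_relation :: "'l set \<Rightarrow> 'l list set \<Rightarrow> 'l list list set \<Rightarrow> bool" where
  "stacking_relation X U M \<longleftrightarrow>
     finite X \<and> finite U \<and> U \<subseteq> lists X \<and> M \<subseteq> {[w, [a], u] | w a u. w \<in> lists X \<and> a \<in> X \<and> u \<in> U}"

lemma stacking_relationE:
  assumes "stacking_relation X U M" "x \<in> M"
  obtains w a u where "x = [w, [a], u]" "w \<in> lists X" "a \<in> X" "u \<in> U"
  using assms unfolding stacking_relation_def by fast

lemma pad_triple_nth:
  "i < max (length w) (max 1 (length u)) \<Longrightarrow> pad [w, [a], u] ! i =
    [if i < length w then Some (w ! i) else None, if i = 0 then Some a else None,
     if i < length u then Some (u ! i) else None]"
  by (simp add: pad_def)

lemma length_pad_triple: "length (pad [w, [a], u]) = max (length w) (max 1 (length u))"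
  by (simp add: pad_def)

lemma pad_triple_append:
  assumes "max 1 (length u) \<le> length w"
  shows "pad [w @ t, [a], u] = pad [w, [a], u] @ map (\<lambda>b. [Some b, None, None]) t"
proof (rule nth_equalityI)
  show "length (pad [w @ t, [a], u]) = length (pad [w, [a], u] @ map (\<lambda>b. [Some b, None, None]) t)"
    using assms by (simp add: length_pad_triple)
  fix i assume "i < length (pad [w @ t, [a], u])"
  then show "pad [w @ t, [a], u] ! i = (pad [w, [a], u] @ map (\<lambda>b. [Some b, None, None]) t) ! i"
    using assms by (auto simp: length_pad_triple nth_append pad_triple_nth)
qed

lemma pad_triple_fst:
  "map the (filter (\<lambda>x. x \<noteq> None) (map hd (pad [w, [a], u]))) = w"
proof -
  define N where "N = max (length w) (max 1 (length u))"
  have "map hd (pad [w, [a], u]) = map Some w @ replicate (N - length w) None"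
    by (rule nth_equalityI) (auto simp: length_pad_triple pad_triple_nth N_def nth_append)
  then show ?thesis by (simp add: comp_def)
qed

lemma pad_triple_inject:
  assumes "pad [w, [a], u] = pad [w', [a'], u']"
  shows "w = w' \<and> a = a' \<and> u = u'"
proof -
  define N where "N = max (length w) (max 1 (length u))"
  define N' where "N' = max (length w') (max 1 (length u'))"
  have len: "N' = N" using arg_cong[OF assms, of length] by (simp add: length_pad_triple N_def N'_def)
  have 1: "map (\<lambda>c. c ! 2) (pad [w, [a], u]) = map Some u @ replicate (N - length u) None"
    if "N = max (length w) (max 1 (length u))" for w u :: "'a list" and a :: 'a and N
    by (rule nth_equalityI) (auto simp: length_pad_triple pad_triple_nth that nth_append)
  have "map the (filter (\<lambda>x. x \<noteq> None) (map Some u @ replicate k None)) = u"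
    for k and u :: "'a list" by (simp add: comp_def)
  then have "u = u'" using 1[OF N_def] 1[OF N'_def] assms by metis
  moreover have "a = a'"
    using assms pad_triple_nth[of 0 w u a] pad_triple_nth[of 0 w' u' a'] by simp
  ultimately show ?thesis using pad_triple_fst assms by metis
qed

lemma lists_padded_alphabet_pad:
  assumes "w \<in> lists X" "a \<in> X" "u \<in> lists X"
  shows "pad [w, [a], u] \<in> lists (padded_alphabet X 3)"
proof -
  have "pad [w, [a], u] ! i \<in> padded_alphabet X 3" if "i < length (pad [w, [a], u])" for i
    using that assms
    by (auto simp: length_pad_triple pad_triple_nth padded_alphabet_def in_lists_conv_set)
  then show ?thesis by (auto simp: in_lists_conv_set in_set_conv_nth)
qed

lemma finite_padded_alphabet: "finite X \<Longrightarrow> finite (padded_alphabet X n)"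
proof -
  assume "finite X"
  then have "finite {c. set c \<subseteq> insert None (Some ` X) \<and> length c = n}"
    by (intro finite_lists_length_eq) auto
  then show ?thesis by (rule rev_finite_subset) (auto simp: padded_alphabet_def)
qed

lemma finite_short_lists: "finite \<Sigma> \<Longrightarrow> finite {w \<in> lists \<Sigma>. length w \<le> n}"
  using finite_lists_length_le[of \<Sigma> n] by (simp add: lists_eq_set Collect_conj_eq Int_commute)

text \<open>Beyond position \<open>max 1 (length u)\<close> a padded triple continues in its first component only,
  so the residuals of long words correspond and the finitely many short words do not matter.\<close>

lemma regular_slice:
  assumes M: "stacking_relation X U M" and reg: "regular_lang (padded_alphabet X 3) (pad ` M)"
  shows "regular_lang X (slice M a u)"
proof (rule regular_langI)
  let ?n = "max 1 (length u)"
  define f where "f w = (if length w \<le> ?n then Inl w else Inr (residual (pad ` M) (pad [w, [a], u])))" for w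
  show "finite X" using M by (simp add: stacking_relation_def)
  show "slice M a u \<subseteq> lists X" using M by (auto simp: stacking_relation_def slice_def)
  show "finite (f ` lists X)"
  proof (rule finite_subset)
    show "f ` lists X \<subseteq> Inl ` {w \<in> lists X. length w \<le> ?n} \<union> Inr ` range (residual (pad ` M))"
      by (auto simp: f_def)
    show "finite (Inl ` {w \<in> lists X. length w \<le> ?n} \<union> Inr ` range (residual (pad ` M)))"
      using regular_lang_finite_residuals[OF reg] finite_short_lists[OF \<open>finite X\<close>] by blast
  qed
  fix w w' assume "f w = f w'"
  then consider "w = w'" | "?n < length w" "?n < length w'"
      "residual (pad ` M) (pad [w, [a], u]) = residual (pad ` M) (pad [w', [a], u])"
    unfolding f_def by (metis Inl_Inr_False Inl_inject Inr_inject not_le)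
  note cases = this
  show "f (w @ [b]) = f (w' @ [b])" for b
    using cases
  proof cases
    case 2
    then show ?thesis
      using residual_append1[OF 2(3), of "[[Some b, None, None]]"]
      by (auto simp: f_def pad_triple_append)
  qed simp
  have mem: "v \<in> slice M a u \<longleftrightarrow> pad [v, [a], u] \<in> pad ` M" for v
  proof
    assume "pad [v, [a], u] \<in> pad ` M"
    then obtain x where x: "x \<in> M" "pad [v, [a], u] = pad x" by blast
    then obtain w b t where "x = [w, [b], t]" using stacking_relationE[OF M] by metis
    with x show "v \<in> slice M a u" using pad_triple_inject by (metis slice_def mem_Collect_eq)
  qed (auto simp: slice_def)
  show "w' \<in> slice M a u" if "w \<in> slice M a u"
    using cases
  proof cases
    case 2
    then show ?thesis using that residual_eq_memD unfolding mem by blast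
  qed (use that in simp)
qed

text \<open>The converse of the passage to slices. Short words are remembered literally; for a long
  word it suffices to know whether it is a padded triple of the given form and, if so, the residual
  of its first component. Padding is injective, so that component is well defined.\<close>

lemma regular_pad_slice:
  assumes fin: "finite X" and a: "a \<in> X" and u: "u \<in> lists X" and L: "regular_lang X L"
  shows "regular_lang (padded_alphabet X 3) ((\<lambda>w. pad [w, [a], u]) ` L)"
proof (rule regular_langI)
  let ?n = "max 1 (length u)"
  let ?p = "\<lambda>w. pad [w, [a], u]"
  define g where "g v = (if \<exists>w. v = ?p w then Some (residual L (THE w. v = ?p w)) else None)" for v
  define f where "f v = (if length v \<le> ?n then Inl v else Inr (g v))" for v
  have gp: "g (?p w) = Some (residual L w)" for w
  proof -
    have "(THE w'. ?p w = ?p w') = w"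
      by (rule the_equality) (rule HOL.refl, use pad_triple_inject in metis)
    moreover have "\<exists>w'. ?p w = ?p w'" by blast
    ultimately show ?thesis unfolding g_def by (simp only: if_True)
  qed
  have gn: "g v = None \<longleftrightarrow> (\<forall>w. v \<noteq> ?p w)" for v by (simp add: g_def)
  show "finite (padded_alphabet X 3)" by (rule finite_padded_alphabet[OF fin])
  show "?p ` L \<subseteq> lists (padded_alphabet X 3)"
    using regular_lang_subset[OF L] by (intro image_subsetI lists_padded_alphabet_pad a u) blast
  show "finite (f ` lists (padded_alphabet X 3))"
  proof (rule finite_subset)
    show "f ` lists (padded_alphabet X 3) \<subseteq> Inl ` {w \<in> lists (padded_alphabet X 3). length w \<le> ?n}
        \<union> Inr ` insert None (Some ` range (residual L))"
    proof -
      have "g v \<in> insert None (Some ` range (residual L))" for v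
        by (cases "\<exists>w. v = ?p w") (simp_all add: g_def)
      then have "f v \<in> Inl ` {w \<in> lists (padded_alphabet X 3). length w \<le> ?n}
          \<union> Inr ` insert None (Some ` range (residual L))" if "v \<in> lists (padded_alphabet X 3)" for v
        using that by (cases "length v \<le> ?n") (simp_all only: f_def if_True if_False, blast+)
      then show ?thesis by blast
    qed
    show "finite (Inl ` {w \<in> lists (padded_alphabet X 3). length w \<le> ?n}
        \<union> Inr ` insert None (Some ` range (residual L)))"
      using regular_lang_finite_residuals[OF L]
        finite_short_lists[OF finite_padded_alphabet[OF fin], of 3 ?n] by blast
  qed
  fix v v' assume "f v = f v'"
  then consider "v = v'" | "?n < length v" "?n < length v'" "g v = g v'"
    unfolding f_def by (metis Inl_Inr_False Inl_inject Inr_inject not_le)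
  note cases = this
  \<comment> \<open>Beyond the first letters a padded triple can be continued only in its first
    component, so the new value of \<open>g\<close> is determined by the old one and the
    letter.\<close>
  have gs: "g (v @ [c]) = (case g v of None \<Rightarrow> None | Some R \<Rightarrow>
      (if \<exists>b. c = [Some b, None, None] then Some (residual R [the (hd c)]) else None))"
    if len: "length v > ?n" for v c
  proof (cases "\<exists>w b. v = ?p w \<and> c = [Some b, None, None]")
    case True
    then obtain w b where wb: "v = ?p w" "c = [Some b, None, None]" by blast
    then have "length w \<ge> ?n" using len by (auto simp: length_pad_triple max_def split: if_splits)
    then have "v @ [c] = ?p (w @ [b])" using wb by (simp add: pad_triple_append)
    then show ?thesis using wb by (simp add: gp) (simp add: residual_def)
  next
    case False
    have "v @ [c] \<noteq> ?p w'" for w'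
    proof
      assume eq: "v @ [c] = ?p w'"
      have "Suc (length v) = max (length w') ?n"
        using arg_cong[OF eq, of length] by (simp only: length_append_singleton length_pad_triple)
      then have "length w' = Suc (length v)" using len by arith
      then obtain w b where w': "w' = w @ [b]" "length w = length v"
        by (cases w' rule: rev_cases) auto
      then show False using False eq len by (auto simp: pad_triple_append)
    qed
    then have "g (v @ [c]) = None" by (simp add: gn)
    then show ?thesis using False by (auto simp: g_def split: option.splits)
  qed
  show "f (v @ [c]) = f (v' @ [c])" for c
    using cases by cases (auto simp: f_def gs)
  show "v' \<in> ?p ` L" if "v \<in> ?p ` L"
    using cases
  proof cases
    case 2
    from that obtain w where w: "v = ?p w" "w \<in> L" by blast
    then obtain w' where w': "v' = ?p w'" using 2(3) gp gn by (metis option.distinct(1))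
    with w 2(3) have "residual L w = residual L w'" by (simp add: gp)
    then have "w' \<in> L" using w(2) residual_eq_memD by blast
    then show ?thesis using w' by blast
  qed (use that in simp)
qed

lemma stacking_relation_UN:
  assumes "stacking_relation X U M"
  shows "M = (\<Union>(a, u)\<in>X \<times> U. (\<lambda>w. [w, [a], u]) ` slice M a u)"
proof
  show "M \<subseteq> (\<Union>(a, u)\<in>X \<times> U. (\<lambda>w. [w, [a], u]) ` slice M a u)"
  proof
    fix x assume "x \<in> M"
    moreover from this obtain w a u where "x = [w, [a], u]" "a \<in> X" "u \<in> U"
      using assms by (auto simp: stacking_relation_def)
    ultimately show "x \<in> (\<Union>(a, u)\<in>X \<times> U. (\<lambda>w. [w, [a], u]) ` slice M a u)"
      by (auto simp: slice_def)
  qed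
qed (auto simp: slice_def)

lemma stacking_relation_tuples: "stacking_relation X U M \<Longrightarrow> M \<subseteq> word_tuples X 3"
  by (fastforce simp: stacking_relation_def word_tuples_def)

text \<open>For the backward direction the relation is the finite union, over letters and labels, of
  its padded slices.\<close>

lemma sync_regular_iff_slices:
  assumes M: "stacking_relation X U M"
  shows "sync_regular X 3 M \<longleftrightarrow> (\<forall>a\<in>X. \<forall>u\<in>U. regular_lang X (slice M a u))"
proof
  assume "sync_regular X 3 M"
  then show "\<forall>a\<in>X. \<forall>u\<in>U. regular_lang X (slice M a u)"
    using regular_slice[OF M] by (auto simp: sync_regular_def)
next
  assume sl: "\<forall>a\<in>X. \<forall>u\<in>U. regular_lang X (slice M a u)"
  have fin: "finite X" "finite U" "U \<subseteq> lists X" using M by (auto simp: stacking_relation_def)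
  have "regular_lang (padded_alphabet X 3) (\<Union>au\<in>X \<times> U. (\<lambda>w. pad [w, [fst au], snd au]) ` slice M (fst au) (snd au))"
    using fin sl by (intro regular_lang_UN finite_padded_alphabet regular_pad_slice) auto
  also have "(\<Union>au\<in>X \<times> U. (\<lambda>w. pad [w, [fst au], snd au]) ` slice M (fst au) (snd au)) = pad ` M"
    by (subst (2) stacking_relation_UN[OF M]) (auto simp: image_UN image_image split_beta)
  finally show "sync_regular X 3 M"
    using stacking_relation_tuples[OF M] by (simp add: sync_regular_def)
qed

lemma nat_list_length_3: "length ns = 3 \<longleftrightarrow> (\<exists>a b c. ns = [a, b, c])"
  by (auto simp: numeral_3_eq_3 length_Suc_conv)

text \<open>Fixing the codes of letter and label as constants decides a slice; conversely, a finite
  disjunction over letters and labels decides the relation.\<close>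

lemma decidable_iff_slices:
  assumes M: "stacking_relation X U M"
  shows "decidable_tuples X 3 M \<longleftrightarrow> (\<forall>a\<in>X. \<forall>u\<in>U. decidable_lang X (slice M a u))"
proof
  assume "decidable_tuples X 3 M"
  then obtain \<iota> f where fin: "finite X" and \<iota>: "inj_on \<iota> X" and f: "total_recursive 3 f"
    "\<forall>ns. length ns = 3 \<longrightarrow> (f ns = 0 \<longleftrightarrow> ns \<in> map (\<lambda>w. list_encode (map \<iota> w)) ` M)"
    unfolding decidable_tuples_def by blast
  have sub: "slice M a u \<subseteq> lists X" for a u using M by (auto simp: stacking_relation_def slice_def)
  show "\<forall>a\<in>X. \<forall>u\<in>U. decidable_lang X (slice M a u)"
  proof (intro ballI decidable_langI[OF fin sub \<iota>])
    fix a u assume a: "a \<in> X" and u: "u \<in> U"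
    define ca cu where "ca = list_encode (map \<iota> [a])" and "cu = list_encode (map \<iota> u)"
    have eq: "n \<in> code_set \<iota> (slice M a u) \<longleftrightarrow> f [n, ca, cu] = 0" for n
    proof -
      have "f [n, ca, cu] = 0 \<longleftrightarrow> [n, ca, cu] \<in> map (\<lambda>w. list_encode (map \<iota> w)) ` M"
        by (rule f(2)[rule_format]) simp
      also have "\<dots> \<longleftrightarrow> n \<in> code_set \<iota> (slice M a u)"
      proof
        assume "[n, ca, cu] \<in> map (\<lambda>w. list_encode (map \<iota> w)) ` M"
        then obtain x where x: "x \<in> M" "[n, ca, cu] = map (\<lambda>w. list_encode (map \<iota> w)) x"
          by (elim imageE)
        obtain w a' u' where xw: "x = [w, [a'], u']" "w \<in> lists X" "a' \<in> X" "u' \<in> U"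
          by (rule stacking_relationE[OF M x(1)])
        then have w: "n = list_encode (map \<iota> w)" "map \<iota> [a'] = map \<iota> [a]" "map \<iota> u' = map \<iota> u"
          using x(2) by (simp_all add: ca_def cu_def list_encode_eq del: list_encode.simps)
        have "a' = a" using w(2) xw(3) a \<iota> by (auto dest: inj_onD)
        moreover have "u' = u"
          using xw(4) u M by (intro map_inj_on[OF w(3) inj_on_subset[OF \<iota>]])
            (auto simp: stacking_relation_def)
        ultimately show "n \<in> code_set \<iota> (slice M a u)"
          using w(1) x(1) xw(1) by (auto simp: code_set_def slice_def)
      qed (force simp: code_set_def slice_def ca_def cu_def)
      finally show ?thesis by blast
    qed
    have "recp 1 (\<lambda>xs. f (map (\<lambda>g. g xs) [\<lambda>xs. xs ! 0, \<lambda>_. ca, \<lambda>_. cu]) = 0)"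
      using f(1) by (intro recp_zero recf_comp)
        (auto intro: recf_total recf_proj recf_const simp: numeral_3_eq_3)
    then show "recp 1 (\<lambda>xs. xs ! 0 \<in> code_set \<iota> (slice M a u))"
      by (simp add: eq)
  qed
next
  assume sl: "\<forall>a\<in>X. \<forall>u\<in>U. decidable_lang X (slice M a u)"
  have fin: "finite X" "finite U" "U \<subseteq> lists X" using M by (auto simp: stacking_relation_def)
  obtain \<iota> :: "_ \<Rightarrow> nat" where \<iota>: "inj_on \<iota> X" using finite_imp_inj_to_nat_seg[OF fin(1)] by blast
  show "decidable_tuples X 3 M"
  proof (rule decidable_tuplesI[OF fin(1) stacking_relation_tuples[OF M] \<iota>])
    have "recp 3 (\<lambda>ns. \<exists>au\<in>X \<times> U. ns ! 0 \<in> code_set \<iota> (slice M (fst au) (snd au)) \<and>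
        (ns ! 1 = list_encode (map \<iota> [fst au]) \<and> ns ! 2 = list_encode (map \<iota> (snd au))))"
      using fin sl
      by (intro recp_Bex recp_and recp_eq recf_const recf_proj
          recp_comp1[OF decidable_langD[OF _ \<iota>]]) auto
    then show "recp 3 (\<lambda>ns. ns \<in> map (\<lambda>w. list_encode (map \<iota> w)) ` M)"
    proof (rule recp_cong)
      fix ns :: "nat list" assume "length ns = 3"
      then obtain n1 n2 n3 where ns: "ns = [n1, n2, n3]" by (auto simp: nat_list_length_3)
      show "(\<exists>au\<in>X \<times> U. ns ! 0 \<in> code_set \<iota> (slice M (fst au) (snd au)) \<and>
          (ns ! 1 = list_encode (map \<iota> [fst au]) \<and> ns ! 2 = list_encode (map \<iota> (snd au)))) =
          (ns \<in> map (\<lambda>w. list_encode (map \<iota> w)) ` M)" (is "?lhs = ?rhs")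
      proof
        assume ?lhs
        then obtain a u w where "[w, [a], u] \<in> M"
            "ns = map (\<lambda>w. list_encode (map \<iota> w)) [w, [a], u]"
          by (auto simp: ns code_set_def slice_def simp del: list_encode.simps)
        then show ?rhs by (metis image_eqI)
      next
        assume ?rhs
        then obtain x where x: "x \<in> M" "ns = map (\<lambda>w. list_encode (map \<iota> w)) x"
          by (elim imageE)
        obtain w a u where "x = [w, [a], u]" "a \<in> X" "u \<in> U"
          by (rule stacking_relationE[OF M x(1)])
        then show ?lhs
          using x by (intro bexI[of _ "(a, u)"])
            (auto simp: code_set_def slice_def simp del: list_encode.simps)
      qed
    qed
  qed
qed

lemma decidable_lang_map:
  assumes L: "decidable_lang \<Sigma> L" and f: "inj_on f \<Sigma>"
  shows "decidable_lang (f ` \<Sigma>) (map f ` L)"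
proof -
  obtain \<iota> :: "_ \<Rightarrow> nat" where \<iota>: "inj_on \<iota> \<Sigma>"
    using finite_imp_inj_to_nat_seg[OF decidable_lang_finite[OF L]] by blast
  let ?\<kappa> = "\<iota> \<circ> inv_into \<Sigma> f"
  have "map ?\<kappa> (map f w) = map \<iota> w" if "w \<in> lists \<Sigma>" for w
    using that f by (induction w) auto
  then have "list_encode (map ?\<kappa> (map f w)) = list_encode (map \<iota> w)" if "w \<in> L" for w
    using that decidable_lang_subset[OF L] by (metis subsetD)
  then have "code_set ?\<kappa> (map f ` L) = code_set \<iota> L"
    unfolding code_set_def image_image by (intro image_cong HOL.refl)
  moreover have "inj_on ?\<kappa> (f ` \<Sigma>)"
    by (intro comp_inj_on inj_on_inv_into subset_refl inj_on_subset[OF \<iota>]) (auto intro: inv_into_into)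
  moreover have "map f ` L \<subseteq> lists (f ` \<Sigma>)"
    using decidable_lang_subset[OF L] by (simp add: lists_image image_mono)
  ultimately show ?thesis
    using decidable_langD[OF L \<iota>] decidable_lang_finite[OF L] by (intro decidable_langI) auto
qed

lemma decidable_lang_empty: "finite \<Sigma> \<Longrightarrow> decidable_lang \<Sigma> {}"
proof -
  assume fin: "finite \<Sigma>"
  obtain \<iota> :: "_ \<Rightarrow> nat" where \<iota>: "inj_on \<iota> \<Sigma>"
    using finite_imp_inj_to_nat_seg[OF fin] by blast
  show ?thesis
    by (rule decidable_langI[OF fin _ \<iota>]) (simp_all add: code_set_def recp_False)
qed

section \<open>Words cut into segments by the stable letter\<close>

definition stable :: "bool \<Rightarrow> 'a hnn_letter" where
  "stable \<epsilon> = (if \<epsilon> then Stable else StableInv)"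

definition hnn_alphabet :: "'a set \<Rightarrow> 'a hnn_letter set" where
  "hnn_alphabet Y = Base ` Y \<union> {Stable, StableInv}"

text \<open>A list of segments is stored with its last segment first; each segment comes with the
  exponent of the stable letter that follows it.\<close>

fun segs_word :: "('a list \<times> bool) list \<Rightarrow> 'a hnn_letter list" where
  "segs_word [] = []"
| "segs_word ((v, \<epsilon>) # ps) = segs_word ps @ map Base v @ [stable \<epsilon>]"

definition last_sign :: "('b \<times> bool) list \<Rightarrow> bool option" where
  "last_sign ps = (case ps of [] \<Rightarrow> None | (_, \<epsilon>) # _ \<Rightarrow> Some \<epsilon>)"

text \<open>The excluded case is an empty segment between two opposite stable letters, the only
  cancellation possible once the segments represent transversal elements.\<close>

fun segs_ok :: "(bool \<Rightarrow> 'a list set) \<Rightarrow> ('a list \<times> bool) list \<Rightarrow> bool" where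
  "segs_ok N [] \<longleftrightarrow> True"
| "segs_ok N ((v, \<epsilon>) # ps) \<longleftrightarrow>
     v \<in> N \<epsilon> \<and> \<not> (v = [] \<and> last_sign ps = Some (\<not> \<epsilon>)) \<and> segs_ok N ps"

definition hnn_lang :: "(bool \<Rightarrow> 'a list set) \<Rightarrow> 'a list set \<Rightarrow> 'a hnn_letter list set" where
  "hnn_lang N K = {segs_word ps @ map Base v | ps v. segs_ok N ps \<and> v \<in> K}"

definition hnn_enter :: "(bool \<Rightarrow> 'a list set) \<Rightarrow> bool \<Rightarrow> bool option \<Rightarrow> 'a list
    \<Rightarrow> (bool option \<times> 'a list) option" where
  "hnn_enter N \<epsilon> l v =
     (if v \<in> N \<epsilon> \<and> \<not> (v = [] \<and> l = Some (\<not> \<epsilon>)) then Some (Some \<epsilon>, []) else None)"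

text \<open>The state holds the whole current segment, so the scan is not yet a finite automaton; in
  this form it serves the regular and the decidable case alike. \<open>None\<close> is the dead
  state.\<close>

fun hnn_step :: "(bool \<Rightarrow> 'a list set) \<Rightarrow> (bool option \<times> 'a list) option \<Rightarrow> 'a hnn_letter
    \<Rightarrow> (bool option \<times> 'a list) option" where
  "hnn_step N None c = None"
| "hnn_step N (Some (l, v)) (Base y) = Some (l, v @ [y])"
| "hnn_step N (Some (l, v)) Stable = hnn_enter N True l v"
| "hnn_step N (Some (l, v)) StableInv = hnn_enter N False l v"

definition hnn_run :: "(bool \<Rightarrow> 'a list set) \<Rightarrow> 'a hnn_letter list \<Rightarrow> (bool option \<times> 'a list) option" where
  "hnn_run N w = foldl (hnn_step N) (Some (None, [])) w"

lemma hnn_step_stable: "hnn_step N (Some (l, v)) (stable \<epsilon>) = hnn_enter N \<epsilon> l v"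
  by (simp add: stable_def)

lemma hnn_step_Base: "foldl (hnn_step N) (Some (l, v)) (map Base u) = Some (l, v @ u)"
  by (induction u arbitrary: v) auto

lemma hnn_run_segs_word:
  "segs_ok N ps \<Longrightarrow> hnn_run N (segs_word ps @ map Base v) = Some (last_sign ps, v)"
proof (induction N ps arbitrary: v rule: segs_ok.induct)
  case (1 N)
  then show ?case by (simp add: hnn_run_def hnn_step_Base last_sign_def)
next
  case (2 N u \<epsilon> ps)
  then have "hnn_run N (segs_word ps @ map Base u) = Some (last_sign ps, u)" by simp
  then show ?case
    using 2 by (simp add: hnn_run_def hnn_step_stable hnn_enter_def hnn_step_Base)
      (simp add: last_sign_def)
qed

lemma hnn_run_SomeD:
  "hnn_run N w = Some (l, v) \<Longrightarrow> \<exists>ps. segs_ok N ps \<and> last_sign ps = l \<and> w = segs_word ps @ map Base v"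
proof (induction w arbitrary: l v rule: rev_induct)
  case Nil
  then show ?case by (auto simp: hnn_run_def last_sign_def intro!: exI[of _ "[]"])
next
  case (snoc c w)
  have step: "hnn_step N (hnn_run N w) c = Some (l, v)"
    using snoc.prems by (simp add: hnn_run_def)
  then obtain l' v' where run: "hnn_run N w = Some (l', v')"
    by (cases "hnn_run N w") auto
  then obtain ps where ps: "segs_ok N ps" "last_sign ps = l'" "w = segs_word ps @ map Base v'"
    using snoc.IH by blast
  consider y where "c = Base y" | \<epsilon> where "c = stable \<epsilon>"
    by (metis hnn_letter.exhaust stable_def)
  then show ?case
  proof cases
    case 1
    then have "l = l'" "v = v' @ [y]" using step by (simp_all add: run)
    then show ?thesis using ps 1 by auto
  next
    case 2
    then have "hnn_enter N \<epsilon> l' v' = Some (l, v)"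
      using step by (simp add: run hnn_step_stable)
    then have "v' \<in> N \<epsilon>" "\<not> (v' = [] \<and> l' = Some (\<not> \<epsilon>))" "l = Some \<epsilon>" "v = []"
      by (auto simp: hnn_enter_def split: if_splits)
    then show ?thesis
      using ps 2 by (intro exI[of _ "(v', \<epsilon>) # ps"]) (auto simp: last_sign_def)
  qed
qed

lemma in_hnn_lang_iff: "w \<in> hnn_lang N K \<longleftrightarrow> (\<exists>l v. hnn_run N w = Some (l, v) \<and> v \<in> K)"
proof
  assume "w \<in> hnn_lang N K"
  then show "\<exists>l v. hnn_run N w = Some (l, v) \<and> v \<in> K"
    unfolding hnn_lang_def using hnn_run_segs_word by blast
next
  assume "\<exists>l v. hnn_run N w = Some (l, v) \<and> v \<in> K"
  then show "w \<in> hnn_lang N K"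
    unfolding hnn_lang_def using hnn_run_SomeD by blast
qed

lemma hnn_lang_subset:
  assumes "\<And>\<epsilon>. N \<epsilon> \<subseteq> lists Y" "K \<subseteq> lists Y"
  shows "hnn_lang N K \<subseteq> lists (hnn_alphabet Y)"
proof -
  have B: "map Base v \<in> lists (hnn_alphabet Y)" if "v \<in> lists Y" for v
    using that by (auto simp: hnn_alphabet_def)
  have "segs_word ps \<in> lists (hnn_alphabet Y)" if "segs_ok N ps" for ps
    using that
  proof (induction ps)
    case (Cons p ps)
    obtain u \<epsilon> where p: "p = (u, \<epsilon>)" by force
    have "u \<in> lists Y" using Cons.prems assms(1) p by auto
    then show ?case using Cons B[of u] p by (simp add: stable_def hnn_alphabet_def)
  qed simp
  then show ?thesis using B assms(2) unfolding hnn_lang_def by fastforce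
qed

theorem regular_hnn_lang:
  assumes N: "\<And>\<epsilon>. regular_lang Y (N \<epsilon>)" and K: "regular_lang Y K"
  shows "regular_lang (hnn_alphabet Y) (hnn_lang N K)"
proof (rule regular_langI)
  \<comment> \<open>About the current segment the scan asks only whether it is empty and whether it
    lies in \<open>N True\<close>, \<open>N False\<close> or \<open>K\<close>. The three residuals
    keep these answers available under further letters, and there are finitely many of them.\<close>
  define abs where "abs = map_option (\<lambda>(l :: bool option, v).
    (l, v = [], residual (N True) v, residual (N False) v, residual K v))"
  define f where "f w = abs (hnn_run N w)" for w
  show "finite (hnn_alphabet Y)"
    using regular_lang_finite[OF K] by (simp add: hnn_alphabet_def)
  show "hnn_lang N K \<subseteq> lists (hnn_alphabet Y)"
    by (intro hnn_lang_subset regular_lang_subset N K)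
  let ?S = "(UNIV :: bool option set) \<times> (UNIV :: bool set) \<times>
    range (residual (N True)) \<times> range (residual (N False)) \<times> range (residual K)"
  have "f w \<in> insert None (Some ` ?S)" for w
    unfolding f_def abs_def by (cases "hnn_run N w") auto
  moreover have "finite (insert None (Some ` ?S))"
    using N K by (intro finite_insert[THEN iffD2] finite_imageI finite_cartesian_product
      regular_lang_finite_residuals) auto
  ultimately show "finite (f ` lists (hnn_alphabet Y))"
    by (meson finite_subset image_subsetI)
  have mem: "v \<in> N \<epsilon> \<longleftrightarrow> v' \<in> N \<epsilon>"
    if "residual (N True) v = residual (N True) v'" "residual (N False) v = residual (N False) v'"
    for v v' \<epsilon> using residual_eq_memD[OF that(1)] residual_eq_memD[OF that(2)] by (cases \<epsilon>) simp_all
  have step: "abs (hnn_step N st c) = abs (hnn_step N st' c)" if eq: "abs st = abs st'" for st st' c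
  proof (cases st)
    case None
    then have "st' = None" using eq by (cases st') (auto simp: abs_def)
    then show ?thesis using None by simp
  next
    case (Some p)
    then obtain l v where st: "st = Some (l, v)" by (cases p) auto
    then obtain v' where st': "st' = Some (l, v')" and v': "(v = []) = (v' = [])"
      "residual (N True) v = residual (N True) v'" "residual (N False) v = residual (N False) v'"
      "residual K v = residual K v'"
      using eq st by (cases st') (auto simp: abs_def)
    have enter: "hnn_enter N \<epsilon> l v = hnn_enter N \<epsilon> l v'" for \<epsilon>
      using mem[OF v'(2,3)] v'(1) by (simp add: hnn_enter_def)
    show ?thesis
      unfolding st st' by (cases c)
        (simp_all add: enter, simp_all add: abs_def residual_append1[OF v'(2)]
          residual_append1[OF v'(3)] residual_append1[OF v'(4)])
  qed
  show "f (w @ [a]) = f (w' @ [a])" if "f w = f w'" for w w' a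
    using step[of "hnn_run N w" "hnn_run N w'" a] that by (simp add: f_def hnn_run_def)
  show "w' \<in> hnn_lang N K" if eq: "f w = f w'" and w: "w \<in> hnn_lang N K" for w w'
  proof -
    from w obtain l v where v: "hnn_run N w = Some (l, v)" "v \<in> K"
      by (auto simp: in_hnn_lang_iff)
    then obtain v' where "hnn_run N w' = Some (l, v')" "residual K v = residual K v'"
      using eq by (cases "hnn_run N w'") (auto simp: f_def abs_def)
    moreover from this v have "v' \<in> K" using residual_eq_memD by blast
    ultimately show ?thesis by (auto simp: in_hnn_lang_iff)
  qed
qed

section \<open>Deciding membership in the segment language\<close>

text \<open>A bijection onto the natural numbers, so that every list of numbers codes a word and
  codes need no separate validity test.\<close>

fun hnn_letter_code :: "nat hnn_letter \<Rightarrow> nat" where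
  "hnn_letter_code Stable = 0"
| "hnn_letter_code StableInv = 1"
| "hnn_letter_code (Base n) = n + 2"

lemma inj_hnn_letter_code: "inj hnn_letter_code"
proof (rule injI)
  fix c d show "hnn_letter_code c = hnn_letter_code d \<Longrightarrow> c = d"
    by (cases c; cases d) auto
qed

lemma surj_hnn_letter_code: "surj hnn_letter_code"
proof (rule surjI)
  fix n show "hnn_letter_code (if n = 0 then Stable else if n = 1 then StableInv else Base (n - 2)) = n"
    by auto
qed

definition sign_code :: "bool option \<Rightarrow> nat" where
  "sign_code l = (case l of None \<Rightarrow> 0 | Some \<epsilon> \<Rightarrow> if \<epsilon> then 1 else 2)"

text \<open>The segment is kept in reverse, so that reading a letter is a \<open>Cons\<close> on
  codes; it is turned round when a membership test is due. The outer \<open>Suc\<close> reserves 0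
  for the dead state.\<close>

definition state_code :: "(bool option \<times> nat list) option \<Rightarrow> nat" where
  "state_code st = (case st of None \<Rightarrow> 0
     | Some (l, v) \<Rightarrow> Suc (prod_encode (sign_code l, list_encode (rev v))))"

definition enter_code :: "(bool \<Rightarrow> nat list set) \<Rightarrow> bool \<Rightarrow> nat \<Rightarrow> nat \<Rightarrow> nat" where
  "enter_code N \<epsilon> l v =
     (if list_encode (rev (list_decode v)) \<in> list_encode ` N \<epsilon> \<and> \<not> (v = 0 \<and> l = sign_code (Some (\<not> \<epsilon>)))
      then Suc (prod_encode (sign_code (Some \<epsilon>), 0)) else 0)"

definition step_code :: "(bool \<Rightarrow> nat list set) \<Rightarrow> nat \<Rightarrow> nat \<Rightarrow> nat" where
  "step_code N st c =
     (if st = 0 then 0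
      else if c = 0 then enter_code N True (fst (prod_decode (st - 1))) (snd (prod_decode (st - 1)))
      else if c = 1 then enter_code N False (fst (prod_decode (st - 1))) (snd (prod_decode (st - 1)))
      else Suc (prod_encode (fst (prod_decode (st - 1)),
                  Suc (prod_encode (c - 2, snd (prod_decode (st - 1)))))))"

lemma list_encode_eq_0_iff: "list_encode v = 0 \<longleftrightarrow> v = []"
  by (cases v) auto

lemma enter_code: "enter_code N \<epsilon> (sign_code l) (list_encode (rev v)) = state_code (hnn_enter N \<epsilon> l v)"
proof -
  have "sign_code l = sign_code (Some (\<not> \<epsilon>)) \<longleftrightarrow> l = Some (\<not> \<epsilon>)"
    by (auto simp: sign_code_def split: option.splits)
  moreover have "list_encode v \<in> list_encode ` N \<epsilon> \<longleftrightarrow> v \<in> N \<epsilon>"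
    by (auto simp: list_encode_eq)
  ultimately show ?thesis
    by (simp add: enter_code_def state_code_def hnn_enter_def list_encode_eq_0_iff)
qed

lemma step_code: "step_code N (state_code st) (hnn_letter_code c) = state_code (hnn_step N st c)"
proof (cases st)
  case (Some p)
  then obtain l v where "st = Some (l, v)" by (cases p) auto
  then show ?thesis
    by (cases c) (simp_all add: step_code_def state_code_def[of "Some (l, _)"] enter_code)
qed (simp add: step_code_def state_code_def)

lemma run_code:
  "foldl (step_code N) (state_code (Some (None, []))) (map hnn_letter_code w) = state_code (hnn_run N w)"
  by (induction w rule: rev_induct) (simp_all add: hnn_run_def step_code)

lemma recf2_step_code:
  assumes N: "\<And>\<epsilon>. recp 1 (\<lambda>xs. xs ! 0 \<in> list_encode ` N \<epsilon>)"
  shows "recf2 (step_code N)"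
proof -
  have enter: "recf n (\<lambda>xs. enter_code N \<epsilon> (l xs) (v xs))" if "recf n l" "recf n v" for n l v \<epsilon>
    unfolding enter_code_def
    by (intro recp_if recp_and recp_not recp_eq recf_const that
        recp_comp1[OF N] recf_comp1[OF recf1_rev])
  show ?thesis
    unfolding step_code_def
    by (intro recf2I recp_if recp_eq recf_const recf_Cons recf_Suc recf_pair enter recf_fst recf_snd
        recf_diff recf_proj) auto
qed

lemma recp_hnn_lang:
  assumes N: "\<And>\<epsilon>. recp 1 (\<lambda>xs. xs ! 0 \<in> list_encode ` N \<epsilon>)"
    and K: "recp 1 (\<lambda>xs. xs ! 0 \<in> list_encode ` K)"
  shows "recp 1 (\<lambda>xs. xs ! 0 \<in> code_set hnn_letter_code (hnn_lang N K))"
proof -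
  let ?run = "\<lambda>n. foldl (step_code N) (state_code (Some (None, []))) (list_decode n)"
  let ?v = "\<lambda>n. snd (prod_decode (?run n - 1))"
  have run: "recf1 ?run"
    by (intro recf1_foldl recf2_step_code N)
  have "recp 1 (\<lambda>xs. ?run (xs ! 0) \<noteq> 0 \<and>
      list_encode (rev (list_decode (?v (xs ! 0)))) \<in> list_encode ` K)"
    by (intro recp_and recp_not recp_eq recf_const recf_comp1[OF run] recp_comp1[OF K]
        recf_comp1[OF recf1_rev] recf_snd recf_diff recf_proj) auto
  then show ?thesis
  proof (rule recp_cong)
    fix xs :: "nat list"
    obtain w where w: "list_decode (xs ! 0) = map hnn_letter_code w"
      using surj_hnn_letter_code by (metis ex_map_conv UNIV_I surjD)
    then have n: "xs ! 0 = list_encode (map hnn_letter_code w)"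
      by (metis list_decode_inverse)
    have "xs ! 0 \<in> code_set hnn_letter_code (hnn_lang N K) \<longleftrightarrow> w \<in> hnn_lang N K"
      using inj_hnn_letter_code by (auto simp: n code_set_def list_encode_eq inj_map_eq_map)
    also have "\<dots> \<longleftrightarrow> state_code (hnn_run N w) \<noteq> 0 \<and>
        list_encode (rev (list_decode (snd (prod_decode (state_code (hnn_run N w) - 1))))) \<in> list_encode ` K"
      unfolding in_hnn_lang_iff
      by (cases "hnn_run N w") (auto simp: state_code_def list_encode_eq)
    finally show "(?run (xs ! 0) \<noteq> 0 \<and>
        list_encode (rev (list_decode (?v (xs ! 0)))) \<in> list_encode ` K) \<longleftrightarrow>
        xs ! 0 \<in> code_set hnn_letter_code (hnn_lang N K)"
      unfolding w run_code by simp
  qed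
qed

lemma map_stable: "map_hnn_letter f (stable \<epsilon>) = stable \<epsilon>"
  by (simp add: stable_def)

text \<open>Relabelling preserves signs and emptiness of segments, the only data besides membership
  on which \<open>segs_ok\<close> depends. It carries the scan over to words of numbers.\<close>

lemma hnn_lang_map:
  "map (map_hnn_letter f) ` hnn_lang N K = hnn_lang (\<lambda>\<epsilon>. map f ` N \<epsilon>) (map f ` K)"
proof -
  let ?m = "map (\<lambda>(v, \<epsilon>). (map f v, \<epsilon> :: bool))"
  have sign: "last_sign (?m ps) = last_sign ps" for ps
    by (cases ps) (auto simp: last_sign_def)
  have word: "map (map_hnn_letter f) (segs_word ps) = segs_word (?m ps)" for ps
    by (induction ps rule: segs_word.induct) (simp_all add: map_stable)
  have ok: "segs_ok N ps \<Longrightarrow> segs_ok (\<lambda>\<epsilon>. map f ` N \<epsilon>) (?m ps)" for ps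
    by (induction N ps rule: segs_ok.induct) (auto simp: sign)
  have "\<exists>qs. segs_ok N qs \<and> ps = ?m qs" if "segs_ok (\<lambda>\<epsilon>. map f ` N \<epsilon>) ps" for ps
    using that
  proof (induction ps)
    case (Cons p ps)
    obtain v \<epsilon> where p: "p = (v, \<epsilon>)" by force
    obtain u where u: "u \<in> N \<epsilon>" "v = map f u" using Cons.prems p by auto
    obtain qs where qs: "segs_ok N qs" "ps = ?m qs" using Cons p by auto
    show ?case
      using Cons.prems p u qs by (intro exI[of _ "(u, \<epsilon>) # qs"]) (auto simp: sign)
  qed (auto intro: exI[of _ "[]"])
  note ko = this
  show ?thesis
  proof (intro equalityI subsetI)
    fix x assume "x \<in> map (map_hnn_letter f) ` hnn_lang N K"
    then obtain ps v where "segs_ok N ps" "v \<in> K" "x = map (map_hnn_letter f) (segs_word ps @ map Base v)"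
      by (auto simp: hnn_lang_def)
    then show "x \<in> hnn_lang (\<lambda>\<epsilon>. map f ` N \<epsilon>) (map f ` K)"
      using ok[of ps] unfolding hnn_lang_def
      by (auto simp: word intro!: exI[of _ "?m ps"] exI[of _ "map f v"])
  next
    fix x assume "x \<in> hnn_lang (\<lambda>\<epsilon>. map f ` N \<epsilon>) (map f ` K)"
    then obtain ps v where ps: "segs_ok (\<lambda>\<epsilon>. map f ` N \<epsilon>) ps" "v \<in> K"
        "x = segs_word ps @ map Base (map f v)"
      by (auto simp: hnn_lang_def)
    from ko[OF ps(1)] obtain qs where "segs_ok N qs" "ps = ?m qs" by blast
    then have "x = map (map_hnn_letter f) (segs_word qs @ map Base v)"
      using ps(3) by (simp add: word)
    then show "x \<in> map (map_hnn_letter f) ` hnn_lang N K"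
      unfolding hnn_lang_def using \<open>segs_ok N qs\<close> ps(2) by blast
  qed
qed

theorem decidable_hnn_lang:
  assumes N: "\<And>\<epsilon>. decidable_lang Y (N \<epsilon>)" and K: "decidable_lang Y K"
  shows "decidable_lang (hnn_alphabet Y) (hnn_lang N K)"
proof -
  obtain \<iota> :: "_ \<Rightarrow> nat" where \<iota>: "inj_on \<iota> Y"
    using finite_imp_inj_to_nat_seg[OF decidable_lang_finite[OF K]] by blast
  let ?\<kappa> = "\<lambda>c. hnn_letter_code (map_hnn_letter \<iota> c)"
  have cs: "code_set \<iota> L = list_encode ` map \<iota> ` L" for L
    by (auto simp: code_set_def)
  have "code_set ?\<kappa> (hnn_lang N K) =
      code_set hnn_letter_code (map (map_hnn_letter \<iota>) ` hnn_lang N K)"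
    by (simp add: code_set_def image_image comp_def)
  also have "\<dots> = code_set hnn_letter_code (hnn_lang (\<lambda>\<epsilon>. map \<iota> ` N \<epsilon>) (map \<iota> ` K))"
    by (simp only: hnn_lang_map)
  finally have code: "code_set ?\<kappa> (hnn_lang N K) = \<dots>" .
  show ?thesis
  proof (rule decidable_langI)
    show "finite (hnn_alphabet Y)"
      using decidable_lang_finite[OF K] by (simp add: hnn_alphabet_def)
    show "hnn_lang N K \<subseteq> lists (hnn_alphabet Y)"
      by (intro hnn_lang_subset decidable_lang_subset N K)
    show "inj_on ?\<kappa> (hnn_alphabet Y)"
    proof (rule inj_onI)
      fix c d assume "c \<in> hnn_alphabet Y" "d \<in> hnn_alphabet Y"
        "hnn_letter_code (map_hnn_letter \<iota> c) = hnn_letter_code (map_hnn_letter \<iota> d)"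
      then show "c = d"
        using \<iota> by (cases c; cases d) (auto simp: hnn_alphabet_def inj_on_eq_iff)
    qed
    show "recp 1 (\<lambda>xs. xs ! 0 \<in> code_set ?\<kappa> (hnn_lang N K))"
      unfolding code
      using decidable_langD[OF N \<iota>] decidable_langD[OF K \<iota>] by (intro recp_hnn_lang) (simp_all only: cs)
  qed
qed

section \<open>Maximal trees and prefix-closed normal forms\<close>

locale tree_edges = group G for G :: "('a, 'b) monoid_scheme" (structure) +
  fixes X :: "'a set" and T :: "('a \<times> 'a) set"
  assumes X: "X \<subseteq> carrier G" and T: "T \<subseteq> carrier G \<times> X"
begin

lemma edge_carrier: "(g, a) \<in> T \<Longrightarrow> g \<in> carrier G" "(g, a) \<in> T \<Longrightarrow> a \<in> carrier G"
  using X T by auto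

lemma tree_path_Nil [simp]: "tree_path G T u [] v \<longleftrightarrow> u = v \<and> u \<in> carrier G"
  by (auto simp: tree_path_def pre_digraph.awalk_def pre_digraph.cas.simps cayley_def)

lemma tree_path_Cons [simp]:
  "tree_path G T u (e # p) v \<longleftrightarrow> e \<in> T \<and> fst e = u \<and> tree_path G T (fst e \<otimes> snd e) p v"
  using edge_carrier[of "fst e" "snd e"]
  by (auto simp: tree_path_def pre_digraph.awalk_def pre_digraph.cas.simps cayley_def split_beta)

lemma tree_path_append:
  "tree_path G T u (p @ q) v \<longleftrightarrow> (\<exists>x. tree_path G T u p x \<and> tree_path G T x q v)"
proof (induction p arbitrary: u)
  case Nil
  have "u \<in> carrier G" if "tree_path G T u q v"
    using that by (simp add: tree_path_def pre_digraph.awalk_def cayley_def)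
  then show ?case by auto
qed auto

end

lemma no_backtrack_simps [simp]:
  "no_backtrack G []" "no_backtrack G [e]"
  "no_backtrack G (e # e' # p) \<longleftrightarrow> e' \<noteq> rev_edge G e \<and> no_backtrack G (e' # p)"
  by (simp_all add: no_backtrack_def)

lemma no_backtrack_tl: "no_backtrack G (e # p) \<Longrightarrow> no_backtrack G p"
  by (cases p) auto

lemma no_backtrack_append:
  "no_backtrack G (p @ q) \<longleftrightarrow> no_backtrack G p \<and> no_backtrack G q \<and>
     (p = [] \<or> q = [] \<or> hd q \<noteq> rev_edge G (last p))"
  by (auto simp: no_backtrack_def successively_append_iff)

locale sym_tree_edges = tree_edges +
  assumes sym_T: "e \<in> T \<Longrightarrow> rev_edge G e \<in> T"
begin

lemma rev_edge_simps: "rev_edge G (g, a) = (g \<otimes> a, inv a)"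
  by (simp add: rev_edge_def)

lemma rev_edge_rev_edge: "e \<in> T \<Longrightarrow> rev_edge G (rev_edge G e) = e"
  using edge_carrier[of "fst e" "snd e"] by (cases e) (simp add: rev_edge_def m_assoc)

lemma tree_path_rev:
  "tree_path G T u p v \<Longrightarrow> tree_path G T v (rev (map (rev_edge G) p)) u"
proof (induction p arbitrary: u)
  case (Cons e p)
  then have e: "e \<in> T" "fst e = u" and "tree_path G T v (rev (map (rev_edge G) p)) (fst e \<otimes> snd e)"
    by auto
  moreover have "tree_path G T (fst e \<otimes> snd e) [rev_edge G e] u"
    using e sym_T[OF e(1)] edge_carrier[of "fst e" "snd e"]
    by (cases e) (simp add: rev_edge_simps m_assoc)
  ultimately show ?case by (auto simp: tree_path_append)
qed simp

lemma no_backtrack_rev: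
  assumes "set p \<subseteq> T" "no_backtrack G p"
  shows "no_backtrack G (rev (map (rev_edge G) p))"
proof -
  have "successively (\<lambda>e e'. rev_edge G e \<noteq> rev_edge G (rev_edge G e')) p"
    using assms
  proof (induction p rule: induct_list012)
    case (3 e e' p)
    then show ?case using rev_edge_rev_edge[of e] rev_edge_rev_edge[of e']
      by (auto simp: no_backtrack_def)
  qed auto
  then show ?thesis by (simp add: no_backtrack_def successively_rev successively_map)
qed

lemma tree_path_subset: "tree_path G T u p v \<Longrightarrow> set p \<subseteq> T"
  by (induction p arbitrary: u) auto

text \<open>An edge put in front of a reduced path either keeps it reduced or cancels against its
  first edge.\<close>

lemma tree_path_reduce:
  "tree_path G T u p v \<Longrightarrow> \<exists>q. tree_path G T u q v \<and> no_backtrack G q"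
proof (induction p arbitrary: u)
  case (Cons e p)
  then obtain q where q: "tree_path G T (fst e \<otimes> snd e) q v" "no_backtrack G q" and e: "e \<in> T" "fst e = u"
    by auto
  show ?case
  proof (cases "\<exists>q'. q = rev_edge G e # q'")
    case True
    then obtain q' where q': "q = rev_edge G e # q'" by blast
    then have "tree_path G T u q' v"
      using q e edge_carrier[of "fst e" "snd e"] by (cases e) (simp add: rev_edge_simps m_assoc)
    then show ?thesis using q(2) q' no_backtrack_tl by blast
  next
    case False
    then have "tree_path G T u (e # q) v \<and> no_backtrack G (e # q)"
      using q e by (cases q) auto
    then show ?thesis by blast
  qed
qed (auto intro: exI[of _ "[]"])

lemma reduced_path_unique:
  assumes closed: "\<forall>u p. tree_path G T u p u \<and> no_backtrack G p \<longrightarrow> p = []"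
  shows "\<lbrakk>tree_path G T u p v; tree_path G T u q v; no_backtrack G p; no_backtrack G q\<rbrakk> \<Longrightarrow> p = q"
proof (induction p arbitrary: u q)
  case Nil
  then show ?case using closed by auto
next
  case (Cons e p)
  show ?case
  proof (cases q)
    case Nil
    then have "u = v" using Cons.prems(2) by simp
    then have "e # p = []" using Cons.prems(1,3) closed by blast
    then show ?thesis by simp
  next
    case (Cons e' q')
    show ?thesis
    proof (cases "e = e'")
      case True
      then show ?thesis
        using Cons.prems Cons Cons.IH[of "fst e \<otimes> snd e" q']
          no_backtrack_tl[of G e p] no_backtrack_tl[of G e' q'] by auto
    next
      case False
      have e: "e \<in> T" using Cons.prems(1) by simp
      \<comment> \<open>The closed path runs back along the first path and out along the second. At
        the junction \<open>rev_edge G e\<close> is followed by \<open>e'\<close>, which differs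
        from its reversal \<open>e\<close>, so nothing backtracks.\<close>
      let ?r = "rev (map (rev_edge G) (e # p)) @ q"
      have "tree_path G T v ?r v"
        using tree_path_rev[OF Cons.prems(1)] Cons.prems(2) tree_path_append by blast
      moreover have "no_backtrack G ?r"
        using no_backtrack_rev[OF tree_path_subset[OF Cons.prems(1)]] Cons.prems(3,4) False
          rev_edge_rev_edge[OF e]
        by (subst no_backtrack_append) (auto simp: Cons)
      ultimately have "?r = []" using closed by blast
      then show ?thesis using Cons by simp
    qed
  qed
qed

lemma nf_eq:
  assumes closed: "\<forall>u p. tree_path G T u p u \<and> no_backtrack G p \<longrightarrow> p = []"
    and p: "tree_path G T \<one> p g" "no_backtrack G p"
  shows "nf G T g = label p"
proof -
  have "(THE p. tree_path G T \<one> p g \<and> no_backtrack G p) = p"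
    using p reduced_path_unique[OF closed] by (intro the_equality) blast+
  then show ?thesis by (simp add: nf_def)
qed

end

text \<open>An edgewise description of tree normal forms: along a tree edge the word gains or loses
  its last letter, and each nontrivial element is reached by a tree edge from the element spelled by
  the word without its last letter. A maximal tree has this property, and conversely it forces
  \<open>T\<close> to be a maximal tree with normal forms \<open>w\<close>.\<close>

definition nf_system ::
    "('a, 'b) monoid_scheme \<Rightarrow> ('a \<times> 'a) set \<Rightarrow> ('a \<Rightarrow> 'a list) \<Rightarrow> bool" where
  "nf_system G T w \<longleftrightarrow>
     w \<one>\<^bsub>G\<^esub> = [] \<and>
     (\<forall>(g, a)\<in>T. w (g \<otimes>\<^bsub>G\<^esub> a) = w g @ [a] \<or> w g = w (g \<otimes>\<^bsub>G\<^esub> a) @ [inv\<^bsub>G\<^esub> a]) \<and>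
     (\<forall>g\<in>carrier G. g = \<one>\<^bsub>G\<^esub> \<or> (\<exists>(g', a)\<in>T. g = g' \<otimes>\<^bsub>G\<^esub> a \<and> w g = w g' @ [a]))"

lemma (in group) maximal_tree_nf_system:
  assumes X: "X \<subseteq> carrier G" and mt: "maximal_tree G X T"
  shows "nf_system G T (nf G T)"
proof -
  interpret sym_tree_edges G X T
    using X mt by unfold_locales (auto simp: maximal_tree_def cayley_def)
  have closed: "\<forall>u p. tree_path G T u p u \<and> no_backtrack G p \<longrightarrow> p = []"
    using mt unfolding maximal_tree_def by blast
  note nf = nf_eq[OF closed]
  have ex: "\<exists>p. tree_path G T \<one> p g \<and> no_backtrack G p" if "g \<in> carrier G" for g
    using mt that tree_path_reduce unfolding maximal_tree_def by blast
  show ?thesis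
    unfolding nf_system_def
  proof (intro conjI ballI)
    show "nf G T \<one> = []" using nf[of "[]" \<one>] by simp
  next
    fix e assume "e \<in> T"
    then obtain g a where e: "e = (g, a)" "(g, a) \<in> T" by (cases e) auto
    then have ga: "g \<in> carrier G" "a \<in> carrier G" by (auto dest: edge_carrier)
    obtain p where p: "tree_path G T \<one> p g" "no_backtrack G p" using ex ga by blast
    have "nf G T (g \<otimes> a) = nf G T g @ [a] \<or> nf G T g = nf G T (g \<otimes> a) @ [inv a]"
    \<comment> \<open>The edge either undoes the last edge of the reduced path to \<open>g\<close>
      or prolongs that path without backtracking.\<close>
    proof (cases "p \<noteq> [] \<and> (g, a) = rev_edge G (last p)")
      case True
      then obtain p' e' where p': "p = p' @ [e']" "(g, a) = rev_edge G e'"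
        by (metis append_butlast_last_id)
      then have "e' \<in> T" using p tree_path_subset by fastforce
      then have e': "e' = (g \<otimes> a, inv a)"
        using p' rev_edge_rev_edge[of e'] by (metis rev_edge_simps)
      have "tree_path G T \<one> p' (g \<otimes> a)" "no_backtrack G p'"
        using p p' e' by (auto simp: tree_path_append no_backtrack_append)
      then show ?thesis using nf[OF p] nf[of p' "g \<otimes> a"] p' e' by simp
    next
      case False
      have "tree_path G T \<one> (p @ [(g, a)]) (g \<otimes> a)" "no_backtrack G (p @ [(g, a)])"
        using p False e ga by (auto simp: tree_path_append no_backtrack_append)
      then show ?thesis using nf[OF p] nf[of "p @ [(g, a)]" "g \<otimes> a"] by simp
    qed
    then show "case e of (g, a) \<Rightarrow> nf G T (g \<otimes> a) = nf G T g @ [a] \<or> nf G T g = nf G T (g \<otimes> a) @ [inv a]"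
      by (simp add: e)
  next
    fix g assume "g \<in> carrier G"
    then obtain p where p: "tree_path G T \<one> p g" "no_backtrack G p" using ex by blast
    show "g = \<one> \<or> (\<exists>(g', a)\<in>T. g = g' \<otimes> a \<and> nf G T g = nf G T g' @ [a])"
    proof (cases p rule: rev_cases)
      case Nil
      then show ?thesis using p by simp
    next
      case (snoc p' e)
      then have "tree_path G T \<one> p' (fst e)" "no_backtrack G p'" "e \<in> T" "g = fst e \<otimes> snd e"
        using p by (auto simp: tree_path_append no_backtrack_append)
      then show ?thesis using nf[OF p] nf[of p' "fst e"] snoc
        by (intro disjI2 bexI[of _ e]) (simp_all add: split_beta)
    qed
  qed
qed

context sym_tree_edges
begin

context
  fixes w assumes w: "nf_system G T w"
begin

lemma nf_system_edge: "(g, a) \<in> T \<Longrightarrow> w (g \<otimes> a) = w g @ [a] \<or> w g = w (g \<otimes> a) @ [inv a]"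
  using w by (auto simp: nf_system_def)

text \<open>A path without backtracking that once moves away from the root keeps doing so, because the
  only edge towards the root reverses the previous one.\<close>

lemma ascending_path:
  "\<lbrakk>tree_path G T u (e # p) v; no_backtrack G (e # p); w (u \<otimes> snd e) = w u @ [snd e]\<rbrakk>
    \<Longrightarrow> w v = w u @ label (e # p)"
proof (induction p arbitrary: u e)
  case (Cons e' p)
  let ?x = "u \<otimes> snd e"
  have e: "e = (u, snd e)" "e \<in> T" "e' = (?x, snd e')" "(?x, snd e') \<in> T"
    using Cons.prems(1) by (auto simp: prod_eq_iff) (metis prod.collapse)
  have "w ?x \<noteq> w (?x \<otimes> snd e') @ [inv (snd e')]"
  proof
    assume "w ?x = w (?x \<otimes> snd e') @ [inv (snd e')]"
    then have "inv (snd e') = snd e" using Cons.prems(3) by simp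
    then have "snd e' = inv (snd e)" using edge_carrier[OF e(4)] by (metis inv_inv)
    then have "e' = rev_edge G e" using e by (metis rev_edge_simps)
    then show False using Cons.prems(2) by simp
  qed
  then have "w (?x \<otimes> snd e') = w ?x @ [snd e']" using nf_system_edge[OF e(4)] by blast
  then have "w v = w ?x @ label (e' # p)"
    using Cons.prems no_backtrack_tl[of G e "e' # p"] by (intro Cons.IH) auto
  then show ?case using Cons.prems(3) by simp
qed auto

text \<open>A reduced closed path cannot start away from the root, since it would then end at a
  vertex with a longer word. So its first edge leads towards the root, and by symmetry so does the
  first edge of the reversed path. Both are determined by the last letter of \<open>w u\<close>,
  hence equal; stripping the two ends leaves a shorter reduced closed path.\<close>

lemma nf_system_closed_path:
  "tree_path G T u p u \<Longrightarrow> no_backtrack G p \<Longrightarrow> p = []"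
proof (induction "length p" arbitrary: u p rule: less_induct)
  case less
  have down: "w u = w (u \<otimes> snd (hd p)) @ [inv (snd (hd p))] \<and> (u, snd (hd p)) = hd p \<and> hd p \<in> T"
    if path: "tree_path G T u p u" "no_backtrack G p" "p \<noteq> []" for p
  proof -
    obtain e q where p: "p = e # q" using path by (cases p) auto
    then have "(u, snd e) = e" "e \<in> T" using path by auto
    then show ?thesis using ascending_path[of u e q u] nf_system_edge[of u "snd e"] path p by auto
  qed
  show ?case
  proof (rule ccontr)
    assume ne: "p \<noteq> []"
    let ?r = "rev (map (rev_edge G) p)"
    have "tree_path G T u ?r u" "no_backtrack G ?r" "?r \<noteq> []"
      using ne tree_path_rev[OF less.prems(1)]
        no_backtrack_rev[OF tree_path_subset[OF less.prems(1)] less.prems(2)] by simp_all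
    from down[OF this] have 1: "w u = w (u \<otimes> snd (hd ?r)) @ [inv (snd (hd ?r))]"
      "(u, snd (hd ?r)) = hd ?r" "hd ?r \<in> T" by auto
    from down[OF less.prems ne] have 2: "w u = w (u \<otimes> snd (hd p)) @ [inv (snd (hd p))]"
      "(u, snd (hd p)) = hd p" "hd p \<in> T" by auto
    have "inv (snd (hd ?r)) = inv (snd (hd p))" using 1(1) 2(1) by simp
    then have "snd (hd ?r) = snd (hd p)"
      using 1 2 edge_carrier by (metis inv_inv)
    then have hd: "hd ?r = hd p" using 1(2) 2(2) by metis
    have hdr: "hd ?r = rev_edge G (last p)" using ne by (simp add: hd_rev last_map)
    have last: "last p \<in> T" using tree_path_subset[OF less.prems(1)] ne by auto
    have eq: "last p = rev_edge G (hd p)"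
      using hd hdr rev_edge_rev_edge[OF last] by metis
    obtain e q where p: "p = e # q" using ne by (cases p) auto
    show False
    proof (cases q rule: rev_cases)
      case Nil
      \<comment> \<open>A single edge would be a loop, although it shortens the word.\<close>
      then have "u \<otimes> snd e = u" using less.prems(1) p by auto
      then show False using 2(1) p by simp
    next
      case (snoc q' e')
      have e': "e' = rev_edge G e" using eq p snoc by simp
      then have "fst e' = fst e \<otimes> snd e" by (cases e) (simp add: rev_edge_simps)
      then have "tree_path G T (fst e \<otimes> snd e) q' (fst e \<otimes> snd e)"
        using less.prems(1) p snoc by (auto simp: tree_path_append)
      moreover have "no_backtrack G q'"
        using less.prems(2) p snoc no_backtrack_tl[of G e "q' @ [e']"] by (auto simp: no_backtrack_append)
      \<comment> \<open>What remains is an edge followed by its reversal, which is a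
        backtrack.\<close>
      ultimately have "q' = []" using less.hyps[of q'] p snoc by simp
      then show False using less.prems(2) p snoc e' by simp
    qed
  qed
qed

lemma nf_system_path_from_one:
  "g \<in> carrier G \<Longrightarrow> \<exists>p. tree_path G T \<one> p g"
proof (induction "length (w g)" arbitrary: g rule: less_induct)
  case less
  show ?case
  proof (cases "g = \<one>")
    case True
    then show ?thesis by (auto intro: exI[of _ "[]"])
  next
    case False
    then obtain g' a where ga: "(g', a) \<in> T" "g = g' \<otimes> a" "w g = w g' @ [a]"
      using w less.prems unfolding nf_system_def by blast
    then obtain p where "tree_path G T \<one> p g'"
      using less.hyps[of g'] edge_carrier by auto
    then have "tree_path G T \<one> (p @ [(g', a)]) g"
      using ga less.prems by (auto simp: tree_path_append)
    then show ?thesis by blast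
  qed
qed

lemma nf_system_maximal_tree: "maximal_tree G X T"
proof -
  have "\<exists>p. tree_path G T u p v" if "u \<in> carrier G" "v \<in> carrier G" for u v
    using nf_system_path_from_one[OF that(1)] nf_system_path_from_one[OF that(2)]
      tree_path_rev tree_path_append by meson
  then show ?thesis
    using T sym_T nf_system_closed_path by (auto simp: maximal_tree_def cayley_def)
qed

lemma nf_system_nf:
  assumes "g \<in> carrier G"
  shows "nf G T g = w g"
proof -
  obtain p where p: "tree_path G T \<one> p g" "no_backtrack G p"
    using nf_system_path_from_one[OF assms] tree_path_reduce by blast
  have w1: "w \<one> = []" using w by (simp add: nf_system_def)
  have "w g = label p"
  proof (cases p)
    case Nil
    then show ?thesis using p w1 by simp
  next
    case (Cons e q)
    then have "(\<one>, snd e) \<in> T" using p by (metis prod.collapse tree_path_Cons)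
    then have "w (\<one> \<otimes> snd e) = w \<one> @ [snd e]" using nf_system_edge[of \<one> "snd e"] w1 by auto
    then show ?thesis
      using ascending_path[OF p(1)[unfolded Cons] p(2)[unfolded Cons]] w1 Cons by simp
  qed
  then show ?thesis using nf_eq[OF _ p] nf_system_closed_path by metis
qed

lemma nf_system_word:
  "g \<in> carrier G \<Longrightarrow> word_val G (w g) = g \<and> w g \<in> lists X"
proof (induction "length (w g)" arbitrary: g rule: less_induct)
  case less
  have app: "word_val G (u @ [a]) = word_val G u \<otimes> a" if "u \<in> lists X" "a \<in> X" for u a
  proof -
    have "word_val G (u @ [a]) = word_val G u \<otimes> a \<and> word_val G u \<in> carrier G"
      using that X unfolding subset_iff by (induction u) (auto simp: word_val_def m_assoc)
    then show ?thesis by blast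
  qed
  show ?case
  proof (cases "g = \<one>")
    case True
    then show ?thesis using w by (simp add: word_val_def nf_system_def)
  next
    case False
    then obtain g' a where ga: "(g', a) \<in> T" "g = g' \<otimes> a" "w g = w g' @ [a]"
      using w less.prems unfolding nf_system_def by blast
    then have "word_val G (w g') = g'" "w g' \<in> lists X" "a \<in> X"
      using less.hyps[of g'] edge_carrier T by auto
    then show ?thesis using ga app[of "w g'" a] by simp
  qed
qed

end

end

section \<open>The normal form theorem for HNN extensions\<close>

lemma (in group) subgroup_mon_image:
  assumes "subgroup A G" "f \<in> mon (G\<lparr>carrier := A\<rparr>) G"
  shows "subgroup (f ` A) G"
proof -
  interpret group_hom "G\<lparr>carrier := A\<rparr>" G f
    using assms(2) subgroup.subgroup_is_group[OF assms(1) is_group] is_group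
    by (simp add: mon_def group_hom_def group_hom_axioms_def)
  show ?thesis using img_is_subgroup by simp
qed

locale hnn = group H for H :: "('a, 'b) monoid_scheme" (structure) +
  fixes A :: "'a set" and \<psi> :: "'a \<Rightarrow> 'a" and R :: "bool \<Rightarrow> 'a set"
  assumes A: "subgroup A H" and \<psi>: "\<psi> \<in> mon (H\<lparr>carrier := A\<rparr>) H"
    and R_carrier: "R \<epsilon> \<subseteq> carrier H" and one_R: "\<one> \<in> R \<epsilon>"
    and R_unique: "h \<in> carrier H \<Longrightarrow> \<exists>!\<tau>. \<tau> \<in> R \<epsilon> \<and> inv \<tau> \<otimes> h \<in> (if \<epsilon> then \<psi> ` A else A)"
begin

text \<open>In the group, \<open>b s\<^sup>\<epsilon> = s\<^sup>\<epsilon> (\<theta> \<epsilon> b)\<close> for \<open>b \<in> D \<epsilon>\<close>.\<close>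

definition D :: "bool \<Rightarrow> 'a set" where
  "D \<epsilon> = (if \<epsilon> then \<psi> ` A else A)"

definition \<theta> :: "bool \<Rightarrow> 'a \<Rightarrow> 'a" where
  "\<theta> \<epsilon> = (if \<epsilon> then inv_into A \<psi> else \<psi>)"

lemma \<psi>_inj: "inj_on \<psi> A"
  using \<psi> by (simp add: mon_def)

lemma \<psi>_mult: "a \<in> A \<Longrightarrow> b \<in> A \<Longrightarrow> \<psi> (a \<otimes> b) = \<psi> a \<otimes> \<psi> b"
  using \<psi> by (auto simp: mon_def hom_def)

lemma subgroup_D: "subgroup (D \<epsilon>) H"
  using A subgroup_mon_image[OF A \<psi>] by (simp add: D_def)

lemma D_carrier: "b \<in> D \<epsilon> \<Longrightarrow> b \<in> carrier H"
  using subgroup.subset[OF subgroup_D] by blast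

lemma \<theta>_D: "b \<in> D \<epsilon> \<Longrightarrow> \<theta> \<epsilon> b \<in> D (\<not> \<epsilon>)"
  by (auto simp: D_def \<theta>_def inv_into_into split: if_splits)

lemma \<theta>_inverse: "b \<in> D \<epsilon> \<Longrightarrow> \<theta> (\<not> \<epsilon>) (\<theta> \<epsilon> b) = b"
  using \<psi>_inj by (auto simp: D_def \<theta>_def f_inv_into_f split: if_splits)

lemma \<theta>_mult: "b \<in> D \<epsilon> \<Longrightarrow> c \<in> D \<epsilon> \<Longrightarrow> \<theta> \<epsilon> (b \<otimes> c) = \<theta> \<epsilon> b \<otimes> \<theta> \<epsilon> c"
proof (cases \<epsilon>)
  case True
  assume "b \<in> D \<epsilon>" "c \<in> D \<epsilon>"
  then obtain x y where "x \<in> A" "y \<in> A" "b = \<psi> x" "c = \<psi> y" using True by (auto simp: D_def)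
  then show ?thesis
    using True \<psi>_inj A by (simp add: \<theta>_def subgroup.m_closed flip: \<psi>_mult)
qed (simp add: D_def \<theta>_def \<psi>_mult)

lemma \<theta>_carrier: "b \<in> D \<epsilon> \<Longrightarrow> \<theta> \<epsilon> b \<in> carrier H"
  using \<theta>_D D_carrier by blast

lemma one_D: "\<one> \<in> D \<epsilon>"
  by (rule subgroup.one_closed[OF subgroup_D])

lemma \<theta>_one: "\<theta> \<epsilon> \<one> = \<one>"
proof -
  have "\<theta> \<epsilon> \<one> \<otimes> \<theta> \<epsilon> \<one> = \<theta> \<epsilon> \<one>"
    using \<theta>_mult[of \<one> \<epsilon> \<one>] one_D by simp
  then show ?thesis using \<theta>_carrier[OF one_D, of \<epsilon>] by (metis l_cancel_one')
qed

definition rep :: "bool \<Rightarrow> 'a \<Rightarrow> 'a" where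
  "rep \<epsilon> h = (THE \<tau>. \<tau> \<in> R \<epsilon> \<and> inv \<tau> \<otimes> h \<in> D \<epsilon>)"

definition rest :: "bool \<Rightarrow> 'a \<Rightarrow> 'a" where
  "rest \<epsilon> h = inv (rep \<epsilon> h) \<otimes> h"

lemma rep_rest:
  assumes "h \<in> carrier H"
  shows rep_R: "rep \<epsilon> h \<in> R \<epsilon>" and rest_D: "rest \<epsilon> h \<in> D \<epsilon>"
    and rep_mult_rest: "rep \<epsilon> h \<otimes> rest \<epsilon> h = h"
proof -
  have "rep \<epsilon> h \<in> R \<epsilon> \<and> inv (rep \<epsilon> h) \<otimes> h \<in> D \<epsilon>"
    unfolding rep_def D_def by (rule theI'[OF R_unique[OF assms]])
  then show "rep \<epsilon> h \<in> R \<epsilon>" "rest \<epsilon> h \<in> D \<epsilon>" by (simp_all add: rest_def)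
  then show "rep \<epsilon> h \<otimes> rest \<epsilon> h = h"
    using R_carrier[of \<epsilon>] assms by (auto simp: rest_def simp flip: m_assoc)
qed

lemma rep_eqI:
  assumes "\<tau> \<in> R \<epsilon>" "b \<in> D \<epsilon>"
  shows rep_eq: "rep \<epsilon> (\<tau> \<otimes> b) = \<tau>" and rest_eq: "rest \<epsilon> (\<tau> \<otimes> b) = b"
proof -
  have c: "\<tau> \<in> carrier H" "b \<in> carrier H" using assms R_carrier D_carrier by auto
  then have b: "inv \<tau> \<otimes> (\<tau> \<otimes> b) = b" by (simp flip: m_assoc)
  show *: "rep \<epsilon> (\<tau> \<otimes> b) = \<tau>"
    unfolding rep_def D_def
    by (rule the1_equality[OF R_unique]) (use assms c b in \<open>auto simp: D_def\<close>)
  show "rest \<epsilon> (\<tau> \<otimes> b) = b" by (simp add: rest_def * b)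
qed

lemma rep_mult:
  assumes "h \<in> carrier H" "b \<in> D \<epsilon>"
  shows rep_mult_D: "rep \<epsilon> (h \<otimes> b) = rep \<epsilon> h" and rest_mult_D: "rest \<epsilon> (h \<otimes> b) = rest \<epsilon> h \<otimes> b"
proof -
  have rb: "rest \<epsilon> h \<otimes> b \<in> D \<epsilon>"
    using rest_D[OF assms(1)] assms(2) by (rule subgroup.m_closed[OF subgroup_D])
  have "h \<otimes> b = rep \<epsilon> h \<otimes> rest \<epsilon> h \<otimes> b"
    by (simp add: rep_mult_rest[OF assms(1)])
  also have "\<dots> = rep \<epsilon> h \<otimes> (rest \<epsilon> h \<otimes> b)"
    using assms rep_R[OF assms(1)] rest_D[OF assms(1)] R_carrier by (intro m_assoc) (auto intro: D_carrier)
  finally have eq: "h \<otimes> b = rep \<epsilon> h \<otimes> (rest \<epsilon> h \<otimes> b)" .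
  show "rep \<epsilon> (h \<otimes> b) = rep \<epsilon> h" "rest \<epsilon> (h \<otimes> b) = rest \<epsilon> h \<otimes> b"
    unfolding eq using rep_eqI[OF rep_R[OF assms(1)] rb] by simp_all
qed

lemma rep_of_R: "\<tau> \<in> R \<epsilon> \<Longrightarrow> rep \<epsilon> \<tau> = \<tau>" and rest_of_R: "\<tau> \<in> R \<epsilon> \<Longrightarrow> rest \<epsilon> \<tau> = \<one>"
  using rep_eqI[of \<tau> \<epsilon> \<one>] one_D R_carrier by (auto simp: subset_iff)

lemma rest_one_iff: "h \<in> carrier H \<Longrightarrow> rest \<epsilon> h = \<one> \<longleftrightarrow> h \<in> R \<epsilon>"
  using rep_rest[of h \<epsilon>] rest_of_R R_carrier[of \<epsilon>] by (metis r_one subsetD)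

section \<open>Right action on reduced expressions\<close>

fun pref_ok :: "('a \<times> bool) list \<Rightarrow> bool" where
  "pref_ok [] \<longleftrightarrow> True"
| "pref_ok ((\<tau>, \<epsilon>) # p) \<longleftrightarrow> \<tau> \<in> R \<epsilon> \<and> \<not> (\<tau> = \<one> \<and> last_sign p = Some (\<not> \<epsilon>)) \<and> pref_ok p"

text \<open>The states \<open>([(\<tau>\<^sub>n, \<epsilon>\<^sub>n), \<dots>, (\<tau>\<^sub>1, \<epsilon>\<^sub>1)], h)\<close> stand for the reduced expressions
  \<open>\<tau>\<^sub>1 s\<^bsup>\<epsilon>\<^sub>1\<^esup> \<dots> \<tau>\<^sub>n s\<^bsup>\<epsilon>\<^sub>n\<^esup> h\<close>.  As in van der Waerden's argument, they are shown to be
  pairwise different by letting the extension act on them from the right.\<close>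

definition states :: "(('a \<times> bool) list \<times> 'a) set" where
  "states = {(p, h). pref_ok p \<and> h \<in> carrier H}"

text \<open>Right multiplication by a stable letter: the part \<open>rest \<epsilon> h\<close> in
  the associated subgroup is carried across by \<open>\<theta>\<close>. If the representative left
  behind is trivial and follows the opposite letter, the two letters cancel and the representative
  before them joins the base factor.\<close>

definition step :: "bool \<Rightarrow> ('a \<times> bool) list \<times> 'a \<Rightarrow> ('a \<times> bool) list \<times> 'a" where
  "step \<epsilon> = (\<lambda>(p, h). if rep \<epsilon> h = \<one> \<and> last_sign p = Some (\<not> \<epsilon>)
     then (tl p, fst (hd p) \<otimes> \<theta> \<epsilon> (rest \<epsilon> h)) else ((rep \<epsilon> h, \<epsilon>) # p, \<theta> \<epsilon> (rest \<epsilon> h)))"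

text \<open>The congruence \<open>hnn_eq\<close> also relates words with letters outside
  \<open>carrier H\<close>; letting these act trivially keeps the action total on
  \<open>states\<close>.\<close>

fun act :: "('a \<times> bool) list \<times> 'a \<Rightarrow> 'a hnn_letter \<Rightarrow> ('a \<times> bool) list \<times> 'a" where
  "act s (Base k) = (if k \<in> carrier H then (fst s, snd s \<otimes> k) else s)"
| "act s Stable = step True s"
| "act s StableInv = step False s"

lemma act_stable: "act s (stable \<epsilon>) = step \<epsilon> s"
  by (simp add: stable_def)

lemma last_sign_SomeE:
  assumes "last_sign p = Some \<epsilon>"
  obtains \<tau> q where "p = (\<tau>, \<epsilon>) # q"
  using assms by (cases p) (auto simp: last_sign_def)

lemma step_cases:
  assumes "(p, h) \<in> states"
  obtains (cancel) \<tau> q where "p = (\<tau>, \<not> \<epsilon>) # q" "rep \<epsilon> h = \<one>" "\<tau> \<in> R (\<not> \<epsilon>)" "\<tau> \<in> carrier H"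
      "step \<epsilon> (p, h) = (q, \<tau> \<otimes> \<theta> \<epsilon> (rest \<epsilon> h))" "(q, \<tau>) \<in> states"
  | (push) "\<not> (rep \<epsilon> h = \<one> \<and> last_sign p = Some (\<not> \<epsilon>))"
      "step \<epsilon> (p, h) = ((rep \<epsilon> h, \<epsilon>) # p, \<theta> \<epsilon> (rest \<epsilon> h))"
proof (cases "rep \<epsilon> h = \<one> \<and> last_sign p = Some (\<not> \<epsilon>)")
  case True
  then obtain \<tau> q where p: "p = (\<tau>, \<not> \<epsilon>) # q" by (auto elim: last_sign_SomeE)
  then have "\<tau> \<in> R (\<not> \<epsilon>)" "pref_ok q" using assms by (auto simp: states_def)
  then show ?thesis
    using True p R_carrier by (intro cancel) (auto simp: step_def states_def)
next
  case False
  then show ?thesis by (intro push) (auto simp: step_def)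
qed

lemma step_states: "s \<in> states \<Longrightarrow> step \<epsilon> s \<in> states"
proof -
  assume s: "s \<in> states"
  obtain p h where ph: "s = (p, h)" by force
  then have p: "(p, h) \<in> states" "pref_ok p" "h \<in> carrier H" using s by (auto simp: states_def)
  show ?thesis
    using p(1)
  proof (cases rule: step_cases[where \<epsilon> = \<epsilon>])
    case (cancel \<tau> q)
    then show ?thesis using \<theta>_carrier[OF rest_D[OF p(3)]] by (auto simp: ph states_def)
  next
    case push
    then show ?thesis
      using \<theta>_carrier[OF rest_D[OF p(3)]] rep_R[OF p(3)] p(2) by (auto simp: ph states_def)
  qed
qed

lemma act_states: "s \<in> states \<Longrightarrow> act s c \<in> states"
  by (cases c) (auto simp: step_states, auto simp: states_def)

lemma foldl_act_states: "s \<in> states \<Longrightarrow> foldl act s w \<in> states"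
  by (induction w arbitrary: s) (simp_all add: act_states)

text \<open>Expresses that \<open>b\<close> passes the stable letter as
  \<open>\<theta> \<epsilon> b\<close>. Splitting off such a factor reduces the study of
  \<open>step\<close> to transversal elements, where \<open>step_R\<close> is explicit.\<close>

lemma step_mult:
  assumes "(p, h) \<in> states" "b \<in> D \<epsilon>"
  shows "step \<epsilon> (p, h \<otimes> b) = act (step \<epsilon> (p, h)) (Base (\<theta> \<epsilon> b))"
proof -
  have h: "h \<in> carrier H" and b: "b \<in> carrier H" using assms D_carrier by (auto simp: states_def)
  have st: "(p, h \<otimes> b) \<in> states" using assms h b by (auto simp: states_def)
  note r = rep_mult[OF h assms(2)] \<theta>_mult[OF rest_D[OF h] assms(2)]
    \<theta>_carrier[OF assms(2)] \<theta>_carrier[OF rest_D[OF h]]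
  show ?thesis
    using assms(1)
  proof (cases rule: step_cases[where \<epsilon> = \<epsilon>])
    case (cancel \<tau> q)
    then show ?thesis using r by (simp add: m_assoc) (simp add: step_def last_sign_def m_assoc)
  next
    case push
    then show ?thesis using r by (auto simp: step_def)
  qed
qed

lemma step_R:
  assumes "(p, \<tau>) \<in> states" "\<tau> \<in> R \<epsilon>"
  shows "step \<epsilon> (p, \<tau>) = (if \<tau> = \<one> \<and> last_sign p = Some (\<not> \<epsilon>) then (tl p, fst (hd p))
    else ((\<tau>, \<epsilon>) # p, \<one>))"
  using assms(1)
proof (cases rule: step_cases[where \<epsilon> = \<epsilon>])
  case (cancel \<tau>' q)
  then show ?thesis
    using assms(2) by (simp add: rep_of_R rest_of_R \<theta>_one last_sign_def)
next
  case push
  then show ?thesis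
    using assms(2) by (auto simp: rep_of_R rest_of_R \<theta>_one)
qed

text \<open>Once \<open>rest \<epsilon> h\<close> is split off, a pair that was cancelled is pushed
  again, which is permitted because \<open>p\<close> was reduced; a letter that was pushed is
  followed by the trivial factor and hence cancels.\<close>

lemma step_inverse: "s \<in> states \<Longrightarrow> step (\<not> \<epsilon>) (step \<epsilon> s) = s"
proof -
  assume s: "s \<in> states"
  obtain p h where ph: "s = (p, h)" by force
  then have p: "(p, h) \<in> states" "pref_ok p" and h: "h \<in> carrier H" using s by (auto simp: states_def)
  note b = rest_D[OF h, of \<epsilon>]
  show ?thesis
    using p(1)
  proof (cases rule: step_cases[where \<epsilon> = \<epsilon>])
    case (cancel \<tau> q)
    have "step (\<not> \<epsilon>) (q, \<tau> \<otimes> \<theta> \<epsilon> (rest \<epsilon> h)) = act (step (\<not> \<epsilon>) (q, \<tau>)) (Base (rest \<epsilon> h))"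
      using step_mult[OF cancel(6) \<theta>_D[OF b]] by (simp add: \<theta>_inverse[OF b])
    also have "step (\<not> \<epsilon>) (q, \<tau>) = (p, \<one>)"
      using step_R[OF cancel(6) cancel(3)] p(2) cancel(1) by auto
    finally show ?thesis
      using cancel rep_mult_rest[OF h, of \<epsilon>] D_carrier[OF b] by (simp add: ph)
  next
    case push
    let ?p = "(rep \<epsilon> h, \<epsilon>) # p"
    have st: "(?p, \<one>) \<in> states"
      using push p rep_R[OF h, of \<epsilon>] by (auto simp: states_def)
    have "step (\<not> \<epsilon>) (?p, \<one> \<otimes> \<theta> \<epsilon> (rest \<epsilon> h)) = act (step (\<not> \<epsilon>) (?p, \<one>)) (Base (rest \<epsilon> h))"
      using step_mult[OF st \<theta>_D[OF b]] by (simp add: \<theta>_inverse[OF b])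
    also have "step (\<not> \<epsilon>) (?p, \<one>) = (p, rep \<epsilon> h)"
      using step_R[OF st one_R] by (simp add: last_sign_def)
    finally show ?thesis
      using push rep_mult_rest[OF h, of \<epsilon>] D_carrier[OF b] \<theta>_carrier[OF b] by (simp add: ph)
  qed
qed

lemma act_hnn_eq: "hnn_eq H A \<psi> u v \<Longrightarrow> s \<in> states \<Longrightarrow> foldl act s u = foldl act s v"
proof (induction arbitrary: s rule: hnn_eq.induct)
  case (cong u v p q)
  then show ?case by (simp add: foldl_act_states)
next
  case base_one
  then show ?case by (auto simp: states_def)
next
  case (base_mult h k)
  then show ?case by (auto simp: states_def m_assoc)
next
  case stable_inv
  then show ?case using step_inverse[of s True] by simp
next
  case inv_stable
  then show ?case using step_inverse[of s False] by simp
next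
  case (conj a)
  obtain p h where s: "s = (p, h)" by force
  have a: "\<psi> a \<in> D True" "\<theta> True (\<psi> a) = a" "\<psi> a \<in> carrier H"
    using conj.hyps \<psi>_inj D_carrier[of "\<psi> a" True] by (auto simp: D_def \<theta>_def)
  have st: "(p, h \<otimes> \<psi> a) \<in> states"
    using conj.prems a(3) by (auto simp: s states_def)
  \<comment> \<open>The relation is used in the form \<open>\<psi> a\<close> times \<open>s\<close>
    equals \<open>s\<close> times \<open>a\<close>; the remaining \<open>s\<close> is then removed
    by \<open>step_inverse\<close>.\<close>
  have "act (step True (p, h)) (Base a) = step True (p, h \<otimes> \<psi> a)"
    using step_mult[of p h "\<psi> a" True] conj.prems a by (simp add: s)
  then show ?case
    using step_inverse[OF st, of True] a(3) by (simp add: s del: act.simps(1)) (simp add: s)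
qed auto

section \<open>Reduced expressions as elements of the extension\<close>

abbreviation G where "G \<equiv> HNN H A \<psi>"

definition \<kappa> :: "'a hnn_letter \<Rightarrow> 'a hnn_letter list set" where
  "\<kappa> c = hnn_class H A \<psi> [c]"

fun pref_word :: "('a \<times> bool) list \<Rightarrow> 'a hnn_letter list" where
  "pref_word [] = []"
| "pref_word ((\<tau>, \<epsilon>) # p) = pref_word p @ [Base \<tau>, stable \<epsilon>]"

definition el :: "('a \<times> bool) list \<times> 'a \<Rightarrow> 'a hnn_letter list set" where
  "el s = hnn_class H A \<psi> (pref_word (fst s) @ [Base (snd s)])"

lemma group_G: "group G"
  using group_HNN is_group by blast

lemma one_G: "\<one>\<^bsub>G\<^esub> = hnn_class H A \<psi> []"
  by (simp add: HNN_def)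

lemma class_append:
  "hnn_class H A \<psi> (u @ v) = hnn_class H A \<psi> u \<otimes>\<^bsub>G\<^esub> hnn_class H A \<psi> v"
  by (simp add: hnn_mult_class)

lemma class_carrier: "w \<in> hnn_words H \<Longrightarrow> hnn_class H A \<psi> w \<in> carrier G"
  by (simp add: HNN_def)

lemma \<kappa>_carrier: "c \<in> hnn_alphabet (carrier H) \<Longrightarrow> \<kappa> c \<in> carrier G"
  unfolding \<kappa>_def by (intro class_carrier) (auto simp: hnn_words_def hnn_alphabet_def)

lemma stable_alphabet: "stable \<epsilon> \<in> hnn_alphabet Y"
  by (auto simp: stable_def hnn_alphabet_def)

lemma Base_alphabet: "Base y \<in> hnn_alphabet Y \<longleftrightarrow> y \<in> Y"
  by (auto simp: hnn_alphabet_def)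

lemma alphabetE:
  assumes "c \<in> hnn_alphabet Y"
  obtains y where "c = Base y" "y \<in> Y" | \<epsilon> where "c = stable \<epsilon>"
  using assms unfolding hnn_alphabet_def stable_def by (auto split: if_splits) metis

lemma \<kappa>_Base_carrier [simp]: "k \<in> carrier H \<Longrightarrow> \<kappa> (Base k) \<in> carrier G"
  by (intro \<kappa>_carrier) (simp add: Base_alphabet)

lemma \<kappa>_stable_carrier [simp]: "\<kappa> (stable \<epsilon>) \<in> carrier G"
  by (intro \<kappa>_carrier stable_alphabet)

lemma \<kappa>_Base_mult: "h \<in> carrier H \<Longrightarrow> k \<in> carrier H \<Longrightarrow>
    \<kappa> (Base h) \<otimes>\<^bsub>G\<^esub> \<kappa> (Base k) = \<kappa> (Base (h \<otimes> k))"
  using hnn_eq.base_mult by (auto simp: \<kappa>_def hnn_mult_class hnn_class_eq_iff)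

lemma \<kappa>_Base_one: "\<kappa> (Base \<one>) = \<one>\<^bsub>G\<^esub>"
  using hnn_eq.base_one[of H A \<psi>] by (simp add: \<kappa>_def one_G hnn_class_eq_iff)

lemma \<kappa>_stable_cancel: "\<kappa> (stable \<epsilon>) \<otimes>\<^bsub>G\<^esub> \<kappa> (stable (\<not> \<epsilon>)) = \<one>\<^bsub>G\<^esub>"
proof -
  have "hnn_eq H A \<psi> ([stable \<epsilon>] @ [stable (\<not> \<epsilon>)]) []"
    by (simp add: stable_def hnn_eq.stable_inv hnn_eq.inv_stable)
  then show ?thesis by (simp add: \<kappa>_def hnn_mult_class one_G hnn_class_eq_iff)
qed

lemma \<kappa>_stable_inv: "inv\<^bsub>G\<^esub> \<kappa> (stable \<epsilon>) = \<kappa> (stable (\<not> \<epsilon>))"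
proof -
  interpret G: group G by (rule group_G)
  show ?thesis using \<kappa>_stable_cancel[of "\<not> \<epsilon>"] by (intro G.inv_equality) auto
qed

lemma \<kappa>_Base_inv: "k \<in> carrier H \<Longrightarrow> inv\<^bsub>G\<^esub> \<kappa> (Base k) = \<kappa> (Base (inv k))"
proof -
  interpret G: group G by (rule group_G)
  assume "k \<in> carrier H"
  then show ?thesis by (intro G.inv_equality) (simp_all add: \<kappa>_Base_mult \<kappa>_Base_one)
qed

text \<open>For both exponents this is the same defining relation, with a stable letter cancelled on
  the right or on the left.\<close>

lemma \<kappa>_commute:
  assumes "b \<in> D \<epsilon>"
  shows "\<kappa> (Base b) \<otimes>\<^bsub>G\<^esub> \<kappa> (stable \<epsilon>) = \<kappa> (stable \<epsilon>) \<otimes>\<^bsub>G\<^esub> \<kappa> (Base (\<theta> \<epsilon> b))"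
proof -
  interpret G: group G by (rule group_G)
  have conj: "\<kappa> (stable True) \<otimes>\<^bsub>G\<^esub> \<kappa> (Base a) \<otimes>\<^bsub>G\<^esub> \<kappa> (stable False) = \<kappa> (Base (\<psi> a))"
    if "a \<in> A" for a
    using hnn_eq.conj[OF that, of H \<psi>] by (simp add: \<kappa>_def hnn_mult_class hnn_class_eq_iff stable_def)
  have c: "a \<in> carrier H" "\<psi> a \<in> carrier H" if "a \<in> A" for a
    using that D_carrier[of a False] D_carrier[of "\<psi> a" True] by (auto simp: D_def)
  have 1: "\<kappa> (Base (\<psi> a)) \<otimes>\<^bsub>G\<^esub> \<kappa> (stable True) = \<kappa> (stable True) \<otimes>\<^bsub>G\<^esub> \<kappa> (Base a)" if "a \<in> A" for a
    using c[OF that] \<kappa>_stable_cancel[of False] by (simp add: G.m_assoc flip: conj[OF that])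
  have "\<kappa> (Base a) \<otimes>\<^bsub>G\<^esub> \<kappa> (stable False) = \<kappa> (stable False) \<otimes>\<^bsub>G\<^esub> \<kappa> (Base (\<psi> a))" if "a \<in> A" for a
    using c[OF that] \<kappa>_stable_cancel[of False] by (simp flip: conj[OF that] G.m_assoc)
  with 1 show ?thesis
    using assms by (cases \<epsilon>) (auto simp: D_def \<theta>_def \<psi>_inj)
qed

definition pel :: "('a \<times> bool) list \<Rightarrow> 'a hnn_letter list set" where
  "pel p = hnn_class H A \<psi> (pref_word p)"

lemma pel_Nil: "pel [] = \<one>\<^bsub>G\<^esub>"
  by (simp add: pel_def one_G)

lemma pel_Cons: "pel ((\<tau>, \<epsilon>) # p) = pel p \<otimes>\<^bsub>G\<^esub> (\<kappa> (Base \<tau>) \<otimes>\<^bsub>G\<^esub> \<kappa> (stable \<epsilon>))"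
  by (simp add: pel_def \<kappa>_def flip: class_append)

lemma el_pel: "el (p, h) = pel p \<otimes>\<^bsub>G\<^esub> \<kappa> (Base h)"
  by (simp add: pel_def \<kappa>_def el_def flip: class_append)

lemma pel_carrier: "pref_ok p \<Longrightarrow> pel p \<in> carrier G"
proof (induction p rule: pref_ok.induct)
  case 1
  interpret G: group G by (rule group_G)
  show ?case by (simp add: pel_Nil)
next
  case (2 \<tau> \<epsilon> p)
  interpret G: group G by (rule group_G)
  show ?case using 2 R_carrier[of \<epsilon>] by (auto simp: pel_Cons)
qed

lemma el_carrier: "s \<in> states \<Longrightarrow> el s \<in> carrier G"
proof -
  interpret G: group G by (rule group_G)
  assume "s \<in> states"
  then show ?thesis by (cases s) (auto simp: states_def el_pel pel_carrier)
qed

lemma el_one: "el ([], \<one>) = \<one>\<^bsub>G\<^esub>"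
proof -
  interpret G: group G by (rule group_G)
  show ?thesis by (simp add: el_pel pel_Nil \<kappa>_Base_one)
qed

lemma one_states: "([], \<one>) \<in> states"
  by (simp add: states_def)

lemma el_Base: "(p, h) \<in> states \<Longrightarrow> k \<in> carrier H \<Longrightarrow> el (p, h) \<otimes>\<^bsub>G\<^esub> \<kappa> (Base k) = el (p, h \<otimes> k)"
proof -
  interpret G: group G by (rule group_G)
  assume "(p, h) \<in> states" "k \<in> carrier H"
  then show ?thesis by (simp add: states_def el_pel pel_carrier G.m_assoc \<kappa>_Base_mult)
qed

text \<open>Ties the combinatorial action to the group: factor \<open>h\<close>, move
  \<open>rest \<epsilon> h\<close> across, and compare with the two outcomes of
  \<open>step\<close>.\<close>

lemma el_stable:
  assumes "s \<in> states"
  shows "el s \<otimes>\<^bsub>G\<^esub> \<kappa> (stable \<epsilon>) = el (step \<epsilon> s)"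
proof -
  interpret G: group G by (rule group_G)
  obtain p h where s: "s = (p, h)" by force
  then have p: "(p, h) \<in> states" "pref_ok p" and h: "h \<in> carrier H" using assms by (auto simp: states_def)
  note b = rest_D[OF h, of \<epsilon>]
  have c: "rep \<epsilon> h \<in> carrier H" "rest \<epsilon> h \<in> carrier H" "\<theta> \<epsilon> (rest \<epsilon> h) \<in> carrier H"
    using rep_R[OF h] R_carrier D_carrier[OF b] \<theta>_carrier[OF b] by blast+
  have "\<kappa> (Base h) = \<kappa> (Base (rep \<epsilon> h)) \<otimes>\<^bsub>G\<^esub> \<kappa> (Base (rest \<epsilon> h))"
    using c by (simp add: \<kappa>_Base_mult rep_mult_rest[OF h])
  then have "el s \<otimes>\<^bsub>G\<^esub> \<kappa> (stable \<epsilon>) =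
      pel p \<otimes>\<^bsub>G\<^esub> (\<kappa> (Base (rep \<epsilon> h)) \<otimes>\<^bsub>G\<^esub> (\<kappa> (Base (rest \<epsilon> h)) \<otimes>\<^bsub>G\<^esub> \<kappa> (stable \<epsilon>)))"
    using c p by (simp add: s el_pel pel_carrier G.m_assoc)
  also have "\<dots> = pel p \<otimes>\<^bsub>G\<^esub> (\<kappa> (Base (rep \<epsilon> h)) \<otimes>\<^bsub>G\<^esub> \<kappa> (stable \<epsilon>)) \<otimes>\<^bsub>G\<^esub> \<kappa> (Base (\<theta> \<epsilon> (rest \<epsilon> h)))"
    using c p by (simp add: \<kappa>_commute[OF b] pel_carrier G.m_assoc)
  finally have eq: "el s \<otimes>\<^bsub>G\<^esub> \<kappa> (stable \<epsilon>) = \<dots>" .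
  show ?thesis
    using p(1)
  proof (cases rule: step_cases[where \<epsilon> = \<epsilon>])
    case (cancel \<tau> q)
    then have "pel q \<in> carrier G" by (simp add: states_def pel_carrier)
    then have "pel p \<otimes>\<^bsub>G\<^esub> (\<kappa> (Base \<one>) \<otimes>\<^bsub>G\<^esub> \<kappa> (stable \<epsilon>)) = pel q \<otimes>\<^bsub>G\<^esub> \<kappa> (Base \<tau>)"
      using cancel(1,4) \<kappa>_stable_cancel[of "\<not> \<epsilon>"]
      by (simp add: pel_Cons \<kappa>_Base_one G.m_assoc)
    then show ?thesis
      unfolding eq using cancel c \<open>pel q \<in> carrier G\<close>
      by (simp add: s el_pel G.m_assoc \<kappa>_Base_mult)
  next
    case push
    then show ?thesis unfolding eq by (simp add: s el_pel pel_Cons)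
  qed
qed

lemma el_act:
  assumes "s \<in> states" "c \<in> hnn_alphabet (carrier H)"
  shows "el s \<otimes>\<^bsub>G\<^esub> \<kappa> c = el (act s c)"
  using assms(2)
proof (cases rule: alphabetE)
  case (1 y)
  then show ?thesis using assms(1) el_Base[of "fst s" "snd s" y] by simp
next
  case (2 \<epsilon>)
  then show ?thesis using assms(1) by (simp add: act_stable el_stable)
qed

text \<open>Spelling a reduced expression from the empty state never triggers a cancellation, since
  \<open>pref_ok\<close> excludes it. The action therefore recovers the state from any word for its
  element, which makes \<open>el\<close> injective.\<close>

lemma act_el_word: "s \<in> states \<Longrightarrow> foldl act ([], \<one>) (pref_word (fst s) @ [Base (snd s)]) = s"
proof -
  assume s: "s \<in> states"
  have "pref_ok p \<Longrightarrow> foldl act ([], \<one>) (pref_word p) = (p, \<one>)" for p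
  proof (induction p rule: pref_ok.induct)
    case (2 \<tau> \<epsilon> p)
    then have "(p, \<tau>) \<in> states" "\<tau> \<in> R \<epsilon>" using R_carrier[of \<epsilon>] by (auto simp: states_def)
    then show ?case using 2 by (auto simp: act_stable step_R states_def)
  qed simp
  then show ?thesis using s by (cases s) (auto simp: states_def)
qed

lemma el_inj: "inj_on el states"
proof (rule inj_onI)
  fix s t assume st: "s \<in> states" "t \<in> states" "el s = el t"
  then have "hnn_eq H A \<psi> (pref_word (fst s) @ [Base (snd s)]) (pref_word (fst t) @ [Base (snd t)])"
    by (simp add: el_def hnn_class_eq_iff)
  from act_hnn_eq[OF this one_states] show "s = t"
    using act_el_word st by simp
qed

lemma el_surj: "el ` states = carrier G"
proof
  show "el ` states \<subseteq> carrier G" using el_carrier by blast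
  interpret G: group G by (rule group_G)
  have "hnn_class H A \<psi> w = el (foldl act ([], \<one>) w)" if "w \<in> hnn_words H" for w
    using that
  proof (induction w rule: rev_induct)
    case Nil
    then show ?case using el_one by (simp add: HNN_def)
  next
    case (snoc c w)
    then have "c \<in> hnn_alphabet (carrier H)" by (auto simp: hnn_words_def hnn_alphabet_def)
    then have "el (foldl act ([], \<one>) (w @ [c])) = el (foldl act ([], \<one>) w) \<otimes>\<^bsub>G\<^esub> \<kappa> c"
      using el_act foldl_act_states one_states by simp
    then show ?case
      using snoc by (simp add: class_append \<kappa>_def hnn_words_def)
  qed
  then show "carrier G \<subseteq> el ` states"
    using foldl_act_states[OF one_states] by (auto simp: HNN_def)
qed

text \<open>Letters already differ in their effect on the empty state, where base letters change the
  second component and stable letters the first. So \<open>\<kappa>\<close> is a faithful renaming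
  of letters, under which languages can be transported.\<close>

lemma act_one_inj: "inj_on (act ([], \<one>)) (hnn_alphabet (carrier H))"
proof (rule inj_onI)
  have st: "act ([], \<one>) (stable \<epsilon>) = ([(\<one>, \<epsilon>)], \<one>)" for \<epsilon>
    using step_R[OF one_states one_R, of \<epsilon>] by (simp add: act_stable last_sign_def)
  fix c d assume "c \<in> hnn_alphabet (carrier H)" "d \<in> hnn_alphabet (carrier H)"
    "act ([], \<one>) c = act ([], \<one>) d"
  then show "c = d"
    by (auto elim!: alphabetE simp: st)
qed

lemma \<kappa>_act: "c \<in> hnn_alphabet (carrier H) \<Longrightarrow> \<kappa> c = el (act ([], \<one>) c)"
proof -
  interpret G: group G by (rule group_G)
  assume "c \<in> hnn_alphabet (carrier H)"
  then show ?thesis using el_act[OF one_states] \<kappa>_carrier by (simp add: el_one flip: el_act[OF one_states])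
qed

lemma \<kappa>_inj: "inj_on \<kappa> (hnn_alphabet (carrier H))"
  using act_one_inj el_inj act_states[OF one_states]
  by (auto simp: inj_on_def \<kappa>_act)

end

section \<open>Values of words and walks in Cayley graphs\<close>

context group
begin

lemma word_val_closed: "w \<in> lists (carrier G) \<Longrightarrow> word_val G w \<in> carrier G"
  by (induction w) (auto simp: word_val_def)

lemma word_val_Nil: "word_val G [] = \<one>"
  by (simp add: word_val_def)

lemma word_val_append:
  "u \<in> lists (carrier G) \<Longrightarrow> v \<in> lists (carrier G) \<Longrightarrow> word_val G (u @ v) = word_val G u \<otimes> word_val G v"
  using word_val_closed[of v]
proof (induction u)
  case (Cons a u)
  then show ?case using word_val_closed[of u] by (auto simp: word_val_def m_assoc)
qed (simp add: word_val_def)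

end

lemma tail_cayley: "tail (cayley G X) = fst"
  and head_cayley: "head (cayley G X) (g, a) = g \<otimes>\<^bsub>G\<^esub> a"
  and arcs_cayley: "arcs (cayley G X) = carrier G \<times> X"
  by (simp_all add: cayley_def)

lemma awalk_cayley: "pre_digraph.awalk (cayley G X) = tree_path G (carrier G \<times> X)"
  by (simp add: tree_path_def cayley_def)

lemma (in group) awalk_label:
  assumes "X \<subseteq> carrier G" "pre_digraph.awalk (cayley G X) u p v"
  shows "label p \<in> lists X"
  using assms(2) by (fastforce simp: pre_digraph.awalk_def cayley_def)

section \<open>The flow function on the Cayley graph of the HNN extension\<close>

text \<open>\<open>SL \<epsilon>\<close> selects a geodesic word over \<open>Zs \<epsilon>\<close> for every element of \<open>D \<epsilon>\<close>.\<close>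

locale hnn_stackable = hnn H A \<psi> R
  for H :: "('a, 'b) monoid_scheme" (structure) and A :: "'a set" and \<psi> R +
  fixes Y :: "'a set" and T :: "('a \<times> 'a) set" and \<Phi> :: "'a \<times> 'a \<Rightarrow> ('a \<times> 'a) list"
    and Zs :: "bool \<Rightarrow> 'a set" and SL :: "bool \<Rightarrow> 'a list set" and k :: nat
  assumes gens_Y: "inv_closed_gens H Y" and max_T: "maximal_tree H Y T"
    and flow: "flow_function H Y T \<Phi>"
    and bound: "e \<in> arcs (cayley H Y) \<Longrightarrow> length (\<Phi> e) \<le> k"
    and Zs_Y: "Zs \<epsilon> \<subseteq> Y" and Zs_D: "Zs \<epsilon> \<subseteq> D \<epsilon>"
    and Zs_inv: "z \<in> Zs \<epsilon> \<Longrightarrow> inv z \<in> Zs \<epsilon>" and \<theta>_Zs: "z \<in> Zs \<epsilon> \<Longrightarrow> \<theta> \<epsilon> z \<in> Y"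
    and SL_lists: "SL \<epsilon> \<subseteq> lists (Zs \<epsilon>)"
    and SL_unique: "b \<in> D \<epsilon> \<Longrightarrow> \<exists>!\<sigma>. \<sigma> \<in> SL \<epsilon> \<and> word_val H \<sigma> = b"
    and SL_min: "\<lbrakk>\<sigma> \<in> SL \<epsilon>; v \<in> lists (Zs \<epsilon>); word_val H v = word_val H \<sigma>\<rbrakk> \<Longrightarrow> length \<sigma> \<le> length v"
begin

lemma Y_carrier: "Y \<subseteq> carrier H"
  using gens_Y by (simp add: inv_closed_gens_def)

sublocale HT: sym_tree_edges H Y T
  using max_T Y_carrier by unfold_locales (auto simp: maximal_tree_def cayley_def)

sublocale G: group G
  by (rule group_G)

abbreviation "nfH \<equiv> nf H T"

lemma nfH_system: "nf_system H T nfH"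
  by (rule maximal_tree_nf_system[OF Y_carrier max_T])

lemma nfH_word: "h \<in> carrier H \<Longrightarrow> word_val H (nfH h) = h \<and> nfH h \<in> lists Y"
  by (rule HT.nf_system_word[OF nfH_system])

lemma nfH_one: "nfH \<one> = []"
  using nfH_system by (simp add: nf_system_def)

lemma nfH_Nil_iff: "h \<in> carrier H \<Longrightarrow> nfH h = [] \<longleftrightarrow> h = \<one>"
  using nfH_word[of h] nfH_one by (auto simp: word_val_Nil)

definition XG where "XG = \<kappa> ` hnn_alphabet Y"

definition N where "N \<epsilon> = nfH ` R \<epsilon>"

lemma alphabet_mono: "hnn_alphabet Y \<subseteq> hnn_alphabet (carrier H)"
  using Y_carrier by (auto simp: hnn_alphabet_def)

lemma \<kappa>_inj_Y: "inj_on \<kappa> (hnn_alphabet Y)"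
  by (rule inj_on_subset[OF \<kappa>_inj alphabet_mono])

lemma inv_Y: "y \<in> Y \<Longrightarrow> inv y \<in> Y"
  using gens_Y by (simp add: inv_closed_gens_def)

lemma XG_carrier: "XG \<subseteq> carrier G"
  unfolding XG_def using \<kappa>_carrier alphabet_mono by blast

lemma gens_XG: "inv_closed_gens G XG"
  unfolding inv_closed_gens_def
proof (intro conjI ballI)
  show "finite XG" using gens_Y by (simp add: XG_def inv_closed_gens_def hnn_alphabet_def)
  show "XG \<subseteq> carrier G" by (rule XG_carrier)
  show "inv\<^bsub>G\<^esub> x \<in> XG" if "x \<in> XG" for x
  proof -
    from that obtain c where c: "c \<in> hnn_alphabet Y" "x = \<kappa> c" by (auto simp: XG_def)
    from c(1) show ?thesis
    proof (cases rule: alphabetE)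
      case (1 y)
      then show ?thesis
        using c Y_carrier inv_Y by (auto simp: \<kappa>_Base_inv XG_def Base_alphabet)
    next
      case (2 \<epsilon>)
      then show ?thesis using c by (auto simp: \<kappa>_stable_inv XG_def stable_alphabet)
    qed
  qed
  show "\<one>\<^bsub>G\<^esub> \<notin> XG"
  proof
    assume "\<one>\<^bsub>G\<^esub> \<in> XG"
    then obtain c where c: "c \<in> hnn_alphabet Y" "\<kappa> c = \<kappa> (Base \<one>)"
      unfolding XG_def by (auto simp: \<kappa>_Base_one)
    then have "c = Base \<one>"
      using \<kappa>_inj alphabet_mono by (auto simp: inj_on_def Base_alphabet)
    then show False using c(1) gens_Y by (simp add: Base_alphabet inv_closed_gens_def)
  qed
  show "generate G XG = carrier G"
  proof
    show "generate G XG \<subseteq> carrier G" by (rule G.generate_incl[OF XG_carrier])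
    have base: "\<kappa> (Base h) \<in> generate G XG" if "h \<in> carrier H" for h
    proof -
      have "h \<in> generate H Y" using that gens_Y by (simp add: inv_closed_gens_def)
      then show ?thesis
      proof (induction rule: generate.induct)
        case one
        then show ?case by (simp add: \<kappa>_Base_one generate.one)
      next
        case (incl h)
        then show ?case by (auto simp: XG_def Base_alphabet intro: generate.incl)
      next
        case (inv h)
        then show ?case by (auto simp: XG_def Base_alphabet inv_Y intro: generate.incl)
      next
        case (eng h1 h2)
        then have "h1 \<in> carrier H" "h2 \<in> carrier H" using generate_incl[OF Y_carrier] by auto
        then show ?case using eng by (auto simp flip: \<kappa>_Base_mult intro: generate.eng)
      qed
    qed
    have st: "\<kappa> (stable \<epsilon>) \<in> generate G XG" for \<epsilon>
      by (auto simp: XG_def stable_alphabet intro: generate.incl)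
    have "pel p \<in> generate G XG" if "pref_ok p" for p
      using that
    proof (induction p rule: pref_ok.induct)
      case 1
      then show ?case by (simp add: pel_Nil generate.one)
    next
      case (2 \<tau> \<epsilon> p)
      then show ?case using R_carrier[of \<epsilon>]
        by (auto simp: pel_Cons intro!: generate.eng base st)
    qed
    then have "el s \<in> generate G XG" if "s \<in> states" for s
      using that by (cases s) (auto simp: el_pel states_def intro!: generate.eng base)
    then show "carrier G \<subseteq> generate G XG" by (auto simp flip: el_surj)
  qed
qed

section \<open>The maximal tree of the extension\<close>

definition ed :: "(('a \<times> bool) list \<times> 'a) \<times> 'a hnn_letter \<Rightarrow> 'a hnn_letter list set \<times> 'a hnn_letter list set"
  where "ed = (\<lambda>(s, c). (el s, \<kappa> c))"

text \<open>A prefix \<open>p\<close> indexes a coset of \<open>H\<close>, which receives a copy of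
  \<open>T\<close>. The stable edges start at transversal elements; they comprise the edges that
  push a letter and, as their reversals, those that cancel one.\<close>

definition TS where
  "TS = {((p, h), Base y) | p h y. pref_ok p \<and> (h, y) \<in> T} \<union>
        {((p, h), stable \<epsilon>) | p h \<epsilon>. pref_ok p \<and> h \<in> R \<epsilon>}"

definition TG where "TG = ed ` TS"

lemma stable_neq_Base [simp]: "stable \<epsilon> \<noteq> Base y" "Base y \<noteq> stable \<epsilon>"
  by (simp_all add: stable_def)

lemma stable_inject [simp]: "stable \<epsilon> = stable \<epsilon>' \<longleftrightarrow> \<epsilon> = \<epsilon>'"
  by (simp add: stable_def)

lemma TS_Base: "((p, h), Base y) \<in> TS \<longleftrightarrow> pref_ok p \<and> (h, y) \<in> T"
  by (auto simp: TS_def)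

lemma TS_stable: "((p, h), stable \<epsilon>) \<in> TS \<longleftrightarrow> pref_ok p \<and> h \<in> R \<epsilon>"
  by (auto simp: TS_def)

lemma TS_subset: "TS \<subseteq> states \<times> hnn_alphabet Y"
  using R_carrier HT.T by (auto simp: TS_def states_def Base_alphabet stable_alphabet)

lemma TS_E:
  assumes "e \<in> TS"
  obtains p h y where "e = ((p, h), Base y)" "(p, h) \<in> states" "(h, y) \<in> T" "y \<in> Y"
  | p h \<epsilon> where "e = ((p, h), stable \<epsilon>)" "(p, h) \<in> states" "h \<in> R \<epsilon>"
  using assms TS_subset unfolding TS_def by (fastforce simp: Base_alphabet)

lemma ed_inj: "inj_on ed (states \<times> hnn_alphabet Y)"
  using el_inj \<kappa>_inj_Y by (auto simp: ed_def inj_on_def)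

lemma ed_image: "ed ` (states \<times> hnn_alphabet Y) = carrier G \<times> XG"
  by (auto simp: ed_def XG_def simp flip: el_surj)

lemma ed_TG: "e \<in> states \<times> hnn_alphabet Y \<Longrightarrow> ed e \<in> TG \<longleftrightarrow> e \<in> TS"
  unfolding TG_def by (rule inj_on_image_mem_iff[OF ed_inj _ TS_subset])

lemma rev_edge_Base: "(p, h) \<in> states \<Longrightarrow> y \<in> Y \<Longrightarrow>
    rev_edge G (ed ((p, h), Base y)) = ed ((p, h \<otimes> y), Base (inv y))"
  using Y_carrier by (auto simp: rev_edge_def ed_def \<kappa>_Base_inv el_Base)

lemma rev_edge_stable: "s \<in> states \<Longrightarrow>
    rev_edge G (ed (s, stable \<epsilon>)) = ed (step \<epsilon> s, stable (\<not> \<epsilon>))"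
  by (simp add: rev_edge_def ed_def \<kappa>_stable_inv el_stable)

text \<open>Closure under reversal: after a push the base factor is trivial, and after a
  cancellation it is the representative that stood before the opposite letter. Both lie in the
  transversal for the opposite exponent.\<close>

lemma step_R_TS:
  assumes "(p, \<tau>) \<in> states" "\<tau> \<in> R \<epsilon>"
  shows "(step \<epsilon> (p, \<tau>), stable (\<not> \<epsilon>)) \<in> TS"
proof (cases "\<tau> = \<one> \<and> last_sign p = Some (\<not> \<epsilon>)")
  case True
  then obtain \<tau>' q where "p = (\<tau>', \<not> \<epsilon>) # q" by (auto elim: last_sign_SomeE)
  then show ?thesis
    using assms True by (simp add: step_R TS_stable states_def)
next
  case False
  then show ?thesis
    using assms one_R by (auto simp: step_R TS_stable states_def)
qed

sublocale GT: sym_tree_edges G XG TG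
proof unfold_locales
  show "XG \<subseteq> carrier G" by (rule XG_carrier)
  show "TG \<subseteq> carrier G \<times> XG"
    unfolding TG_def ed_image[symmetric] using TS_subset by blast
  fix e assume "e \<in> TG"
  then obtain e' where e': "e' \<in> TS" "e = ed e'" by (auto simp: TG_def)
  from e'(1) show "rev_edge G e \<in> TG"
  proof (cases rule: TS_E)
    case (1 p h y)
    then have "(h \<otimes> y, inv y) \<in> T"
      using HT.sym_T[of "(h, y)"] by (simp add: rev_edge_def)
    then have "((p, h \<otimes> y), Base (inv y)) \<in> TS"
      using 1 by (simp add: TS_Base states_def)
    then show ?thesis using 1 by (simp add: e' rev_edge_Base TG_def)
  next
    case (2 p h \<epsilon>)
    then show ?thesis using step_R_TS[OF 2(2,3)] by (simp add: e' rev_edge_stable TG_def)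
  qed
qed

definition pnf :: "('a \<times> bool) list \<Rightarrow> 'a hnn_letter list" where
  "pnf p = segs_word (map (\<lambda>(\<tau>, \<epsilon>). (nfH \<tau>, \<epsilon>)) p)"

definition snf :: "('a \<times> bool) list \<times> 'a \<Rightarrow> 'a hnn_letter list" where
  "snf = (\<lambda>(p, h). pnf p @ map Base (nfH h))"

lemma snf_Cons: "snf ((\<tau>, \<epsilon>) # p, \<one>) = snf (p, \<tau>) @ [stable \<epsilon>]"
  by (simp add: snf_def pnf_def nfH_one)

definition st :: "'a hnn_letter list set \<Rightarrow> ('a \<times> bool) list \<times> 'a" where
  "st = inv_into states el"

lemma st_el [simp]: "s \<in> states \<Longrightarrow> st (el s) = s"
  unfolding st_def by (rule inv_into_f_f[OF el_inj])

text \<open>Since \<open>nfH \<one>\<close> is empty, a push appends exactly the stable letter to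
  the word and a cancellation deletes one; inside a coset the property is inherited from
  \<open>H\<close>. The edgewise criterion then yields both the maximality of the tree and its
  normal forms.\<close>

lemma G_nf_system: "nf_system G TG (\<lambda>g. map \<kappa> (snf (st g)))"
  unfolding nf_system_def
proof (intro conjI ballI)
  show "map \<kappa> (snf (st \<one>\<^bsub>G\<^esub>)) = []"
    using st_el[OF one_states] by (simp add: el_one snf_def pnf_def nfH_one)
next
  fix e assume "e \<in> TG"
  then obtain e' where e': "e' \<in> TS" "e = ed e'" by (auto simp: TG_def)
  from e'(1) show "case e of (g, a) \<Rightarrow> map \<kappa> (snf (st (g \<otimes>\<^bsub>G\<^esub> a))) = map \<kappa> (snf (st g)) @ [a] \<or>
      map \<kappa> (snf (st g)) = map \<kappa> (snf (st (g \<otimes>\<^bsub>G\<^esub> a))) @ [inv\<^bsub>G\<^esub> a]"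
  proof (cases rule: TS_E)
    case (1 p h y)
    then have y: "y \<in> carrier H" and hy: "(p, h \<otimes> y) \<in> states"
      using Y_carrier by (auto simp: states_def)
    have "nfH (h \<otimes> y) = nfH h @ [y] \<or> nfH h = nfH (h \<otimes> y) @ [inv y]"
      by (rule HT.nf_system_edge[OF nfH_system 1(3)])
    then have "snf (p, h \<otimes> y) = snf (p, h) @ [Base y] \<or> snf (p, h) = snf (p, h \<otimes> y) @ [Base (inv y)]"
      by (auto simp: snf_def)
    then show ?thesis
      using 1 hy y by (auto simp: e' ed_def el_Base \<kappa>_Base_inv)
  next
    case (2 p h \<epsilon>)
    have "snf (step \<epsilon> (p, h)) = snf (p, h) @ [stable \<epsilon>] \<or>
        snf (p, h) = snf (step \<epsilon> (p, h)) @ [stable (\<not> \<epsilon>)]"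
    proof (cases "h = \<one> \<and> last_sign p = Some (\<not> \<epsilon>)")
      case True
      then obtain \<tau> q where "p = (\<tau>, \<not> \<epsilon>) # q" by (auto elim: last_sign_SomeE)
      then show ?thesis using True step_R[OF 2(2,3)] by (simp add: snf_Cons)
    next
      case False
      then show ?thesis using step_R[OF 2(2,3)] by (auto simp: snf_Cons)
    qed
    then show ?thesis
      using 2(1,2) step_states[OF 2(2), of \<epsilon>] by (auto simp: e' ed_def el_stable \<kappa>_stable_inv)
  qed
next
  fix g assume "g \<in> carrier G"
  then obtain p h where s: "g = el (p, h)" "(p, h) \<in> states" by (auto simp flip: el_surj)
  have ex: "\<exists>(g', a)\<in>TG. g = g' \<otimes>\<^bsub>G\<^esub> a \<and> map \<kappa> (snf (st g)) = map \<kappa> (snf (st g')) @ [a]"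
    if "(s', c) \<in> TS" "el (p, h) = el s' \<otimes>\<^bsub>G\<^esub> \<kappa> c" "snf (p, h) = snf s' @ [c]" for s' c
  proof -
    have "s' \<in> states" using that(1) TS_subset by auto
    moreover have "(el s', \<kappa> c) \<in> TG" using that(1) by (force simp: TG_def ed_def)
    ultimately show ?thesis
      using that s by (intro bexI[of _ "(el s', \<kappa> c)"]) (auto simp flip: that(2))
  qed
  show "g = \<one>\<^bsub>G\<^esub> \<or> (\<exists>(g', a)\<in>TG. g = g' \<otimes>\<^bsub>G\<^esub> a \<and> map \<kappa> (snf (st g)) = map \<kappa> (snf (st g')) @ [a])"
  \<comment> \<open>The last letter of the word is a base letter when \<open>h\<close> is
    nontrivial, and otherwise the stable letter at the head of \<open>p\<close>.\<close>
  proof (cases "h = \<one>")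
    case False
    then obtain h' y where y: "(h', y) \<in> T" "h = h' \<otimes> y" "nfH h = nfH h' @ [y]"
      using nfH_system s by (auto simp: nf_system_def states_def)
    then have "h' \<in> carrier H" "y \<in> carrier H" by (auto dest: HT.edge_carrier)
    then have "\<exists>(g', a)\<in>TG. g = g' \<otimes>\<^bsub>G\<^esub> a \<and> map \<kappa> (snf (st g)) = map \<kappa> (snf (st g')) @ [a]"
      using y s by (intro ex[of "(p, h')" "Base y"]) (auto simp: TS_Base states_def el_Base snf_def)
    then show ?thesis by blast
  next
    case h: True
    show ?thesis
    proof (cases p)
      case Nil
      then show ?thesis using s h el_one by simp
    next
      case (Cons a q)
      obtain \<tau> \<epsilon> where a: "a = (\<tau>, \<epsilon>)" by force
      have q: "(q, \<tau>) \<in> states" "\<tau> \<in> R \<epsilon>" "step \<epsilon> (q, \<tau>) = (p, h)"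
        using s Cons a h R_carrier[of \<epsilon>] step_R[of q \<tau> \<epsilon>] by (auto simp: states_def)
      have "\<exists>(g', a)\<in>TG. g = g' \<otimes>\<^bsub>G\<^esub> a \<and> map \<kappa> (snf (st g)) = map \<kappa> (snf (st g')) @ [a]"
        using q h Cons a
        by (intro ex[of "(q, \<tau>)" "stable \<epsilon>"]) (simp_all add: TS_stable states_def el_stable snf_Cons)
      then show ?thesis by blast
    qed
  qed
qed

lemma max_TG: "maximal_tree G XG TG"
  by (rule GT.nf_system_maximal_tree[OF G_nf_system])

lemma nfG: "s \<in> states \<Longrightarrow> nf G TG (el s) = map \<kappa> (snf s)"
  using GT.nf_system_nf[OF G_nf_system el_carrier] by simp

section \<open>Flow paths across a stable letter\<close>

definition sl :: "bool \<Rightarrow> 'a \<Rightarrow> 'a list" where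
  "sl \<epsilon> h = (THE \<sigma>. \<sigma> \<in> SL \<epsilon> \<and> word_val H \<sigma> = rest \<epsilon> h)"

lemma sl: "h \<in> carrier H \<Longrightarrow> sl \<epsilon> h \<in> SL \<epsilon> \<and> word_val H (sl \<epsilon> h) = rest \<epsilon> h"
  unfolding sl_def by (rule theI'[OF SL_unique[OF rest_D]])

lemma sl_eqI: "h \<in> carrier H \<Longrightarrow> \<sigma> \<in> SL \<epsilon> \<Longrightarrow> word_val H \<sigma> = rest \<epsilon> h \<Longrightarrow> sl \<epsilon> h = \<sigma>"
  using SL_unique[OF rest_D, of h \<epsilon>] sl[of h \<epsilon>] by blast

lemma Zs_carrier: "Zs \<epsilon> \<subseteq> carrier H"
  using Zs_Y Y_carrier by blast

lemma Zs_props: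
  assumes "z \<in> Zs \<epsilon>"
  shows "z \<in> D \<epsilon>" "z \<in> carrier H" "inv z \<in> Y" "\<theta> \<epsilon> z \<in> Y" "\<theta> \<epsilon> z \<in> carrier H"
proof -
  show "\<theta> \<epsilon> z \<in> Y" by (rule \<theta>_Zs[OF assms])
  then show "\<theta> \<epsilon> z \<in> carrier H" using Y_carrier by blast
qed (use assms Zs_D[of \<epsilon>] Zs_carrier[of \<epsilon>] Zs_Y[of \<epsilon>] Zs_inv in blast)+

text \<open>The word without its last letter \<open>z\<close> represents the remainder of
  \<open>h \<otimes> inv z\<close>. Whether or not it is the selected word for it,
  \<open>SL_min\<close> makes the selected one at most as long.\<close>

lemma sl_last:
  assumes h: "h \<in> carrier H" "h \<notin> R \<epsilon>"
  shows sl_Nil: "sl \<epsilon> h \<noteq> []" and sl_last_Zs: "last (sl \<epsilon> h) \<in> Zs \<epsilon>"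
    and sl_shorter: "length (sl \<epsilon> (h \<otimes> inv (last (sl \<epsilon> h)))) < length (sl \<epsilon> h)"
proof -
  have s: "sl \<epsilon> h \<in> SL \<epsilon>" "word_val H (sl \<epsilon> h) = rest \<epsilon> h" using sl h by auto
  show ne: "sl \<epsilon> h \<noteq> []"
    using s(2) h rest_one_iff by (metis word_val_Nil)
  then obtain \<sigma> z where \<sigma>: "sl \<epsilon> h = \<sigma> @ [z]" by (metis append_butlast_last_id)
  then have \<sigma>z: "\<sigma> \<in> lists (Zs \<epsilon>)" "z \<in> Zs \<epsilon>" using s(1) SL_lists by force+
  then show "last (sl \<epsilon> h) \<in> Zs \<epsilon>" using \<sigma> by simp
  have c: "\<sigma> \<in> lists (carrier H)" "z \<in> carrier H" using \<sigma>z Zs_carrier by auto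
  have "rest \<epsilon> h = word_val H \<sigma> \<otimes> z"
    using s(2) c by (simp add: \<sigma> word_val_append) (simp add: word_val_def)
  then have "word_val H \<sigma> = rest \<epsilon> h \<otimes> inv z"
    using c word_val_closed[OF c(1)] by (simp add: m_assoc)
  also have "\<dots> = rest \<epsilon> (h \<otimes> inv z)"
    using Zs_inv[OF \<sigma>z(2)] Zs_D h by (subst rest_mult_D) auto
  finally have "word_val H \<sigma> = word_val H (sl \<epsilon> (h \<otimes> inv z))"
    using sl[of "h \<otimes> inv z" \<epsilon>] h c by simp
  then have "length (sl \<epsilon> (h \<otimes> inv z)) \<le> length \<sigma>"
    using sl[of "h \<otimes> inv z" \<epsilon>] h c by (intro SL_min[OF _ \<sigma>z(1)]) auto
  then show "length (sl \<epsilon> (h \<otimes> inv (last (sl \<epsilon> h)))) < length (sl \<epsilon> h)"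
    by (simp add: \<sigma>)
qed

definition sflow where
  "sflow \<epsilon> = (\<lambda>(p, h). if h \<in> R \<epsilon> then [((p, h), stable \<epsilon>)]
     else [((p, h), Base (inv (last (sl \<epsilon> h)))),
           ((p, h \<otimes> inv (last (sl \<epsilon> h))), stable \<epsilon>),
           (step \<epsilon> (p, h \<otimes> inv (last (sl \<epsilon> h))), Base (\<theta> \<epsilon> (last (sl \<epsilon> h))))])"

fun flowS :: "('a \<times> bool) list \<times> 'a \<Rightarrow> 'a hnn_letter \<Rightarrow> ((('a \<times> bool) list \<times> 'a) \<times> 'a hnn_letter) list" where
  "flowS s (Base y) = map (\<lambda>(h, x). ((fst s, h), Base x)) (\<Phi> (snd s, y))"
| "flowS s Stable = sflow True s"
| "flowS s StableInv = sflow False s"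

lemma flowS_stable: "flowS s (stable \<epsilon>) = sflow \<epsilon> s"
  by (simp add: stable_def)

definition \<Phi>G where
  "\<Phi>G e = map ed (flowS (st (fst e)) (inv_into (hnn_alphabet Y) \<kappa> (snd e)))"

lemma \<Phi>G_ed: "e \<in> states \<times> hnn_alphabet Y \<Longrightarrow> \<Phi>G (ed e) = map ed (flowS (fst e) (snd e))"
  using \<kappa>_inj_Y by (auto simp: \<Phi>G_def ed_def)

lemma arcs_G: "arcs (cayley G XG) = ed ` (states \<times> hnn_alphabet Y)"
  by (simp only: ed_image arcs_cayley)

sublocale HA: tree_edges H Y "carrier H \<times> Y"
  using Y_carrier by unfold_locales auto

sublocale GA: tree_edges G XG "carrier G \<times> XG"
  using XG_carrier by unfold_locales auto

lemma \<Phi>_path: "h \<in> carrier H \<Longrightarrow> y \<in> Y \<Longrightarrow> tree_path H (carrier H \<times> Y) h (\<Phi> (h, y)) (h \<otimes> y)"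
  using flow by (force simp: flow_function_def awalk_cayley arcs_cayley tail_cayley head_cayley)

lemma \<Phi>_set: "h \<in> carrier H \<Longrightarrow> y \<in> Y \<Longrightarrow> set (\<Phi> (h, y)) \<subseteq> carrier H \<times> Y"
  using \<Phi>_path[of h y] by (auto simp: tree_path_def pre_digraph.awalk_def)

lemma ed_edge: "s \<in> states \<Longrightarrow> c \<in> hnn_alphabet Y \<Longrightarrow> ed (s, c) \<in> carrier G \<times> XG"
  using ed_image by blast

text \<open>Left multiplication by \<open>pel p\<close> maps the Cayley graph of \<open>H\<close>
  into that of the extension.\<close>

lemma translate_path:
  assumes "pref_ok p"
  shows "tree_path H (carrier H \<times> Y) h q h' \<Longrightarrow>
    tree_path G (carrier G \<times> XG) (el (p, h)) (map (\<lambda>(h, x). ed ((p, h), Base x)) q) (el (p, h'))"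
proof (induction q arbitrary: h)
  case Nil
  then show ?case using assms by (auto simp: states_def intro!: el_carrier)
next
  case (Cons e q)
  then obtain y where e: "e = (h, y)" "h \<in> carrier H" "y \<in> Y" by (cases e) auto
  then have s: "(p, h) \<in> states" "y \<in> carrier H" using assms Y_carrier by (auto simp: states_def)
  have "fst (ed ((p, h), Base y)) \<otimes>\<^bsub>G\<^esub> snd (ed ((p, h), Base y)) = el (p, h \<otimes> y)"
    using s by (simp add: ed_def el_Base)
  moreover have "fst (ed ((p, h), Base y)) = el (p, h)" by (simp add: ed_def)
  moreover have "ed ((p, h), Base y) \<in> carrier G \<times> XG"
    using s e by (intro ed_edge) (auto simp: Base_alphabet)
  ultimately show ?case using Cons e by simp
qed

lemma flowS_path:
  assumes "s \<in> states" "c \<in> hnn_alphabet Y"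
  shows "tree_path G (carrier G \<times> XG) (el s) (map ed (flowS s c)) (el s \<otimes>\<^bsub>G\<^esub> \<kappa> c)"
proof -
  obtain p h where s: "s = (p, h)" "(p, h) \<in> states" "pref_ok p" "h \<in> carrier H"
    using assms(1) by (auto simp: states_def)
  from assms(2) show ?thesis
  proof (cases rule: alphabetE)
    case (1 y)
    have flow: "map ed (flowS s c) = map (\<lambda>(h, x). ed ((p, h), Base x)) (\<Phi> (h, y))"
      by (simp add: s 1 split_beta)
    have el: "el s \<otimes>\<^bsub>G\<^esub> \<kappa> c = el (p, h \<otimes> y)"
      using s 1 Y_carrier by (auto simp: el_Base)
    show ?thesis
      unfolding flow el unfolding s(1) by (rule translate_path[OF s(3) \<Phi>_path[OF s(4) 1(2)]])
  next
    case (2 \<epsilon>)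
    show ?thesis
    proof (cases "h \<in> R \<epsilon>")
      case True
      have "ed ((p, h), stable \<epsilon>) \<in> carrier G \<times> XG"
        using s by (intro ed_edge stable_alphabet)
      then show ?thesis
        using True s 2 el_carrier by (auto simp: flowS_stable sflow_def ed_def)
    next
      case False
      define z where "z = last (sl \<epsilon> h)"
      have z0: "z \<in> Zs \<epsilon>" using sl_last_Zs[OF s(4) False] by (simp add: z_def)
      note z = z0 Zs_props[OF z0]
      define s1 s2 where "s1 = (p, h \<otimes> inv z)" and "s2 = step \<epsilon> s1"
      have "s1 \<in> states" using s z by (simp add: s1_def states_def)
      then have st: "s1 \<in> states" "s2 \<in> states" by (simp_all add: s2_def step_states)
      have 1: "el s \<otimes>\<^bsub>G\<^esub> \<kappa> (Base (inv z)) = el s1"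
        using s z by (simp add: s1_def el_Base)
      have mid: "el s1 \<otimes>\<^bsub>G\<^esub> \<kappa> (stable \<epsilon>) = el s2"
        using st by (simp add: s2_def el_stable)
      \<comment> \<open>By \<open>step_mult\<close>, multiplying by
        \<open>\<theta> \<epsilon> z\<close> after the stable letter equals multiplying by
        \<open>z\<close> before it. This undoes the first edge, so the detour ends where the
        original edge does.\<close>
      have "act s2 (Base (\<theta> \<epsilon> z)) = step \<epsilon> (p, h \<otimes> inv z \<otimes> z)"
        using step_mult[of p "h \<otimes> inv z" z \<epsilon>] st z by (simp add: s1_def s2_def)
      then have 3: "el s2 \<otimes>\<^bsub>G\<^esub> \<kappa> (Base (\<theta> \<epsilon> z)) = el s \<otimes>\<^bsub>G\<^esub> \<kappa> (stable \<epsilon>)"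
        using el_act[OF st(2), of "Base (\<theta> \<epsilon> z)"] s z by (simp add: Base_alphabet el_stable m_assoc)
      have flow: "flowS s c = [(s, Base (inv z)), (s1, stable \<epsilon>), (s2, Base (\<theta> \<epsilon> z))]"
        using False by (simp add: 2 flowS_stable sflow_def s s1_def s2_def z_def)
      have "ed (s, Base (inv z)) \<in> carrier G \<times> XG" "ed (s1, stable \<epsilon>) \<in> carrier G \<times> XG"
        "ed (s2, Base (\<theta> \<epsilon> z)) \<in> carrier G \<times> XG"
        using assms st z by (auto intro!: ed_edge simp: Base_alphabet stable_alphabet)
      then show ?thesis
        unfolding flow using 1 mid 3 assms el_carrier 2 by (auto simp: ed_def)
    qed
  qed
qed

lemma flowS_TS:
  assumes "e \<in> TS"
  shows "flowS (fst e) (snd e) = [e]"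
  using assms
proof (cases rule: TS_E)
  case (1 p h y)
  then have "\<Phi> (h, y) = [(h, y)]"
    using flow HT.T by (auto simp: flow_function_def arcs_cayley)
  then show ?thesis using 1 by simp
next
  case (2 p h \<epsilon>)
  then show ?thesis by (simp add: flowS_stable sflow_def)
qed

lemma flowS_subset:
  assumes "s \<in> states" "c \<in> hnn_alphabet Y"
  shows "set (flowS s c) \<subseteq> states \<times> hnn_alphabet Y"
proof -
  obtain p h where s: "s = (p, h)" "(p, h) \<in> states" "pref_ok p" "h \<in> carrier H"
    using assms(1) by (auto simp: states_def)
  from assms(2) show ?thesis
  proof (cases rule: alphabetE)
    case (1 y)
    then show ?thesis using \<Phi>_set[OF s(4), of y] s by (auto simp: states_def Base_alphabet)
  next
    case (2 \<epsilon>)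
    have st: "(p, h \<otimes> inv z) \<in> states" "inv z \<in> Y" "\<theta> \<epsilon> z \<in> Y" if "z \<in> Zs \<epsilon>" for z
      using s Zs_props[OF that] by (auto simp: states_def)
    show ?thesis
    proof (cases "h \<in> R \<epsilon>")
      case True
      then show ?thesis using 2 s(1,2) by (simp add: flowS_stable sflow_def stable_alphabet)
    next
      case False
      note z = sl_last_Zs[OF s(4) False]
      show ?thesis
        using False 2 s(1,2) st[OF z] step_states[OF st(1)[OF z]]
        by (simp add: flowS_stable sflow_def Base_alphabet stable_alphabet)
    qed
  qed
qed

section \<open>Well-foundedness and boundedness of the new flow\<close>

text \<open>Base edges share the first coordinate 0 and are compared by the flow order of
  \<open>H\<close>. The \<open>Suc\<close> places every stable edge strictly above them, so the base
  letters at the two ends of a detour count as smaller.\<close>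

definition weight :: "(('a \<times> bool) list \<times> 'a) \<times> 'a hnn_letter \<Rightarrow> nat \<times> ('a \<times> 'a)" where
  "weight e = (case snd e of Base y \<Rightarrow> (0, (snd (fst e), y))
     | Stable \<Rightarrow> (Suc (length (sl True (snd (fst e)))), undefined)
     | StableInv \<Rightarrow> (Suc (length (sl False (snd (fst e)))), undefined))"

lemma weight_Base: "weight (s, Base y) = (0, (snd s, y))"
  by (simp add: weight_def)

lemma weight_stable: "weight (s, stable \<epsilon>) = (Suc (length (sl \<epsilon> (snd s))), undefined)"
  by (simp add: weight_def stable_def)

text \<open>Replacing an edge labelled by the stable letter produces at most one further such edge, and
  the geodesic attached to it is shorter.\<close>

lemma weight_decreases:
  assumes e: "e \<in> states \<times> hnn_alphabet Y" "e \<notin> TS"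
    and e': "e' \<in> set (flowS (fst e) (snd e))" "e' \<notin> TS"
  shows "(weight e', weight e) \<in> less_than <*lex*> flow_less H Y T \<Phi>"
proof -
  obtain p h c where ph: "e = ((p, h), c)" "(p, h) \<in> states" "pref_ok p" "h \<in> carrier H"
      "c \<in> hnn_alphabet Y"
    using e(1) by (auto simp: states_def)
  from ph(5) show ?thesis
  proof (cases rule: alphabetE)
    case (1 y)
    then obtain h' y' where h': "(h', y') \<in> set (\<Phi> (h, y))" "e' = ((p, h'), Base y')"
      using e'(1) ph(1) by auto
    have "(h, y) \<notin> T" "(h', y') \<notin> T"
      using e(2) e'(2) ph 1 h' by (auto simp: TS_Base)
    then show ?thesis
      using ph 1 h' by (simp add: weight_Base flow_less_def arcs_cayley)
  next
    case (2 \<epsilon>)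
    then have h: "h \<notin> R \<epsilon>" using e(2) ph by (simp add: TS_stable)
    then show ?thesis
      using e'(1) ph 2 sl_shorter[OF ph(4) h]
      by (auto simp: flowS_stable sflow_def weight_stable weight_Base)
  qed
qed

lemma flow_G: "flow_function G XG TG \<Phi>G"
proof -
  have "wf (flow_less H Y T \<Phi>)"
    using flow by (auto simp: flow_function_def Let_def intro: wf_subset)
  \<comment> \<open>Edges are compared through their pairs of state and letter, on which
    \<open>ed\<close> is injective.\<close>
  then have wf: "wf (inv_image (less_than <*lex*> flow_less H Y T \<Phi>)
      (\<lambda>e. weight (inv_into (states \<times> hnn_alphabet Y) ed e)))"
    by (intro wf_inv_image wf_lex_prod wf_less_than)
  have "flow_less G XG TG \<Phi>G \<subseteq> inv_image (less_than <*lex*> flow_less H Y T \<Phi>)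
      (\<lambda>e. weight (inv_into (states \<times> hnn_alphabet Y) ed e))"
  proof
    fix x assume "x \<in> flow_less G XG TG \<Phi>G"
    then obtain e e' where x: "x = (e', e)" "e \<in> arcs (cayley G XG)" "e' \<in> set (\<Phi>G e)" "e \<notin> TG" "e' \<notin> TG"
      by (auto simp: flow_less_def)
    then obtain d where d: "d \<in> states \<times> hnn_alphabet Y" "e = ed d" unfolding arcs_G by blast
    then obtain d' where d': "d' \<in> set (flowS (fst d) (snd d))" "e' = ed d'"
      using x(3) \<Phi>G_ed by auto
    have d's: "d' \<in> states \<times> hnn_alphabet Y"
      using d d'(1) flowS_subset[of "fst d" "snd d"] by (auto simp: mem_Times_iff)
    have "(weight d', weight d) \<in> less_than <*lex*> flow_less H Y T \<Phi>"
      using d d' d's x ed_TG by (intro weight_decreases) auto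
    then show "x \<in> inv_image (less_than <*lex*> flow_less H Y T \<Phi>)
      (\<lambda>e. weight (inv_into (states \<times> hnn_alphabet Y) ed e))"
      by (simp add: x(1) d(2) d'(2) inv_into_f_f[OF ed_inj] d(1) d's del: in_lex_prod)
  qed
  then have "wf ((flow_less G XG TG \<Phi>G)\<^sup>+)"
    using wf wf_subset wf_trancl by blast
  moreover have "pre_digraph.awalk (cayley G XG) (tail (cayley G XG) e) (\<Phi>G e) (head (cayley G XG) e)"
    if "e \<in> arcs (cayley G XG)" for e
  proof -
    from that obtain d where d: "d \<in> states \<times> hnn_alphabet Y" "e = ed d" unfolding arcs_G by blast
    then show ?thesis
      using flowS_path[of "fst d" "snd d"] \<Phi>G_ed[OF d(1)]
      by (cases d) (simp add: awalk_cayley tail_cayley ed_def head_cayley)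
  qed
  moreover have "\<Phi>G e = [e]" if "e \<in> TG" for e
    using that TS_subset flowS_TS \<Phi>G_ed by (auto simp: TG_def)
  ultimately show ?thesis
    by (auto simp: flow_function_def Let_def irrefl_def wf_not_refl)
qed

text \<open>Here 3 is the length of the detour around a stable edge outside the tree, and
  \<open>k\<close> bounds the translated flow paths of \<open>H\<close>.\<close>

lemma length_\<Phi>G: "e \<in> arcs (cayley G XG) \<Longrightarrow> length (\<Phi>G e) \<le> max k 3"
proof -
  assume "e \<in> arcs (cayley G XG)"
  then obtain s c where d: "s \<in> states" "c \<in> hnn_alphabet Y" "e = ed (s, c)"
    unfolding arcs_G by blast
  have "length (flowS s c) \<le> max k 3"
    using d(2)
  proof (cases rule: alphabetE)
    case (1 y)
    then show ?thesis
      using d(1) bound[of "(snd s, y)"] by (auto simp: arcs_cayley states_def)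
  next
    case (2 \<epsilon>)
    then show ?thesis by (auto simp: flowS_stable sflow_def split: prod.splits)
  qed
  then show ?thesis using \<Phi>G_ed[of "(s, c)"] d by simp
qed

section \<open>The graph of the stacking map\<close>

text \<open>The label of a flow path is the same in every coset, so the empty prefix can stand for
  all prefixes. This is why only the last segment of a normal form is constrained.\<close>

definition lab :: "'a hnn_letter \<Rightarrow> 'a \<Rightarrow> 'a hnn_letter list" where
  "lab c h = map snd (flowS ([], h) c)"

lemma lab_flowS: "map snd (flowS (p, h) c) = lab c h"
  by (cases c) (auto simp: lab_def sflow_def)

lemma lab_alphabet: "h \<in> carrier H \<Longrightarrow> c \<in> hnn_alphabet Y \<Longrightarrow> lab c h \<in> lists (hnn_alphabet Y)"
  using flowS_subset[of "([], h)" c] by (fastforce simp: lab_def states_def)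

text \<open>A representative is trivial exactly when its segment is empty, so \<open>pref_ok\<close>
  and \<open>segs_ok\<close> exclude the same cancellations.\<close>

lemma hnn_lang_nfH:
  assumes "S \<subseteq> carrier H"
  shows "hnn_lang N (nfH ` S) = {snf (p, h) | p h. pref_ok p \<and> h \<in> S}"
proof -
  let ?m = "map (\<lambda>(\<tau>, \<epsilon>). (nfH \<tau>, \<epsilon> :: bool))"
  have sign: "last_sign (?m p) = last_sign p" for p
    by (cases p) (auto simp: last_sign_def)
  have ok: "segs_ok N (?m p)" if "pref_ok p" for p
    using that
  proof (induction p rule: pref_ok.induct)
    case (2 \<tau> \<epsilon> p)
    then show ?case using R_carrier[of \<epsilon>] by (auto simp: sign N_def nfH_Nil_iff subset_iff)
  qed simp
  have ex: "\<exists>p. pref_ok p \<and> ps = ?m p" if "segs_ok N ps" for ps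
    using that
  proof (induction ps)
    case (Cons x ps)
    obtain v \<epsilon> where x: "x = (v, \<epsilon>)" by force
    obtain \<tau> where \<tau>: "\<tau> \<in> R \<epsilon>" "v = nfH \<tau>" using Cons.prems by (auto simp: x N_def)
    obtain p where p: "pref_ok p" "ps = ?m p" using Cons x by auto
    have "pref_ok ((\<tau>, \<epsilon>) # p)"
      using Cons.prems x \<tau> p R_carrier[of \<epsilon>] by (auto simp: sign nfH_one)
    then show ?case using x \<tau> p by (intro exI[of _ "(\<tau>, \<epsilon>) # p"]) simp
  qed (auto intro: exI[of _ "[]"])
  show ?thesis
  proof (intro equalityI subsetI)
    fix w assume "w \<in> hnn_lang N (nfH ` S)"
    then obtain ps h where "segs_ok N ps" "h \<in> S" "w = segs_word ps @ map Base (nfH h)"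
      by (auto simp: hnn_lang_def)
    with ex[of ps] show "w \<in> {snf (p, h) | p h. pref_ok p \<and> h \<in> S}"
      by (auto simp: snf_def pnf_def)
  next
    fix w assume "w \<in> {snf (p, h) | p h. pref_ok p \<and> h \<in> S}"
    then obtain p h where "pref_ok p" "h \<in> S" "w = snf (p, h)" by blast
    with ok[of p] show "w \<in> hnn_lang N (nfH ` S)"
      unfolding hnn_lang_def snf_def pnf_def by auto
  qed
qed

lemma slice_G:
  assumes c: "c \<in> hnn_alphabet Y"
  shows "slice (stacking_graph G XG TG \<Phi>G) (\<kappa> c) u =
    map \<kappa> ` hnn_lang N (nfH ` {h \<in> carrier H. u = map \<kappa> (lab c h)})"
proof -
  have lab: "label (\<Phi>G (el (p, h), \<kappa> c)) = map \<kappa> (lab c h)" if "(p, h) \<in> states" for p h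
  proof -
    have "\<Phi>G (el (p, h), \<kappa> c) = map ed (flowS (p, h) c)"
      using \<Phi>G_ed[of "((p, h), c)"] that c by (simp add: ed_def)
    moreover have "snd \<circ> ed = \<kappa> \<circ> snd" by (auto simp: ed_def)
    ultimately show ?thesis by (simp flip: lab_flowS[of p h c])
  qed
  have "slice (stacking_graph G XG TG \<Phi>G) (\<kappa> c) u =
      {map \<kappa> (snf s) | s. s \<in> states \<and> u = map \<kappa> (lab c (snd s))}"
  proof (intro equalityI subsetI)
    fix w assume "w \<in> slice (stacking_graph G XG TG \<Phi>G) (\<kappa> c) u"
    then obtain g where g: "g \<in> carrier G" "w = nf G TG g" "u = label (\<Phi>G (g, \<kappa> c))"
      by (auto simp: slice_def stacking_graph_def)
    then obtain s where "s \<in> states" "g = el s" by (auto simp flip: el_surj)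
    then show "w \<in> {map \<kappa> (snf s) | s. s \<in> states \<and> u = map \<kappa> (lab c (snd s))}"
      using g lab[of "fst s" "snd s"] nfG by (intro CollectI exI[of _ s]) simp
  next
    fix w assume "w \<in> {map \<kappa> (snf s) | s. s \<in> states \<and> u = map \<kappa> (lab c (snd s))}"
    then obtain s where s: "s \<in> states" "w = nf G TG (el s)" "u = label (\<Phi>G (el s, \<kappa> c))"
      using lab nfG by force
    then show "w \<in> slice (stacking_graph G XG TG \<Phi>G) (\<kappa> c) u"
      using c el_carrier[OF s(1)] unfolding slice_def stacking_graph_def XG_def by blast
  qed
  also have "\<dots> = map \<kappa> ` {snf (p, h) | p h. pref_ok p \<and> h \<in> {h \<in> carrier H. u = map \<kappa> (lab c h)}}"
    by (force simp: states_def)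
  finally show ?thesis by (subst hnn_lang_nfH) auto
qed

text \<open>The factorisation into a representative and a selected word is unique, so the given
  language of last letters is the set of normal forms at which the flow path of the stable edge uses
  \<open>z\<close>.\<close>

lemma last_letter_lang_N:
  assumes z: "z \<in> Zs \<epsilon>"
  shows "last_letter_lang H (normal_forms H T) (N \<epsilon>) (SL \<epsilon>) z =
    nfH ` {h \<in> carrier H. h \<notin> R \<epsilon> \<and> last (sl \<epsilon> h) = z}"
proof (intro equalityI subsetI)
  fix w assume "w \<in> last_letter_lang H (normal_forms H T) (N \<epsilon>) (SL \<epsilon>) z"
  then obtain h \<tau> \<sigma> where h: "h \<in> carrier H" "w = nfH h" and \<tau>: "\<tau> \<in> R \<epsilon>" and
    \<sigma>: "\<sigma> \<in> SL \<epsilon>" "\<sigma> \<noteq> []" "last \<sigma> = z" and val: "word_val H w = word_val H (nfH \<tau> @ \<sigma>)"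
    by (auto simp: last_letter_lang_def normal_forms_def N_def)
  have \<tau>c: "\<tau> \<in> carrier H" using \<tau> R_carrier by blast
  have \<sigma>c: "\<sigma> \<in> lists (carrier H)" "\<sigma> \<in> lists (D \<epsilon>)" using \<sigma>(1) SL_lists[of \<epsilon>] Zs_carrier Zs_D by (fast+)
  have \<sigma>D: "word_val H \<sigma> \<in> D \<epsilon>"
    using \<sigma>c(2) subgroup.m_closed[OF subgroup_D] one_D by (induction \<sigma>) (auto simp: word_val_def)
  have "nfH \<tau> \<in> lists (carrier H)" using nfH_word[OF \<tau>c] Y_carrier by auto
  then have "h = \<tau> \<otimes> word_val H \<sigma>"
    using val h nfH_word \<tau>c \<sigma>c by (simp add: word_val_append)
  then have "rest \<epsilon> h = word_val H \<sigma>" using rest_eq[OF \<tau> \<sigma>D] by simp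
  then have "sl \<epsilon> h = \<sigma>" using h \<sigma> by (intro sl_eqI) auto
  moreover have "h \<notin> R \<epsilon>"
  proof
    assume "h \<in> R \<epsilon>"
    then have "word_val H \<sigma> = \<one>" using \<open>rest \<epsilon> h = word_val H \<sigma>\<close> rest_of_R by simp
    \<comment> \<open>The empty word has the same value, so minimality would make
      \<open>\<sigma>\<close> empty.\<close>
    then have "length \<sigma> \<le> length ([] :: 'a list)"
      using \<sigma>(1) by (intro SL_min) (auto simp: word_val_Nil)
    then show False using \<sigma>(2) by simp
  qed
  ultimately show "w \<in> nfH ` {h \<in> carrier H. h \<notin> R \<epsilon> \<and> last (sl \<epsilon> h) = z}"
    using h \<sigma> by auto
next
  fix w assume "w \<in> nfH ` {h \<in> carrier H. h \<notin> R \<epsilon> \<and> last (sl \<epsilon> h) = z}"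
  then obtain h where h: "h \<in> carrier H" "h \<notin> R \<epsilon>" "last (sl \<epsilon> h) = z" "w = nfH h" by blast
  have c: "rep \<epsilon> h \<in> carrier H" using rep_R[OF h(1)] R_carrier by blast
  have "sl \<epsilon> h \<in> lists (carrier H)" using sl[OF h(1), of \<epsilon>] SL_lists[of \<epsilon>] Zs_carrier by fast
  moreover have "nfH (rep \<epsilon> h) \<in> lists (carrier H)" using nfH_word[OF c] Y_carrier by auto
  ultimately have "word_val H w = word_val H (nfH (rep \<epsilon> h) @ sl \<epsilon> h)"
    using h sl[OF h(1), of \<epsilon>] nfH_word[OF c] nfH_word[OF h(1)] rep_mult_rest[OF h(1), of \<epsilon>]
    by (simp add: word_val_append)
  then show "w \<in> last_letter_lang H (normal_forms H T) (N \<epsilon>) (SL \<epsilon>) z"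
    using h rep_R[OF h(1), of \<epsilon>] sl[OF h(1), of \<epsilon>] sl_Nil[OF h(1,2)]
    unfolding last_letter_lang_def normal_forms_def N_def by blast
qed

lemma \<Phi>_label:
  assumes "h \<in> carrier H" "y \<in> Y"
  shows "label (\<Phi> (h, y)) \<in> {v \<in> lists Y. length v \<le> k}"
  using \<Phi>_set[OF assms] bound[of "(h, y)"] assms by (fastforce simp: arcs_cayley)

text \<open>\<open>P\<close> stands for regularity or decidability. For a base letter the last
  segments form a slice of the stacking graph of \<open>H\<close>; for a stable letter the label
  shows whether \<open>h\<close> is a representative and, if not, reveals the last letter through
  its inverse. A word that is no label gives the empty language.\<close>

lemma slice_G_cases:
  assumes c: "c \<in> hnn_alphabet Y"
    and P: "P {}" "\<And>y v. y \<in> Y \<Longrightarrow> v \<in> {v \<in> lists Y. length v \<le> k} \<Longrightarrow> P (slice (stacking_graph H Y T \<Phi>) y v)"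
      "\<And>\<epsilon>. P (N \<epsilon>)"
      "\<And>\<epsilon> z. z \<in> Zs \<epsilon> \<Longrightarrow> P (last_letter_lang H (normal_forms H T) (N \<epsilon>) (SL \<epsilon>) z)"
  obtains K where "slice (stacking_graph G XG TG \<Phi>G) (\<kappa> c) u = map \<kappa> ` hnn_lang N K" "P K"
proof -
  define S where "S = {h \<in> carrier H. u = map \<kappa> (lab c h)}"
  have "P (nfH ` S)"
  proof (cases "S = {}")
    case False
    then obtain h0 where h0: "h0 \<in> carrier H" "u = map \<kappa> (lab c h0)" by (auto simp: S_def)
    have "map \<kappa> (lab c h0) = map \<kappa> (lab c h) \<longleftrightarrow> lab c h = lab c h0" if "h \<in> carrier H" for h
    proof -
      have "inj_on \<kappa> (set (lab c h0) \<union> set (lab c h))"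
        using lab_alphabet[OF that c] lab_alphabet[OF h0(1) c] by (intro inj_on_subset[OF \<kappa>_inj_Y]) auto
      from inj_on_map_eq_map[OF this] show ?thesis by metis
    qed
    then have S: "S = {h \<in> carrier H. lab c h = lab c h0}"
      using h0 by (auto simp: S_def)
    from c show ?thesis
    proof (cases rule: alphabetE)
      case (1 y)
      have inj_Base: "inj Base" by (simp add: inj_def)
      have lab: "lab c h = map Base (label (\<Phi> (h, y)))" for h
        by (simp add: lab_def 1 split_beta comp_def)
      have "S = {h \<in> carrier H. label (\<Phi> (h, y)) = label (\<Phi> (h0, y))}"
        unfolding S by (simp only: lab inj_map_eq_map[OF inj_Base])
      then have "nfH ` S = slice (stacking_graph H Y T \<Phi>) y (label (\<Phi> (h0, y)))"
        using 1(2) by (auto simp: slice_def stacking_graph_def)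
      then show ?thesis using P(2)[OF 1(2) \<Phi>_label[OF h0(1) 1(2)]] by simp
    next
      case (2 \<epsilon>)
      have lab: "lab c h = (if h \<in> R \<epsilon> then [stable \<epsilon>] else
          [Base (inv (last (sl \<epsilon> h))), stable \<epsilon>, Base (\<theta> \<epsilon> (last (sl \<epsilon> h)))])" for h
        by (simp add: lab_def 2 flowS_stable sflow_def)
      show ?thesis
      proof (cases "h0 \<in> R \<epsilon>")
        case True
        then have "S = R \<epsilon>" unfolding S lab using R_carrier[of \<epsilon>] by auto
        then show ?thesis using P(3)[of \<epsilon>] by (simp add: N_def)
      next
        case False
        let ?z = "last (sl \<epsilon> h0)"
        have z: "?z \<in> Zs \<epsilon>" by (rule sl_last_Zs[OF h0(1) False])
        have "S = {h \<in> carrier H. h \<notin> R \<epsilon> \<and> last (sl \<epsilon> h) = ?z}"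
        proof (intro equalityI subsetI)
          fix h assume "h \<in> S"
          then have h: "h \<in> carrier H" "h \<notin> R \<epsilon>" "inv (last (sl \<epsilon> h)) = inv ?z"
            unfolding S lab using False by (auto split: if_splits)
          then have "last (sl \<epsilon> h) = ?z"
            using z sl_last_Zs[OF h(1,2)] Zs_carrier by (metis inv_inv subsetD)
          then show "h \<in> {h \<in> carrier H. h \<notin> R \<epsilon> \<and> last (sl \<epsilon> h) = ?z}" using h by simp
        qed (use False in \<open>auto simp: S lab\<close>)
        then show ?thesis using P(4)[OF z] last_letter_lang_N[OF z] by simp
      qed
    qed
  qed (use P(1) in simp)
  then show ?thesis by (rule that[OF slice_G[OF c, of u, folded S_def]])
qed

section \<open>The stacking structure of the extension\<close>

lemma stacking_relation_H:
  "stacking_relation Y {v \<in> lists Y. length v \<le> k} (stacking_graph H Y T \<Phi>)"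
proof -
  have fin: "finite Y" using gens_Y by (simp add: inv_closed_gens_def)
  have "[nfH h, [y], label (\<Phi> (h, y))] \<in> {[w, [a], u] | w a u. w \<in> lists Y \<and> a \<in> Y \<and>
      u \<in> {v \<in> lists Y. length v \<le> k}}" if "h \<in> carrier H" "y \<in> Y" for h y
    using \<Phi>_label[OF that] nfH_word[OF that(1)] that(2) by auto
  then show ?thesis
    using fin finite_short_lists[OF fin, of k]
    unfolding stacking_relation_def stacking_graph_def by (intro conjI subsetI) auto
qed

lemma stacking_relation_G:
  "stacking_relation XG {v \<in> lists XG. length v \<le> max k 3} (stacking_graph G XG TG \<Phi>G)"
proof -
  have fin: "finite XG" using gens_XG by (simp add: inv_closed_gens_def)
  have "label (\<Phi>G (g, x)) \<in> {v \<in> lists XG. length v \<le> max k 3}" if "g \<in> carrier G" "x \<in> XG" for g x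
  proof -
    have a: "(g, x) \<in> arcs (cayley G XG)" using that by (simp add: arcs_cayley)
    then have "pre_digraph.awalk (cayley G XG) (tail (cayley G XG) (g, x)) (\<Phi>G (g, x)) (head (cayley G XG) (g, x))"
      using flow_G by (auto simp: flow_function_def)
    from G.awalk_label[OF XG_carrier this] show ?thesis using length_\<Phi>G[OF a] by simp
  qed
  moreover have "nf G TG g \<in> lists XG" if "g \<in> carrier G" for g
    using GT.nf_system_word[OF G.maximal_tree_nf_system[OF XG_carrier max_TG] that] by simp
  ultimately have "[nf G TG g, [x], label (\<Phi>G (g, x))] \<in> {[w, [a], u] | w a u. w \<in> lists XG \<and>
      a \<in> XG \<and> u \<in> {v \<in> lists XG. length v \<le> max k 3}}" if "g \<in> carrier G" "x \<in> XG" for g x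
    using that by auto
  then show ?thesis
    using fin finite_short_lists[OF fin, of "max k 3"]
    unfolding stacking_relation_def stacking_graph_def by (intro conjI subsetI) auto
qed

lemma bounded_flow_G: "bounded_flow_function G XG TG \<Phi>G"
  using flow_G length_\<Phi>G unfolding bounded_flow_function_def by blast

theorem autostackable_G:
  assumes "sync_regular Y 3 (stacking_graph H Y T \<Phi>)"
    and N: "\<And>\<epsilon>. regular_lang Y (N \<epsilon>)"
    and L: "\<And>\<epsilon> z. z \<in> Zs \<epsilon> \<Longrightarrow> regular_lang Y (last_letter_lang H (normal_forms H T) (N \<epsilon>) (SL \<epsilon>) z)"
  shows "autostackable G"
proof -
  have "regular_lang XG (slice (stacking_graph G XG TG \<Phi>G) x u)" if x: "x \<in> XG" for x u
  proof -
    from x obtain c where c: "c \<in> hnn_alphabet Y" "x = \<kappa> c" by (auto simp: XG_def)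
    obtain K where K: "slice (stacking_graph G XG TG \<Phi>G) (\<kappa> c) u = map \<kappa> ` hnn_lang N K" "regular_lang Y K"
      using assms(1) N L regular_lang_empty[OF regular_lang_finite[OF N[of True]]]
      unfolding sync_regular_iff_slices[OF stacking_relation_H]
      by (elim slice_G_cases[OF c(1), rotated -1]) blast+
    have "regular_lang XG (map \<kappa> ` hnn_lang N K)"
      unfolding XG_def by (intro regular_lang_map regular_hnn_lang N K(2) \<kappa>_inj_Y)
    then show ?thesis by (simp add: c(2) K(1))
  qed
  then have "sync_regular XG 3 (stacking_graph G XG TG \<Phi>G)"
    unfolding sync_regular_iff_slices[OF stacking_relation_G] by blast
  then have "autostackable_structure G XG TG \<Phi>G"
    using gens_XG max_TG bounded_flow_G by (simp add: autostackable_structure_def)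
  then show ?thesis unfolding autostackable_def using group_G by blast
qed

theorem alg_stackable_G:
  assumes "decidable_tuples Y 3 (stacking_graph H Y T \<Phi>)"
    and N: "\<And>\<epsilon>. decidable_lang Y (N \<epsilon>)"
    and L: "\<And>\<epsilon> z. z \<in> Zs \<epsilon> \<Longrightarrow> decidable_lang Y (last_letter_lang H (normal_forms H T) (N \<epsilon>) (SL \<epsilon>) z)"
  shows "alg_stackable G"
proof -
  have "decidable_lang XG (slice (stacking_graph G XG TG \<Phi>G) x u)" if x: "x \<in> XG" for x u
  proof -
    from x obtain c where c: "c \<in> hnn_alphabet Y" "x = \<kappa> c" by (auto simp: XG_def)
    obtain K where K: "slice (stacking_graph G XG TG \<Phi>G) (\<kappa> c) u = map \<kappa> ` hnn_lang N K" "decidable_lang Y K"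
      using assms(1) N L decidable_lang_empty[OF decidable_lang_finite[OF N[of True]]]
      unfolding decidable_iff_slices[OF stacking_relation_H]
      by (elim slice_G_cases[OF c(1), rotated -1]) blast+
    have "decidable_lang XG (map \<kappa> ` hnn_lang N K)"
      unfolding XG_def by (intro decidable_lang_map decidable_hnn_lang N K(2) \<kappa>_inj_Y)
    then show ?thesis by (simp add: c(2) K(1))
  qed
  then have "decidable_tuples XG 3 (stacking_graph G XG TG \<Phi>G)"
    unfolding decidable_iff_slices[OF stacking_relation_G] by blast
  then have "alg_stackable_structure G XG TG \<Phi>G"
    using gens_XG max_TG bounded_flow_G by (simp add: alg_stackable_structure_def)
  then show ?thesis unfolding alg_stackable_def using group_G by blast
qed

end

section \<open>Shortlex normal forms and transversals\<close>

lemma lenlex_total_on_lists: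
  assumes "total_on Z r"
  shows "u \<in> lists Z \<Longrightarrow> v \<in> lists Z \<Longrightarrow> u = v \<or> (u, v) \<in> lenlex r \<or> (v, u) \<in> lenlex r"
proof (induction u arbitrary: v)
  case Nil
  then show ?case by (cases v) auto
next
  case (Cons a u)
  show ?case
  proof (cases v)
    case v: (Cons b v')
    have "a = b \<or> (a, b) \<in> r \<or> (b, a) \<in> r"
      using assms Cons.prems v by (auto simp: total_on_def)
    moreover have "u = v' \<or> (u, v') \<in> lenlex r \<or> (v', u) \<in> lenlex r"
      using Cons.IH[of v'] Cons.prems v by auto
    ultimately show ?thesis
      unfolding v Cons_lenlex_iff by (metis linorder_neqE_nat list.inject)
  qed simp
qed

text \<open>A word that is smaller in \<open>lenlex\<close> is never longer, so the least word is
  found among the finitely many words of length at most that of \<open>w\<close>. There a transitive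
  irreflexive relation is well-founded, and totality on words over \<open>Z\<close> makes the
  minimal word least.\<close>

lemma shortlex_nfs_ex1:
  assumes fin: "finite Z" and r: "strict_linear_order_on Z r" and w: "w \<in> lists Z" "word_val G w = g"
  shows "\<exists>!\<sigma>. \<sigma> \<in> shortlex_nfs G Z r \<and> word_val G \<sigma> = g"
proof -
  have tr: "trans (lenlex r)" and irr: "(u, u) \<notin> lenlex r" for u
    using r lenlex_transI lenlex_irreflexive[of r] by (auto simp: strict_linear_order_on_def irrefl_def)
  define W where "W = {v \<in> lists Z. length v \<le> length w \<and> word_val G v = g}"
  have "finite W"
    by (rule finite_subset[OF _ finite_short_lists[OF fin, of "length w"]]) (auto simp: W_def)
  moreover have "acyclic (Restr (lenlex r) W)"
    using irr trancl_mono[of _ "Restr (lenlex r) W" "lenlex r"]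
    by (auto simp: acyclic_def trancl_id[OF tr])
  ultimately have wf: "wf (Restr (lenlex r) W)" by (intro finite_acyclic_wf) auto
  have "w \<in> W" using w by (simp add: W_def)
  then obtain \<sigma> where \<sigma>: "\<sigma> \<in> W" and min: "\<And>v. (v, \<sigma>) \<in> Restr (lenlex r) W \<Longrightarrow> v \<notin> W"
    by (rule wfE_min[OF wf]) blast
  have "v = \<sigma> \<or> (\<sigma>, v) \<in> lenlex r" if "v \<in> lists Z" "word_val G v = word_val G \<sigma>" for v
  proof (rule ccontr)
    assume neg: "\<not> (v = \<sigma> \<or> (\<sigma>, v) \<in> lenlex r)"
    then have "(v, \<sigma>) \<in> lenlex r"
      using lenlex_total_on_lists[of Z r \<sigma> v] r \<sigma> that by (auto simp: strict_linear_order_on_def W_def)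
    moreover from this have "v \<in> W"
      using lenlex_length[of v \<sigma> r] \<sigma> that by (auto simp: W_def)
    ultimately show False using min \<sigma> by blast
  qed
  then have "\<sigma> \<in> shortlex_nfs G Z r \<and> word_val G \<sigma> = g"
    using \<sigma> by (auto simp: shortlex_nfs_def W_def)
  moreover have "\<sigma>' = \<sigma>''"
    if "\<sigma>' \<in> shortlex_nfs G Z r" "\<sigma>'' \<in> shortlex_nfs G Z r" "word_val G \<sigma>' = word_val G \<sigma>''" for \<sigma>' \<sigma>''
  proof (rule ccontr)
    assume "\<sigma>' \<noteq> \<sigma>''"
    then have "(\<sigma>', \<sigma>'') \<in> lenlex r" "(\<sigma>'', \<sigma>') \<in> lenlex r"
      using that unfolding shortlex_nfs_def by (metis (mono_tags, lifting) mem_Collect_eq)+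
    then show False using irr transD[OF tr] by blast
  qed
  ultimately show ?thesis by metis
qed

lemma shortlex_nfs_length:
  "\<sigma> \<in> shortlex_nfs G Z r \<Longrightarrow> v \<in> lists Z \<Longrightarrow> word_val G v = word_val G \<sigma> \<Longrightarrow> length \<sigma> \<le> length v"
  unfolding shortlex_nfs_def using lenlex_length by fastforce

context group
begin

lemma generate_words:
  assumes "Z \<subseteq> carrier G" "\<forall>z\<in>Z. inv z \<in> Z"
  shows "generate G Z = word_val G ` lists Z"
proof (intro equalityI subsetI)
  fix a assume "a \<in> generate G Z"
  then show "a \<in> word_val G ` lists Z"
  proof (induction rule: generate.induct)
    case one
    show ?case by (rule image_eqI[of _ _ "[]"]) (auto simp: word_val_Nil)
  next
    case (incl h)
    then show ?case using assms(1) by (intro image_eqI[of _ _ "[h]"]) (auto simp: word_val_def)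
  next
    case (inv h)
    then show ?case using assms by (intro image_eqI[of _ _ "[inv h]"]) (auto simp: word_val_def)
  next
    case (eng h1 h2)
    then obtain u v where "u \<in> lists Z" "v \<in> lists Z" "h1 = word_val G u" "h2 = word_val G v" by blast
    moreover from this have "word_val G (u @ v) = word_val G u \<otimes> word_val G v"
      using lists_mono[OF assms(1)] by (intro word_val_append) blast+
    ultimately show ?case by (intro image_eqI[of _ _ "u @ v"]) auto
  qed
next
  fix a assume "a \<in> word_val G ` lists Z"
  then obtain w where "w \<in> lists Z" "a = word_val G w" by blast
  moreover have "word_val G w \<in> generate G Z" if "w \<in> lists Z" for w
    using that by (induction w) (auto simp: word_val_def intro: generate.one generate.eng generate.incl)
  ultimately show "a \<in> generate G Z" by simp
qed

text \<open>Two left cosets of \<open>B\<close> agree exactly when the quotient of their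
  representatives lies in \<open>B\<close>; this turns the bijection of words with cosets into the
  form used for factoring elements.\<close>

lemma represents_transversal_unique:
  assumes B: "subgroup B G" and N: "represents_transversal G B N" "N \<subseteq> lists (carrier G)"
    and h: "h \<in> carrier G"
  shows "\<exists>!\<tau>. \<tau> \<in> word_val G ` N \<and> inv \<tau> \<otimes> h \<in> B"
proof -
  have bij: "bij_betw (\<lambda>w. word_val G w <# B) N (lcosets B)"
    using N by (simp add: represents_transversal_def)
  have coset: "h <# B = \<tau> <# B \<longleftrightarrow> inv \<tau> \<otimes> h \<in> B" if \<tau>: "\<tau> \<in> carrier G" for \<tau>
  proof
    assume "h <# B = \<tau> <# B"
    then have "h \<in> \<tau> <# B" using lcos_self[OF h B] by simp
    then obtain b where "b \<in> B" "h = \<tau> \<otimes> b" by (auto simp: l_coset_def)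
    then show "inv \<tau> \<otimes> h \<in> B"
      using \<tau> subgroup.mem_carrier[OF B] by (simp flip: m_assoc)
  next
    assume "inv \<tau> \<otimes> h \<in> B"
    moreover have "h = \<tau> \<otimes> (inv \<tau> \<otimes> h)" using \<tau> h by (simp flip: m_assoc)
    ultimately have "h \<in> \<tau> <# B" unfolding l_coset_def by blast
    then show "h <# B = \<tau> <# B" using l_repr_independence[OF _ \<tau> B] by simp
  qed
  have closed: "word_val G w \<in> carrier G" if "w \<in> N" for w
    using that N(2) word_val_closed by blast
  have "h <# B \<in> lcosets B" using h by (auto simp: LCOSETS_def)
  then have "h <# B \<in> (\<lambda>w. word_val G w <# B) ` N"
    by (simp only: bij_betw_imp_surj_on[OF bij])
  then obtain w where w: "w \<in> N" "word_val G w <# B = h <# B" by auto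
  show ?thesis
  proof (rule ex1I[of _ "word_val G w"])
    show "word_val G w \<in> word_val G ` N \<and> inv (word_val G w) \<otimes> h \<in> B"
      using w coset[OF closed[OF w(1)]] by auto
    fix \<tau> assume "\<tau> \<in> word_val G ` N \<and> inv \<tau> \<otimes> h \<in> B"
    then obtain w' where w': "w' \<in> N" "\<tau> = word_val G w'" "inv \<tau> \<otimes> h \<in> B" by blast
    then have "word_val G w' <# B = word_val G w <# B"
      using coset[OF closed[OF w'(1)]] w(2) by simp
    then have "w' = w" using w'(1) w(1) by (rule inj_onD[OF bij_betw_imp_inj_on[OF bij]])
    then show "\<tau> = word_val G w" by (simp add: w')
  qed
qed

end

lemma hnn_stackableI:
  fixes H :: "('a, 'b) monoid_scheme" and Z :: "'a set" and r and \<psi> :: "'a \<Rightarrow> 'a" and N_HA N_HpA :: "'a list set" and k :: nat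
  defines "N \<equiv> \<lambda>\<epsilon>. if \<epsilon> then N_HpA else N_HA"
    and "Zs \<equiv> \<lambda>\<epsilon>. if \<epsilon> then \<psi> ` Z else Z"
    and "SL \<equiv> \<lambda>\<epsilon>. if \<epsilon> then map \<psi> ` shortlex_nfs H Z r else shortlex_nfs H Z r"
  assumes "group H" and A: "subgroup A H"
    and Z: "finite Z" "Z \<subseteq> Y" "\<forall>z\<in>Z. inv\<^bsub>H\<^esub> z \<in> Z" "generate H Z = A"
    and r: "strict_linear_order_on Z r"
    and mon: "\<psi> \<in> mon (H\<lparr>carrier := A\<rparr>) H" "\<psi> ` Z \<subseteq> Y"
    and NA: "N_HA \<subseteq> normal_forms H T" "[] \<in> N_HA" "represents_transversal H A N_HA"
    and NpA: "N_HpA \<subseteq> normal_forms H T" "[] \<in> N_HpA" "represents_transversal H (\<psi> ` A) N_HpA"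
    and Y: "inv_closed_gens H Y" and T: "maximal_tree H Y T" and \<Phi>: "flow_function H Y T \<Phi>"
    and k: "\<forall>e\<in>arcs (cayley H Y). length (\<Phi> e) \<le> k"
  shows "hnn_stackable H A \<psi> (\<lambda>\<epsilon>. word_val H ` N \<epsilon>) Y T \<Phi> Zs SL k"
    and "nf H T ` word_val H ` N \<epsilon> = N \<epsilon>"
proof -
  interpret group H by fact
  have YC: "Y \<subseteq> carrier H" using Y by (simp add: inv_closed_gens_def)
  interpret HT: sym_tree_edges H Y T
    using T YC by unfold_locales (auto simp: maximal_tree_def cayley_def)
  have nf: "word_val H (nf H T h) = h" "nf H T h \<in> lists Y" if "h \<in> carrier H" for h
    using HT.nf_system_word[OF maximal_tree_nf_system[OF YC T] that] by auto
  have N: "N \<epsilon> \<subseteq> normal_forms H T" "[] \<in> N \<epsilon>"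
    "represents_transversal H (if \<epsilon> then \<psi> ` A else A) (N \<epsilon>)" for \<epsilon>
    using NA NpA by (simp_all add: N_def)
  have norm: "nf H T (word_val H w) = w" "w \<in> lists Y" if "w \<in> normal_forms H T" for w
    using that nf by (auto simp: normal_forms_def)
  show "nf H T ` word_val H ` N \<epsilon> = N \<epsilon>"
  proof -
    have "nf H T (word_val H w) = w" if "w \<in> N \<epsilon>" for w
      using norm(1) N(1) that by blast
    then show ?thesis by (simp add: image_image)
  qed
  have NY: "N \<epsilon> \<subseteq> lists (carrier H)" for \<epsilon>
    using N(1)[of \<epsilon>] norm(2) lists_mono[OF YC] by blast
  interpret hnn H A \<psi> "\<lambda>\<epsilon>. word_val H ` N \<epsilon>"
  proof (intro hnn.intro hnn_axioms.intro)
    show "group H" "subgroup A H" "\<psi> \<in> mon (H\<lparr>carrier := A\<rparr>) H" by fact+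
    show "word_val H ` N \<epsilon> \<subseteq> carrier H" for \<epsilon> using NY word_val_closed by blast
    show "\<one>\<^bsub>H\<^esub> \<in> word_val H ` N \<epsilon>" for \<epsilon>
      using N(2)[of \<epsilon>] by (metis image_eqI word_val_Nil)
    show "\<exists>!\<tau>. \<tau> \<in> word_val H ` N \<epsilon> \<and> inv\<^bsub>H\<^esub> \<tau> \<otimes>\<^bsub>H\<^esub> h \<in> (if \<epsilon> then \<psi> ` A else A)"
      if "h \<in> carrier H" for h \<epsilon>
      using A subgroup_mon_image[OF A mon(1)] by (intro represents_transversal_unique N NY that) simp
  qed
  have words: "A = word_val H ` lists Z"
    using generate_words[of Z] Z YC by auto
  have ZA: "Z \<subseteq> A" using Z(4) generate.incl[of _ Z H] by blast
  have \<psi>1: "\<psi> \<one>\<^bsub>H\<^esub> = \<one>\<^bsub>H\<^esub>" using \<theta>_one[of False] by (simp add: \<theta>_def)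
  have valA: "word_val H w \<in> A" if "w \<in> lists Z" for w using that words by blast
  have val\<psi>: "word_val H (map \<psi> w) = \<psi> (word_val H w)" if "w \<in> lists Z" for w
    using that
  proof (induction w)
    case (Cons a w)
    then show ?case using valA[of w] ZA by (auto simp: word_val_def \<psi>_mult)
  qed (simp add: word_val_Nil \<psi>1)
  have SLZ: "shortlex_nfs H Z r \<subseteq> lists Z" by (auto simp: shortlex_nfs_def)
  have \<psi>inv: "inv\<^bsub>H\<^esub> (\<psi> z) = \<psi> (inv\<^bsub>H\<^esub> z)" if "z \<in> Z" for z
  proof (rule inv_equality)
    have z: "z \<in> A" "inv\<^bsub>H\<^esub> z \<in> A" "z \<in> carrier H" using that ZA Z YC by auto
    then show "\<psi> (inv\<^bsub>H\<^esub> z) \<otimes>\<^bsub>H\<^esub> \<psi> z = \<one>\<^bsub>H\<^esub>" by (simp add: \<psi>1 flip: \<psi>_mult)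
    show "\<psi> z \<in> carrier H" "\<psi> (inv\<^bsub>H\<^esub> z) \<in> carrier H" using that Z mon(2) YC by auto
  qed
  show "hnn_stackable H A \<psi> (\<lambda>\<epsilon>. word_val H ` N \<epsilon>) Y T \<Phi> Zs SL k"
  proof (intro hnn_stackable.intro hnn_stackable_axioms.intro)
    show "hnn H A \<psi> (\<lambda>\<epsilon>. word_val H ` N \<epsilon>)" by (rule hnn_axioms)
    show "inv_closed_gens H Y" "maximal_tree H Y T" "flow_function H Y T \<Phi>" by fact+
    show "length (\<Phi> e) \<le> k" if "e \<in> arcs (cayley H Y)" for e using k that by blast
    fix \<epsilon>
    show "Zs \<epsilon> \<subseteq> Y" using Z mon by (simp add: Zs_def)
    show "Zs \<epsilon> \<subseteq> D \<epsilon>" using ZA by (auto simp: Zs_def D_def)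
    show "inv\<^bsub>H\<^esub> z \<in> Zs \<epsilon>" if "z \<in> Zs \<epsilon>" for z
      using that Z \<psi>inv by (auto simp: Zs_def split: if_splits)
    show "\<theta> \<epsilon> z \<in> Y" if z: "z \<in> Zs \<epsilon>" for z
    proof (cases \<epsilon>)
      case True
      then obtain x where "x \<in> Z" "z = \<psi> x" using z by (auto simp: Zs_def)
      moreover from this have "\<theta> \<epsilon> z = x"
        using True ZA inv_into_f_f[OF \<psi>_inj, of x] by (auto simp: \<theta>_def)
      ultimately show ?thesis using Z(2) by auto
    next
      case False
      then show ?thesis using z mon(2) by (auto simp: Zs_def \<theta>_def)
    qed
    show "SL \<epsilon> \<subseteq> lists (Zs \<epsilon>)"
      using SLZ by (auto simp: SL_def Zs_def lists_image)
    show "\<exists>!\<sigma>. \<sigma> \<in> SL \<epsilon> \<and> word_val H \<sigma> = b" if b: "b \<in> D \<epsilon>" for b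
    proof -
      have ex: "\<exists>!\<sigma>. \<sigma> \<in> shortlex_nfs H Z r \<and> word_val H \<sigma> = a" if a: "a \<in> A" for a
      proof -
        from a words obtain w where w: "w \<in> lists Z" "word_val H w = a" by auto
        show ?thesis by (rule shortlex_nfs_ex1[OF Z(1) r w])
      qed
      show ?thesis
      proof (cases \<epsilon>)
        case True
        then obtain a where a: "a \<in> A" "b = \<psi> a" using b by (auto simp: D_def)
        have eq: "word_val H (map \<psi> \<sigma>) = b \<longleftrightarrow> word_val H \<sigma> = a" if "\<sigma> \<in> shortlex_nfs H Z r" for \<sigma>
        proof -
          have "\<sigma> \<in> lists Z" using that SLZ by blast
          then show ?thesis using val\<psi> valA a \<psi>_inj by (simp add: inj_on_eq_iff)
        qed
        obtain \<sigma> where \<sigma>: "\<sigma> \<in> shortlex_nfs H Z r" "word_val H \<sigma> = a"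
          "\<And>\<sigma>'. \<sigma>' \<in> shortlex_nfs H Z r \<Longrightarrow> word_val H \<sigma>' = a \<Longrightarrow> \<sigma>' = \<sigma>"
          using ex[OF a(1)] by blast
        show ?thesis
        proof (rule ex1I[of _ "map \<psi> \<sigma>"])
          show "map \<psi> \<sigma> \<in> SL \<epsilon> \<and> word_val H (map \<psi> \<sigma>) = b"
            using True eq[OF \<sigma>(1)] \<sigma>(1,2) by (simp add: SL_def)
          fix \<rho> assume \<rho>: "\<rho> \<in> SL \<epsilon> \<and> word_val H \<rho> = b"
          then obtain \<sigma>' where \<sigma>': "\<sigma>' \<in> shortlex_nfs H Z r" "\<rho> = map \<psi> \<sigma>'"
            using True unfolding SL_def by (simp only: if_True) blast
          then have "word_val H \<sigma>' = a" using \<rho> eq[OF \<sigma>'(1)] by simp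
          then show "\<rho> = map \<psi> \<sigma>" using \<sigma>(3)[OF \<sigma>'(1)] \<sigma>'(2) by simp
        qed
      next
        case False
        then show ?thesis using ex b by (simp add: SL_def D_def)
      qed
    qed
    show "length \<sigma> \<le> length v"
      if \<sigma>: "\<sigma> \<in> SL \<epsilon>" and v: "v \<in> lists (Zs \<epsilon>)" and eq: "word_val H v = word_val H \<sigma>" for \<sigma> v
    proof (cases \<epsilon>)
      case True
      obtain \<sigma>' where \<sigma>': "\<sigma>' \<in> shortlex_nfs H Z r" "\<sigma> = map \<psi> \<sigma>'" using \<sigma> True by (auto simp: SL_def)
      obtain v' where v': "v' \<in> lists Z" "v = map \<psi> v'" using v True by (auto simp: Zs_def lists_image)
      have "\<sigma>' \<in> lists Z" using \<sigma>'(1) SLZ by blast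
      then have "word_val H v' = word_val H \<sigma>'"
        using eq \<sigma>' v' val\<psi> valA \<psi>_inj by (simp add: inj_on_eq_iff)
      then show ?thesis using shortlex_nfs_length[OF \<sigma>'(1) v'(1)] by (simp add: \<sigma>' v')
    next
      case False
      then show ?thesis using \<sigma> v eq shortlex_nfs_length by (simp add: SL_def Zs_def)
    qed
  qed
qed

theorem corollary4p6:
  fixes H :: "('a, 'b) monoid_scheme"
    and Y Z A :: "'a set"
    and T :: "('a \<times> 'a) set"
    and \<Phi> :: "'a \<times> 'a \<Rightarrow> ('a \<times> 'a) list"
    and r :: "('a \<times> 'a) set"
    and \<psi> :: "'a \<Rightarrow> 'a"
    and N_HA N_HpA :: "'a list set"
  assumes "group H"
    and "subgroup A H"
    and "finite Z" and "Z \<subseteq> Y" and "\<forall>z\<in>Z. inv\<^bsub>H\<^esub> z \<in> Z" and "generate H Z = A"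
    and "strict_linear_order_on Z r"
    and "\<psi> \<in> mon (H\<lparr>carrier := A\<rparr>) H" and "\<psi> ` Z \<subseteq> Y"
    and "N_HA \<subseteq> normal_forms H T" and "[] \<in> N_HA"
    and "represents_transversal H A N_HA"
    and "N_HpA \<subseteq> normal_forms H T" and "[] \<in> N_HpA"
    and "represents_transversal H (\<psi> ` A) N_HpA"
  shows
    "(autostackable_structure H Y T \<Phi> \<and>
      regular_lang Y N_HA \<and> regular_lang Y N_HpA \<and>
      (\<forall>z\<in>Z. regular_lang Y
         (last_letter_lang H (normal_forms H T) N_HA (shortlex_nfs H Z r) z)) \<and>
      (\<forall>z'\<in>\<psi> ` Z. regular_lang Y
         (last_letter_lang H (normal_forms H T) N_HpA (map \<psi> ` shortlex_nfs H Z r) z'))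
      \<longrightarrow> autostackable (HNN H A \<psi>)) \<and>
     (alg_stackable_structure H Y T \<Phi> \<and>
      decidable_lang Y N_HA \<and> decidable_lang Y N_HpA \<and>
      (\<forall>z\<in>Z. decidable_lang Y
         (last_letter_lang H (normal_forms H T) N_HA (shortlex_nfs H Z r) z)) \<and>
      (\<forall>z'\<in>\<psi> ` Z. decidable_lang Y
         (last_letter_lang H (normal_forms H T) N_HpA (map \<psi> ` shortlex_nfs H Z r) z'))
      \<longrightarrow> alg_stackable (HNN H A \<psi>))"
proof -
  let ?N = "\<lambda>\<epsilon>. if \<epsilon> then N_HpA else N_HA"
    and ?Zs = "\<lambda>\<epsilon>. if \<epsilon> then \<psi> ` Z else Z"
    and ?SL = "\<lambda>\<epsilon>. if \<epsilon> then map \<psi> ` shortlex_nfs H Z r else shortlex_nfs H Z r"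
    and ?R = "\<lambda>\<epsilon>. word_val H ` (if \<epsilon> then N_HpA else N_HA)"
  \<comment> \<open>Tree and bounded flow alone produce the construction, so both claims share it;
    the equation for \<open>hnn_stackable.N\<close> makes the hypotheses on the given languages
    applicable.\<close>
  have stackable: "\<exists>k. hnn_stackable H A \<psi> ?R Y T \<Phi> ?Zs ?SL k \<and> hnn_stackable.N H ?R T = ?N"
    if Y: "inv_closed_gens H Y" "maximal_tree H Y T" and bf: "bounded_flow_function H Y T \<Phi>"
  proof -
    from bf obtain k where \<Phi>: "flow_function H Y T \<Phi>" "\<forall>e\<in>arcs (cayley H Y). length (\<Phi> e) \<le> k"
      by (auto simp: bounded_flow_function_def)
    note I = hnn_stackableI[OF assms Y \<Phi>]
    have "hnn_stackable.N H ?R T \<epsilon> = ?N \<epsilon>" for \<epsilon>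
      unfolding hnn_stackable.N_def[OF I(1)] by (rule I(2))
    then show ?thesis using I(1) by blast
  qed
  show ?thesis
  proof (intro conjI impI; elim conjE)
    assume "autostackable_structure H Y T \<Phi>"
      and reg: "regular_lang Y N_HA" "regular_lang Y N_HpA"
        "\<forall>z\<in>Z. regular_lang Y
          (last_letter_lang H (normal_forms H T) N_HA (shortlex_nfs H Z r) z)"
        "\<forall>z'\<in>\<psi> ` Z. regular_lang Y
          (last_letter_lang H (normal_forms H T) N_HpA (map \<psi> ` shortlex_nfs H Z r) z')"
    then have str: "inv_closed_gens H Y" "maximal_tree H Y T" "bounded_flow_function H Y T \<Phi>"
      "sync_regular Y 3 (stacking_graph H Y T \<Phi>)"
      by (auto simp: autostackable_structure_def)
    obtain k where k: "hnn_stackable H A \<psi> ?R Y T \<Phi> ?Zs ?SL k" and N: "hnn_stackable.N H ?R T = ?N"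
      using stackable[OF str(1-3)] by blast
    show "autostackable (HNN H A \<psi>)"
      by (rule hnn_stackable.autostackable_G[OF k str(4)]) (use reg in \<open>auto simp: N split: if_splits\<close>)
  next
    assume "alg_stackable_structure H Y T \<Phi>"
      and dec: "decidable_lang Y N_HA" "decidable_lang Y N_HpA"
        "\<forall>z\<in>Z. decidable_lang Y
          (last_letter_lang H (normal_forms H T) N_HA (shortlex_nfs H Z r) z)"
        "\<forall>z'\<in>\<psi> ` Z. decidable_lang Y
          (last_letter_lang H (normal_forms H T) N_HpA (map \<psi> ` shortlex_nfs H Z r) z')"
    then have str: "inv_closed_gens H Y" "maximal_tree H Y T" "bounded_flow_function H Y T \<Phi>"
      "decidable_tuples Y 3 (stacking_graph H Y T \<Phi>)"
      by (auto simp: alg_stackable_structure_def)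
    obtain k where k: "hnn_stackable H A \<psi> ?R Y T \<Phi> ?Zs ?SL k" and N: "hnn_stackable.N H ?R T = ?N"
      using stackable[OF str(1-3)] by blast
    show "alg_stackable (HNN H A \<psi>)"
      by (rule hnn_stackable.alg_stackable_G[OF k str(4)]) (use dec in \<open>auto simp: N split: if_splits\<close>)
  qed
qed

end
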